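(* Let $a<b$ be real numbers, let $0<q_*<1$ be a constant and let $\sigma\ge 1$ be an integer. Then there exist positive constants $D$ and $\delta$, independent of $u$, $N$, $c$ and $h$, such that the following holds. Let $M\ge 1$ be an integer, $h=(b-a)/M$, let $N\ge 1$ be an integer, and let $c\ge 0$ satisfy $$\frac{c}{\sqrt{\chi_N(c)}}\le \frac{q_*}{\sqrt[6]{2}}.$$ Then for every $u\in \widetilde H^\sigma(a,b)$, $$\|\boldsymbol{\pi}_{h,N}^c u-u\|_{L^2(a,b)}\le D\Big\{\sqrt N \Big(\frac h N\Big)^{\sigma}|u|_{\widetilde H^\sigma(a,b)}+\frac{1}{\sqrt{\delta \ln (1/q_* )}}\,(q_* )^{\delta N}\,\|u\|_{L^2(a,b)}\Big\}.$$ Here $\chi_N(c)$ is the $N$-th prolate eigenvalue, $\boldsymbol{\pi}_{h,N}^c$ is the piecewise prolate projection on the uniform partition of $(a,b)$ into $M$ subintervals, and $\widetilde H^\sigma(a,b)$ is the associated broken Sobolev space.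
   Context: Prolate spheroidal wave functions (PSWFs). For $c\ge 0$, the PSWFs (of order zero) $\psi_n(y;c)$, $n=0,1,2,\dots$, are the eigenfunctions on $(-1,1)$ of the singular Sturm-Liouville problem $$-\partial_y\big((1-y^2)\,\partial_y\psi_n(y;c)\big)+c^2y^2\,\psi_n(y;c)=\chi_n(c)\,\psi_n(y;c),\qquad y\in(-1,1),$$ (eigenfunctions being regular at $y=\pm1$), where the eigenvalues $\chi_0(c)<\chi_1(c)<\cdots$ are arranged in ascending order. They form a complete orthogonal system in $L^2(-1,1)$ and are normalized so that $\int_{-1}^1\psi_n(y;c)\psi_m(y;c)\,dy=\delta_{mn}$. For $c=0$ they are the orthonormal Legendre polynomials and $\chi_n(0)=n(n+1)$. Reference projection. Let $I_{\rm ref}=(-1,1)$ and $V_N^c=\mathrm{span}\{\psi_n(\cdot;c):0\le n\le N\}$. The $L^2(I_{\rm ref})$-orthogonal projector $\hat\pi_N^c$ onto $V_N^c$ is $$(\hat\pi_N^c\hat u)(y)=\sum_{n=0}^N\hat u_n(c)\,\psi_n(y;c),\qquad \hat u_n(c)=\int_{-1}^1\hat u(y)\,\psi_n(y;c)\,dy.$$ Partition. For $M\ge 1$ and $h=(b-a)/M$, put $a_i=a+ih$ for $0\le i\le M$, and $I_i=(a_{i-1},a_i)$ for $1\le i\le M$. The interval $I_i$ is the image of $I_{\rm ref}$ under $x=\frac{h}{2}y+\frac{a_{i-1}+a_i}{2}$. For $u$ defined on $(a,b)$, write $u^{I_i}=u|_{I_i}$ and $\hat u^{I_i}(y)=u^{I_i}(x)$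 with $x=\frac{h}{2}y+\frac{a_{i-1}+a_i}{2}$, $y\in I_{\rm ref}$. Piecewise projection. $\boldsymbol{\pi}_{h,N}^c u$ is defined element by element by $$(\boldsymbol{\pi}_{h,N}^c u)|_{I_i}(x)=(\hat\pi_N^c\hat u^{I_i})(y),\qquad x=\tfrac{h}{2}y+\tfrac{a_{i-1}+a_i}{2}\in I_i,\quad 1\le i\le M.$$ Broken Sobolev space. $\widetilde H^\sigma(a,b)=\{u: u^{I_i}\in H^\sigma(I_i),\ 1\le i\le M\}$, where $H^\sigma(I_i)$ is the usual $L^2$-based Sobolev space, with semi-norm $$|u|_{\widetilde H^\sigma(a,b)}=\Big(\sum_{i=1}^M\|\partial_x^\sigma u^{I_i}\|_{L^2(I_i)}^2\Big)^{1/2}.$$ *)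

theory Defs
  imports "HOL-Analysis.Analysis"
begin

section \<open>Prolate spheroidal wave functions of order zero\<close>

text \<open>
  Functions are total on the reals; only their values on \<open>(-1, 1)\<close> are constrained.
  Both endpoints are regular singular points whose indicial exponents are both zero, so near an
  endpoint a solution is either analytic up to the endpoint or unbounded (logarithmic).
  Regularity at \<open>y = 1\<close> and \<open>y = -1\<close> is therefore expressed as boundedness.
\<close>

definition prolate_eigenfunction :: "real \<Rightarrow> real \<Rightarrow> (real \<Rightarrow> real) \<Rightarrow> bool" where
  "prolate_eigenfunction c lam f \<longleftrightarrow>
     (\<forall>y\<in>{-1<..<1}.
        f differentiable (at y) \<and>
        (\<lambda>t. (1 - t\<^sup>2) * deriv f t) differentiable (at y) \<and>
        - deriv (\<lambda>t. (1 - t\<^sup>2) * deriv f t) y + c\<^sup>2 * y\<^sup>2 * f y = lam * f y) \<and>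
     bounded (f ` {-1<..<1}) \<and>
     (\<exists>y\<in>{-1<..<1}. f y \<noteq> 0)"

definition prolate_eigenvalue :: "real \<Rightarrow> real \<Rightarrow> bool" where
  "prolate_eigenvalue c lam \<longleftrightarrow> (\<exists>f. prolate_eigenfunction c lam f)"

text \<open>
  \<open>chi\<close> lists all eigenvalues in ascending order and \<open>\<psi> n\<close> is a normalized eigenfunction for
  \<open>chi n\<close>. For given \<open>c\<close> this determines \<open>chi\<close>, and it determines each \<open>\<psi> n\<close> on \<open>(-1, 1)\<close> up to
  sign; the sign does not affect the projections below. Completeness in \<open>L\<^sup>2(-1, 1)\<close> is a
  consequence of this definition and is not part of it.
\<close>

definition pswf_system :: "real \<Rightarrow> (nat \<Rightarrow> real) \<Rightarrow> (nat \<Rightarrow> real \<Rightarrow> real) \<Rightarrow> bool" where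
  "pswf_system c chi \<psi> \<longleftrightarrow>
     strict_mono chi \<and>
     range chi = {lam. prolate_eigenvalue c lam} \<and>
     (\<forall>n. prolate_eigenfunction c (chi n) (\<psi> n)) \<and>
     (\<forall>m n. (LINT y:{-1<..<1}|lebesgue. \<psi> n y * \<psi> m y) = (if m = n then 1 else 0))"

definition ref_projection :: "(nat \<Rightarrow> real \<Rightarrow> real) \<Rightarrow> nat \<Rightarrow> (real \<Rightarrow> real) \<Rightarrow> real \<Rightarrow> real" where
  "ref_projection \<psi> N v y =
     (\<Sum>n\<le>N. (LINT t:{-1<..<1}|lebesgue. v t * \<psi> n t) * \<psi> n y)"


section \<open>Uniform partition and piecewise projection\<close>

definition mesh :: "real \<Rightarrow> real \<Rightarrow> nat \<Rightarrow> real" where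
  "mesh a b M = (b - a) / real M"

definition node :: "real \<Rightarrow> real \<Rightarrow> nat \<Rightarrow> nat \<Rightarrow> real" where
  "node a b M i = a + real i * mesh a b M"

definition elem :: "real \<Rightarrow> real \<Rightarrow> nat \<Rightarrow> nat \<Rightarrow> real set" where
  "elem a b M i = {node a b M (i - 1)<..<node a b M i}"

definition midpt :: "real \<Rightarrow> real \<Rightarrow> nat \<Rightarrow> nat \<Rightarrow> real" where
  "midpt a b M i = (node a b M (i - 1) + node a b M i) / 2"

definition pullback :: "real \<Rightarrow> real \<Rightarrow> nat \<Rightarrow> nat \<Rightarrow> (real \<Rightarrow> real) \<Rightarrow> real \<Rightarrow> real" where
  "pullback a b M i u y = u (mesh a b M / 2 * y + midpt a b M i)"

text \<open>The elements are disjoint, so at most one summand is nonzero; the value at the nodes is 0.\<close>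

definition piecewise_projection ::
    "(nat \<Rightarrow> real \<Rightarrow> real) \<Rightarrow> real \<Rightarrow> real \<Rightarrow> nat \<Rightarrow> nat \<Rightarrow> (real \<Rightarrow> real) \<Rightarrow> real \<Rightarrow> real" where
  "piecewise_projection \<psi> a b M N u x =
     (\<Sum>i = 1..M.
        if x \<in> elem a b M i
        then ref_projection \<psi> N (pullback a b M i u) ((x - midpt a b M i) / (mesh a b M / 2))
        else 0)"


section \<open>Lebesgue and Sobolev spaces\<close>

definition L2_space :: "real set \<Rightarrow> (real \<Rightarrow> real) set" where
  "L2_space S = {u. set_borel_measurable lebesgue S u \<and>
                    set_integrable lebesgue S (\<lambda>x. (u x)\<^sup>2)}"

definition L2norm :: "real set \<Rightarrow> (real \<Rightarrow> real) \<Rightarrow> real" where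
  "L2norm S u = sqrt (LINT x:S|lebesgue. (u x)\<^sup>2)"

definition test_function :: "real set \<Rightarrow> (real \<Rightarrow> real) \<Rightarrow> bool" where
  "test_function I \<phi> \<longleftrightarrow>
     (\<forall>k x. ((deriv ^^ k) \<phi>) differentiable (at x)) \<and>
     (\<exists>K. compact K \<and> K \<subseteq> I \<and> (\<forall>x. x \<notin> K \<longrightarrow> \<phi> x = 0))"

definition has_weak_deriv :: "nat \<Rightarrow> real set \<Rightarrow> (real \<Rightarrow> real) \<Rightarrow> (real \<Rightarrow> real) \<Rightarrow> bool" where
  "has_weak_deriv k I u v \<longleftrightarrow>
     (\<forall>\<phi>. test_function I \<phi> \<longrightarrow>
        (LINT x:I|lebesgue. u x * (deriv ^^ k) \<phi> x) =
        (-1) ^ k * (LINT x:I|lebesgue. v x * \<phi> x))"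

definition sobolev_space :: "nat \<Rightarrow> real set \<Rightarrow> (real \<Rightarrow> real) set" where
  "sobolev_space s I =
     {u. u \<in> L2_space I \<and> (\<forall>k\<le>s. \<exists>v\<in>L2_space I. has_weak_deriv k I u v)}"

text \<open>Weak derivatives are unique almost everywhere, so norms do not depend on the choice.\<close>

definition weak_deriv :: "nat \<Rightarrow> real set \<Rightarrow> (real \<Rightarrow> real) \<Rightarrow> real \<Rightarrow> real" where
  "weak_deriv k I u = (SOME v. v \<in> L2_space I \<and> has_weak_deriv k I u v)"

definition broken_sobolev :: "real \<Rightarrow> real \<Rightarrow> nat \<Rightarrow> nat \<Rightarrow> (real \<Rightarrow> real) set" where
  "broken_sobolev a b M s = {u. \<forall>i\<in>{1..M}. u \<in> sobolev_space s (elem a b M i)}"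

definition broken_seminorm :: "real \<Rightarrow> real \<Rightarrow> nat \<Rightarrow> nat \<Rightarrow> (real \<Rightarrow> real) \<Rightarrow> real" where
  "broken_seminorm a b M s u =
     sqrt (\<Sum>i = 1..M. (L2norm (elem a b M i) (weak_deriv s (elem a b M i) u))\<^sup>2)"

end

theory Submission
  imports Defs "HOL-Computational_Algebra.Polynomial" "HOL-Complex_Analysis.Great_Picard"
begin

text \<open>
  Split a function on the reference interval into a Legendre polynomial part \<open>p\<close> of degree
  \<open>K \<sim> \<epsilon> N\<close> and a remainder. For the remainder, one weak derivative gains a factor \<open>1 / K\<close>
  because of the recurrence for \<open>\<langle>u, P\<^sub>n\<rangle>\<close> in terms of \<open>\<langle>u', P\<^bsub>n\<plusminus>1\<^esub>\<rangle>\<close>. For \<open>p\<close>, let \<open>A\<close> be the prolate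
  operator and \<open>\<pi>\<close> the projection. The spectral gap gives
  \<open>\<chi>\<^sub>N\<^bsup>m\<^esup> \<parallel>p - \<pi> p\<parallel> \<le> \<parallel>A\<^bsup>m\<^esup> p\<parallel>\<close>, while \<open>A\<close> raises the degree by 2 and has norm at most
  \<open>d (d + 1) + c\<^sup>2\<close> on polynomials of degree \<open>d\<close>. As \<open>\<chi>\<^sub>N \<ge> N\<^sup>2 / 8\<close> and \<open>c\<^sup>2 \<le> q\<^sup>2 \<chi>\<^sub>N\<close>, each of
  \<open>m \<sim> \<epsilon> N\<close> applications of \<open>A\<close> gains a factor \<open>q\<close>. In Legendre coefficients \<open>A\<close> is a
  pentadiagonal matrix; the gap follows by minimizing its Rayleigh quotient on the orthogonal
  complement of the first eigenvectors, since the minimizer is the coefficient sequence of a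
  classical bounded eigenfunction and eigenvalues are simple.
\<close>

section \<open>Legendre polynomials\<close>

text \<open>The spectral gap replaces it. A gap on the orthogonal complement of the first
  eigenfunctions can only fail through an eigenfunction living there, and that is what the
  variational argument has to produce. Coefficient sequences are the right setting for this: bounded
  energy dominates the squared entries by a summable sequence, which yields compactness, and the
  growing diagonal n (n + 1) yields regularity.

  The operator is unbounded and the regularity of u is limited, so powers of A are applied to a
  finite Legendre sum only; the remainder enters through the contraction property of I - \<pi>
  alone. The rate comes from one balance: degrees that stay below 4 e N contribute at most (q - q^2)
  chi_N and the term c^2 x^2 at most q^2 chi_N, which add up to q chi_N. The lower bound for chi_N
  then fixes e, the exponent \<delta> of the statement.\<close>

fun leg :: "nat \<Rightarrow> real poly" where
  "leg 0 = 1"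
| "leg (Suc 0) = [:0, 1:]"
| "leg (Suc (Suc n)) =
     smult (1 / (real n + 2))
       (smult (2 * real n + 3) ([:0, 1:] * leg (Suc n)) - smult (real n + 1) (leg n))"

declare leg.simps(3) [simp del]

abbreviation Leg :: "nat \<Rightarrow> real \<Rightarrow> real" where "Leg n \<equiv> poly (leg n)"
abbreviation dLeg :: "nat \<Rightarrow> real \<Rightarrow> real" where "dLeg n \<equiv> poly (pderiv (leg n))"

lemma leg_rec: "(real n + 2) * Leg (Suc (Suc n)) x = (2 * real n + 3) * (x * Leg (Suc n) x) - (real n + 1) * Leg n x"
  by (simp add: leg.simps(3) field_simps)

lemma dLeg_rec: "(real n + 2) * dLeg (Suc (Suc n)) x
    = (2 * real n + 3) * (Leg (Suc n) x + x * dLeg (Suc n) x) - (real n + 1) * dLeg n x"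
  by (simp add: leg.simps(3) pderiv_smult pderiv_mult pderiv_diff pderiv_pCons field_simps)

text \<open>Proved as a pair because the induction step for each identity uses the other
  one.\<close>

lemma leg_deriv_both:
  "dLeg (Suc n) x = x * dLeg n x + (real n + 1) * Leg n x
   \<and> x * dLeg (Suc n) x - dLeg n x = (real n + 1) * Leg (Suc n) x"
proof (induction n)
  case 0
  then show ?case by (simp add: pderiv_pCons)
next
  case (Suc n)
  then have a: "dLeg n x = x * dLeg (Suc n) x - (real n + 1) * Leg (Suc n) x"
    and b: "dLeg (Suc n) x = x * dLeg n x + (real n + 1) * Leg n x"
    by linarith+
  have n2: "real n + 2 \<noteq> 0" by simp
  have "(real n + 2) * dLeg (Suc (Suc n)) x = (real n + 2) * (x * dLeg (Suc n) x + (real n + 2) * Leg (Suc n) x)"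
    unfolding dLeg_rec a by (simp add: algebra_simps)
  with n2 have 1: "dLeg (Suc (Suc n)) x = x * dLeg (Suc n) x + (real n + 2) * Leg (Suc n) x"
    by (metis mult_cancel_left)
  have "x * dLeg (Suc (Suc n)) x - dLeg (Suc n) x = (real n + 2) * Leg (Suc (Suc n)) x"
    unfolding leg_rec 1 using a b by algebra
  with 1 show ?case by (simp add: add.commute)
qed

lemma leg_deriv_up: "dLeg (Suc n) x = x * dLeg n x + (real n + 1) * Leg n x"
  and leg_deriv_down: "x * dLeg (Suc n) x - dLeg n x = (real n + 1) * Leg (Suc n) x"
  using leg_deriv_both[of n x] by blast+

lemma leg_deriv_weight: "(1 - x\<^sup>2) * dLeg (Suc n) x = (real n + 1) * (Leg n x - x * Leg (Suc n) x)"
  using leg_deriv_up[of n x] leg_deriv_down[of x n] by algebra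

text \<open>Expands the flux of P_(n+1) in the Legendre basis. Paired with a weak derivative, this
  becomes the coefficient recurrence \<open>weak_deriv_leg\<close>.\<close>

lemma leg_deriv_weight': "(1 - x\<^sup>2) * dLeg (Suc n) x
    = (real n + 1) * (real n + 2) / (2 * real n + 3) * (Leg n x - Leg (Suc (Suc n)) x)"
proof -
  have "(2 * real n + 3) * ((1 - x\<^sup>2) * dLeg (Suc n) x)
      = (real n + 1) * ((2 * real n + 3) * Leg n x - (2 * real n + 3) * (x * Leg (Suc n) x))"
    unfolding leg_deriv_weight by (simp add: algebra_simps)
  also have "\<dots> = (real n + 1) * (real n + 2) * (Leg n x - Leg (Suc (Suc n)) x)"
    using leg_rec[of n x] by algebra
  finally show ?thesis by (simp add: field_simps)
qed

lemma leg_deriv_diff: "dLeg (Suc (Suc n)) x - dLeg n x = (2 * real n + 3) * Leg (Suc n) x"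
  using leg_deriv_up[of "Suc n" x] leg_deriv_down[of x n] by (simp add: algebra_simps)

lemma leg_ode_deriv:
  "((\<lambda>x. (1 - x\<^sup>2) * dLeg n x) has_real_derivative - (real n * (real n + 1) * Leg n x)) (at x)"
proof (cases n)
  case 0
  then show ?thesis by simp
next
  case (Suc m)
  have eq: "(\<lambda>x. (1 - x\<^sup>2) * dLeg n x) = (\<lambda>x. (real m + 1) * (Leg m x - x * Leg (Suc m) x))"
    unfolding Suc using leg_deriv_weight by blast
  show ?thesis
    unfolding eq
    apply (rule derivative_eq_intros poly_DERIV refl)+
    using leg_deriv_down[of x m] unfolding Suc by (simp add: ) algebra
qed

text \<open>This is Sonin's function. The weight 1 / (n (n + 1)) is chosen so that Legendre's
  equation cancels the terms in P_n P_n', and what remains of the derivative has the sign of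
  x.\<close>

lemma leg_bound_deriv:
  assumes "n \<ge> 1"
  shows "((\<lambda>x. (Leg n x)\<^sup>2 + 1 / (real n * (real n + 1)) * ((1 - x\<^sup>2) * (dLeg n x)\<^sup>2))
     has_real_derivative 1 / (real n * (real n + 1)) * (2 * x * (dLeg n x)\<^sup>2)) (at x)"
proof -
  define k where "k = real n * (real n + 1)"
  have n0: "k \<noteq> 0" using assms by (simp add: k_def)
  define r where "r = 1 / k"
  have rk: "r * k = 1" using n0 by (simp add: r_def)
  have e: "-2 * x * dLeg n x + (1 - x\<^sup>2) * poly (pderiv (pderiv (leg n))) x = - (k * Leg n x)"
    unfolding k_def
    by (rule DERIV_unique[OF _ leg_ode_deriv])
      (rule derivative_eq_intros poly_DERIV refl | simp)+
  have "((\<lambda>x. (Leg n x)\<^sup>2 + r * ((1 - x\<^sup>2) * (dLeg n x)\<^sup>2))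
     has_real_derivative (2 * Leg n x * dLeg n x + r * (-2 * x * (dLeg n x)\<^sup>2 +
       (1 - x\<^sup>2) * (2 * dLeg n x * poly (pderiv (pderiv (leg n))) x)))) (at x)"
    by (rule derivative_eq_intros poly_DERIV refl | simp)+
  moreover have "2 * Leg n x * dLeg n x + r * (-2 * x * (dLeg n x)\<^sup>2 +
       (1 - x\<^sup>2) * (2 * dLeg n x * poly (pderiv (pderiv (leg n))) x))
     = r * (2 * x * (dLeg n x)\<^sup>2)"
    using e rk by algebra
  ultimately show ?thesis unfolding r_def k_def by simp
qed

lemma leg_at_1: "Leg n 1 = 1"
proof (induction n rule: leg.induct)
  case (3 n)
  then show ?case by (simp add: leg.simps(3) field_simps)
qed auto

lemma leg_at_minus_1: "Leg n (-1) = (-1) ^ n"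
proof (induction n rule: leg.induct)
  case (3 n)
  then show ?case by (simp add: leg.simps(3) field_simps)
qed auto

text \<open>Sonin's function decreases on [-1, 0] and increases on [0, 1], so it is largest at the
  endpoints; there the factor 1 - x^2 removes the derivative term and the value is 1.\<close>

lemma abs_leg_le_1:
  assumes "x \<in> {-1..1}"
  shows "\<bar>Leg n x\<bar> \<le> 1"
proof (cases "n = 0")
  case False
  then have n1: "n \<ge> 1" by simp
  let ?g = "\<lambda>x. (Leg n x)\<^sup>2 + 1 / (real n * (real n + 1)) * ((1 - x\<^sup>2) * (dLeg n x)\<^sup>2)"
  have "?g x \<le> 1"
  proof (cases "x \<ge> 0")
    case True
    have "?g x \<le> ?g 1"
    proof (rule DERIV_nonneg_imp_nondecreasing[where f = ?g and a = x and b = 1])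
      show "x \<le> 1" using assms by simp
      fix y assume "x \<le> y" "y \<le> 1"
      then have "1 / (real n * (real n + 1)) * (2 * y * (dLeg n y)\<^sup>2) \<ge> 0"
        using True by (intro mult_nonneg_nonneg) auto
      with leg_bound_deriv[OF n1, of y] show "\<exists>z. DERIV ?g y :> z \<and> 0 \<le> z" by (intro exI conjI)
    qed
    then show ?thesis by (simp add: leg_at_1)
  next
    case neg: False
    have "?g x \<le> ?g (-1)"
    proof (rule DERIV_nonpos_imp_nonincreasing[where f = ?g and a = "-1" and b = x])
      show "- 1 \<le> x" using assms by simp
      fix y assume "-1 \<le> y" "y \<le> x"
      then have "1 / (real n * (real n + 1)) * (2 * y * (dLeg n y)\<^sup>2) \<le> 0"
        using neg by (intro mult_nonneg_nonpos mult_nonpos_nonneg) auto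
      with leg_bound_deriv[OF n1, of y] show "\<exists>z. DERIV ?g y :> z \<and> z \<le> 0" by (intro exI conjI)
    qed
    then show ?thesis by (simp add: leg_at_minus_1 minus_one_power_iff split: if_splits)
  qed
  moreover have "1 / (real n * (real n + 1)) * ((1 - x\<^sup>2) * (dLeg n x)\<^sup>2) \<ge> 0"
    using assms by (intro mult_nonneg_nonneg) (auto simp: abs_square_le_1 abs_le_iff)
  ultimately have "(Leg n x)\<^sup>2 \<le> 1" by linarith
  then show ?thesis by (simp add: abs_square_le_1)
qed simp

text \<open>Only polynomial growth in n matters: it allows termwise differentiation of Legendre
  series with rapidly decaying coefficients.\<close>

lemma abs_dleg_le:
  assumes "x \<in> {-1..1}"
  shows "\<bar>dLeg n x\<bar> \<le> (real n + 1)\<^sup>2"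
proof (induction n rule: leg.induct)
  case (3 n)
  have "\<bar>dLeg (Suc (Suc n)) x\<bar> \<le> \<bar>dLeg n x\<bar> + (2 * real n + 3) * \<bar>Leg (Suc n) x\<bar>"
  proof -
    have "dLeg (Suc (Suc n)) x = dLeg n x + (2 * real n + 3) * Leg (Suc n) x"
      using leg_deriv_diff[of n x] by linarith
    then have "\<bar>dLeg (Suc (Suc n)) x\<bar> \<le> \<bar>dLeg n x\<bar> + \<bar>(2 * real n + 3) * Leg (Suc n) x\<bar>"
      by (metis abs_triangle_ineq)
    then show ?thesis by (simp add: abs_mult)
  qed
  also have "\<dots> \<le> (real n + 1)\<^sup>2 + (2 * real n + 3) * 1"
    by (intro add_mono mult_left_mono abs_leg_le_1 assms 3) auto
  also have "\<dots> \<le> (real (Suc (Suc n)) + 1)\<^sup>2" by (simp add: power2_eq_square algebra_simps)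
  finally show ?case .
qed (simp_all add: pderiv_pCons)

lemma leg_degree: "degree (leg n) = n \<and> leg n \<noteq> 0"
proof (induction n rule: leg.induct)
  case (3 n)
  have d: "degree ([:0, 1:] * leg (Suc n)) = Suc (Suc n)"
    using 3 by (subst degree_mult_eq) auto
  let ?p = "smult (2 * real n + 3) ([:0, 1:] * leg (Suc n))"
  have d1: "degree ?p = Suc (Suc n)" by (subst degree_smult_eq) (simp only: d, simp)
  have "degree (smult (real n + 1) (leg n)) \<le> n" using 3 by simp
  then have "degree (?p - smult (real n + 1) (leg n)) = degree ?p"
    using degree_add_eq_left[of "- smult (real n + 1) (leg n)" ?p] d1 by (simp only: degree_minus diff_conv_add_uminus)
  then have "degree (leg (Suc (Suc n))) = Suc (Suc n)" using d1 by (simp only: leg.simps(3) degree_smult_eq) simp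
  moreover then have "leg (Suc (Suc n)) \<noteq> 0" by (metis degree_0 nat.distinct(1))
  ultimately show ?case by simp
qed auto

lemma leg_span:
  fixes p :: "real poly"
  assumes "degree p \<le> n"
  shows "\<exists>t. p = (\<Sum>k\<le>n. smult (t k) (leg k))"
  using assms
proof (induction n arbitrary: p)
  case 0
  then obtain a where "p = [:a:]" by (metis degree_eq_zeroE le_zero_eq)
  then show ?case by (intro exI[of _ "\<lambda>_. a"]) simp
next
  case (Suc n)
  define s where "s = coeff p (Suc n) / coeff (leg (Suc n)) (Suc n)"
  have l: "coeff (leg (Suc n)) (Suc n) \<noteq> 0" "degree (leg (Suc n)) = Suc n"
    using leg_degree[of "Suc n"] leading_coeff_neq_0[of "leg (Suc n)"] by simp_all
  have "degree (p - smult s (leg (Suc n))) \<le> n"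
  proof (rule degree_le, intro allI impI)
    fix i assume "n < i"
    then consider "i = Suc n" | "i > Suc n" by linarith
    then show "coeff (p - smult s (leg (Suc n))) i = 0"
    proof cases
      case 1
      then show ?thesis using l by (simp add: s_def)
    next
      case 2
      then show ?thesis using l Suc.prems coeff_eq_0[of p i] coeff_eq_0[of "leg (Suc n)" i] by simp
    qed
  qed
  from Suc.IH[OF this] obtain t where t: "p - smult s (leg (Suc n)) = (\<Sum>k\<le>n. smult (t k) (leg k))" by blast
  have "p = (\<Sum>k\<le>Suc n. smult ((t(Suc n := s)) k) (leg k))"
    using t by (simp add: algebra_simps del: leg.simps)
  then show ?case by blast
qed

section \<open>The space \<open>L\<^sup>2(-1, 1)\<close>\<close>

lemma LINT_lebesgue_on:
  fixes f :: "real \<Rightarrow> real"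
  assumes "S \<in> sets lebesgue"
  shows "(LINT x:S|lebesgue. f x) = (\<integral>x. f x \<partial>lebesgue_on S)"
  using assms by (simp add: integral_restrict_space set_lebesgue_integral_def)

lemma set_integrable_lebesgue_on:
  fixes f :: "real \<Rightarrow> real"
  assumes "S \<in> sets lebesgue"
  shows "set_integrable lebesgue S f \<longleftrightarrow> integrable (lebesgue_on S) f"
  using assms by (simp add: set_integrable_eq)

lemma L2_space_iff:
  assumes "S \<in> sets lebesgue"
  shows "u \<in> L2_space S \<longleftrightarrow>
    u \<in> borel_measurable (lebesgue_on S) \<and> integrable (lebesgue_on S) (\<lambda>x. (u x)\<^sup>2)"
  using assms
  by (simp add: L2_space_def set_integrable_lebesgue_on set_borel_measurable_def
      borel_measurable_restrict_space_iff)

lemma L2_mult_integrable: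
  assumes S: "S \<in> sets lebesgue" and u: "u \<in> L2_space S" and v: "v \<in> L2_space S"
  shows "integrable (lebesgue_on S) (\<lambda>x. u x * v x)"
proof (rule Bochner_Integration.integrable_bound)
  show "integrable (lebesgue_on S) (\<lambda>x. (u x)\<^sup>2 + (v x)\<^sup>2)"
    using u v by (simp add: L2_space_iff[OF S])
  show "(\<lambda>x. u x * v x) \<in> borel_measurable (lebesgue_on S)"
    using u v by (auto simp: L2_space_iff[OF S])
  have "\<bar>a * b\<bar> \<le> a\<^sup>2 + b\<^sup>2" for a b :: real
    using sum_squares_bound[of "\<bar>a\<bar>" "\<bar>b\<bar>"] mult_nonneg_nonneg[OF abs_ge_zero abs_ge_zero, of a b]
    unfolding abs_mult power2_abs mult.assoc by linarith
  then show "AE x in lebesgue_on S. norm (u x * v x) \<le> norm ((u x)\<^sup>2 + (v x)\<^sup>2)"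
    by (simp add: order_trans[OF _ abs_ge_self])
qed

lemma L2_add:
  assumes S: "S \<in> sets lebesgue" and u: "u \<in> L2_space S" and v: "v \<in> L2_space S"
  shows "(\<lambda>x. u x + v x) \<in> L2_space S"
proof -
  have "integrable (lebesgue_on S) (\<lambda>x. (u x)\<^sup>2 + (v x)\<^sup>2 + 2 * (u x * v x))"
    using u v L2_mult_integrable[OF S u v] by (simp add: L2_space_iff[OF S])
  then have "integrable (lebesgue_on S) (\<lambda>x. (u x + v x)\<^sup>2)"
    by (simp add: power2_sum mult.assoc)
  then show ?thesis using u v by (auto simp: L2_space_iff[OF S])
qed

lemma L2_cmult:
  assumes S: "S \<in> sets lebesgue" and u: "u \<in> L2_space S"
  shows "(\<lambda>x. c * u x) \<in> L2_space S"
  using u by (auto simp: L2_space_iff[OF S] power_mult_distrib)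

lemma L2_diff:
  assumes S: "S \<in> sets lebesgue" and u: "u \<in> L2_space S" and v: "v \<in> L2_space S"
  shows "(\<lambda>x. u x - v x) \<in> L2_space S"
  using L2_add[OF S u L2_cmult[OF S v, of "-1"]] by simp

lemma L2_sum:
  assumes S: "S \<in> sets lebesgue" and "\<And>k. k \<in> A \<Longrightarrow> f k \<in> L2_space S"
  shows "(\<lambda>x. \<Sum>k\<in>A. f k x) \<in> L2_space S"
  using assms(2)
proof (induction A rule: infinite_finite_induct)
  case (insert x F)
  then show ?case by (simp add: L2_add[OF S])
qed (simp_all add: L2_space_iff[OF S])

lemma L2_times_bounded:
  assumes S: "S \<in> sets lebesgue" and u: "u \<in> L2_space S"
    and g: "g \<in> borel_measurable (lebesgue_on S)" and B: "\<And>x. x \<in> S \<Longrightarrow> \<bar>g x\<bar> \<le> B"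
  shows "(\<lambda>x. g x * u x) \<in> L2_space S"
proof -
  have "integrable (lebesgue_on S) (\<lambda>x. (g x * u x)\<^sup>2)"
  proof (rule Bochner_Integration.integrable_bound)
    show "integrable (lebesgue_on S) (\<lambda>x. B\<^sup>2 * (u x)\<^sup>2)"
      using u by (simp add: L2_space_iff[OF S])
    show "(\<lambda>x. (g x * u x)\<^sup>2) \<in> borel_measurable (lebesgue_on S)"
      using u g by (auto simp: L2_space_iff[OF S])
    show "AE x in lebesgue_on S. norm ((g x * u x)\<^sup>2) \<le> norm (B\<^sup>2 * (u x)\<^sup>2)"
    proof (rule AE_I2)
      fix x assume "x \<in> space (lebesgue_on S)"
      then have "(g x)\<^sup>2 \<le> B\<^sup>2" using B[of x] by (simp add: abs_le_square_iff[symmetric])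
      then show "norm ((g x * u x)\<^sup>2) \<le> norm (B\<^sup>2 * (u x)\<^sup>2)"
        by (simp add: power_mult_distrib mult_right_mono)
    qed
  qed
  then show ?thesis using u g by (auto simp: L2_space_iff[OF S])
qed

abbreviation Iref :: "real set" where "Iref \<equiv> {-1<..<1}"

lemma Iref_lebesgue [simp]: "Iref \<in> sets lebesgue" by simp

lemma finite_measure_Iref: "finite_measure (lebesgue_on Iref)"
  by (rule finite_measureI) (simp add: emeasure_restrict_space)

lemma one_L2: "(\<lambda>x. 1) \<in> L2_space Iref"
proof -
  interpret finite_measure "lebesgue_on Iref" by (rule finite_measure_Iref)
  show ?thesis by (simp add: L2_space_iff)
qed

lemma L2_bounded_continuous:
  assumes "continuous_on Iref f" and "\<And>x. x \<in> Iref \<Longrightarrow> \<bar>f x\<bar> \<le> B"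
  shows "f \<in> L2_space Iref"
  using L2_times_bounded[OF _ one_L2 _ assms(2)] continuous_imp_measurable_on_sets_lebesgue[OF assms(1)]
  by simp

lemma L2_continuous_Icc:
  assumes "continuous_on {-1..1} f"
  shows "f \<in> L2_space Iref"
proof -
  have "bounded (f ` {-1..1})"
    using assms by (intro compact_imp_bounded compact_continuous_image) auto
  then obtain B where "\<forall>x\<in>{-1..1}. norm (f x) \<le> B" by (auto simp: bounded_iff)
  moreover have "continuous_on Iref f" by (rule continuous_on_subset[OF assms]) auto
  ultimately show ?thesis by (intro L2_bounded_continuous[of f B]) auto
qed

lemma L2_poly [simp]: "poly p \<in> L2_space Iref"
  by (intro L2_continuous_Icc continuous_intros)

lemma L2_imp_integrable:
  assumes "f \<in> L2_space Iref"
  shows "integrable (lebesgue_on Iref) f"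
  using L2_mult_integrable[OF Iref_lebesgue assms one_L2] by simp

lemma poly_bounded_Iref: "\<exists>B. B \<ge> 0 \<and> (\<forall>x\<in>Iref. \<bar>poly q x\<bar> \<le> B)" for q :: "real poly"
proof -
  have "bounded (poly q ` {-1..1})"
    by (intro compact_imp_bounded compact_continuous_image continuous_intros) auto
  then obtain B where "\<forall>x\<in>{-1..1}. norm (poly q x) \<le> B" by (auto simp: bounded_iff)
  then show ?thesis by (intro exI[of _ "max B 0"]) (auto simp: le_max_iff_disj)
qed

definition ip :: "(real \<Rightarrow> real) \<Rightarrow> (real \<Rightarrow> real) \<Rightarrow> real" where
  "ip f g = (\<integral>x. f x * g x \<partial>lebesgue_on Iref)"

abbreviation nsq :: "(real \<Rightarrow> real) \<Rightarrow> real" where "nsq f \<equiv> ip f f"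

lemma ip_LINT: "(LINT x:Iref|lebesgue. f x * g x) = ip f g"
  by (simp add: ip_def LINT_lebesgue_on)

lemma ip_commute: "ip f g = ip g f" by (simp add: ip_def mult.commute)

lemma ip_cong: "(\<And>x. x \<in> Iref \<Longrightarrow> f x = f' x) \<Longrightarrow> (\<And>x. x \<in> Iref \<Longrightarrow> g x = g' x) \<Longrightarrow> ip f g = ip f' g'"
  unfolding ip_def by (rule Bochner_Integration.integral_cong) auto

lemma ip_nonneg: "nsq f \<ge> 0"
  unfolding ip_def by (rule Bochner_Integration.integral_nonneg) simp

lemma ip_cmult_left: "ip (\<lambda>x. c * f x) g = c * ip f g"
  unfolding ip_def by (simp add: mult.assoc)

lemma ip_cmult_right: "ip f (\<lambda>x. c * g x) = c * ip f g"
  unfolding ip_def by (simp add: mult.left_commute)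

lemma ip_add_left:
  assumes "f \<in> L2_space Iref" "g \<in> L2_space Iref" "h \<in> L2_space Iref"
  shows "ip (\<lambda>x. f x + g x) h = ip f h + ip g h"
  unfolding ip_def distrib_right
  by (rule Bochner_Integration.integral_add) (auto intro: L2_mult_integrable assms)

lemma ip_diff_left:
  assumes "f \<in> L2_space Iref" "g \<in> L2_space Iref" "h \<in> L2_space Iref"
  shows "ip (\<lambda>x. f x - g x) h = ip f h - ip g h"
  unfolding ip_def left_diff_distrib
  by (rule Bochner_Integration.integral_diff) (auto intro: L2_mult_integrable assms)

lemma ip_diff_right:
  assumes "f \<in> L2_space Iref" "g \<in> L2_space Iref" "h \<in> L2_space Iref"
  shows "ip h (\<lambda>x. f x - g x) = ip h f - ip h g"
  using ip_diff_left[OF assms] by (simp add: ip_commute)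

lemma ip_sum_left:
  assumes "\<And>k. k \<in> A \<Longrightarrow> f k \<in> L2_space Iref" "h \<in> L2_space Iref"
  shows "ip (\<lambda>x. \<Sum>k\<in>A. f k x) h = (\<Sum>k\<in>A. ip (f k) h)"
  unfolding ip_def sum_distrib_right
  by (rule Bochner_Integration.integral_sum) (auto intro: L2_mult_integrable assms)

lemma ip_sum_right:
  assumes "\<And>k. k \<in> A \<Longrightarrow> f k \<in> L2_space Iref" "h \<in> L2_space Iref"
  shows "ip h (\<lambda>x. \<Sum>k\<in>A. f k x) = (\<Sum>k\<in>A. ip h (f k))"
  using ip_sum_left[OF assms] by (simp add: ip_commute)

lemma ip_diff_diff:
  assumes "f \<in> L2_space Iref" "g \<in> L2_space Iref"
  shows "nsq (\<lambda>x. f x - g x) = nsq f - 2 * ip f g + nsq g"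
  using assms by (simp add: ip_diff_left ip_diff_right L2_diff ip_commute[of g f])

text \<open>Completing the square in the coefficients. Choosing \<open>t k\<close> as the Fourier
  coefficient gives Bessel's inequality, and nonnegativity of the last sum is the best approximation
  property.\<close>

lemma ip_orthonormal_diff:
  fixes \<phi> :: "nat \<Rightarrow> real \<Rightarrow> real"
  assumes "\<And>k. \<phi> k \<in> L2_space Iref" and "\<And>m n. ip (\<phi> m) (\<phi> n) = (if m = n then 1 else 0)"
    and u: "u \<in> L2_space Iref" and A: "finite A"
  shows "nsq (\<lambda>x. u x - (\<Sum>k\<in>A. t k * \<phi> k x))
     = nsq u - (\<Sum>k\<in>A. (ip u (\<phi> k))\<^sup>2) + (\<Sum>k\<in>A. (t k - ip u (\<phi> k))\<^sup>2)"
proof -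
  define s where "s = (\<lambda>x. \<Sum>k\<in>A. t k * \<phi> k x)"
  have L: "(\<lambda>x. t k * \<phi> k x) \<in> L2_space Iref" for k by (intro L2_cmult assms) simp
  have s: "s \<in> L2_space Iref" unfolding s_def by (intro L2_sum L) simp
  have us: "ip u s = (\<Sum>k\<in>A. t k * ip u (\<phi> k))"
    unfolding s_def by (subst ip_sum_right) (auto simp: L u ip_cmult_right)
  have "ip (\<phi> j) s = (if j \<in> A then t j else 0)" for j
    unfolding s_def using A by (subst ip_sum_right) (auto simp: L assms ip_cmult_right if_distrib cong: if_cong)
  then have ss: "nsq s = (\<Sum>k\<in>A. t k * t k)"
    by (subst s_def, subst ip_sum_left) (auto simp: L s ip_cmult_left intro!: sum.cong)
  have "nsq (\<lambda>x. u x - s x) = nsq u - 2 * (\<Sum>k\<in>A. t k * ip u (\<phi> k)) + (\<Sum>k\<in>A. t k * t k)"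
    by (simp add: ip_diff_diff u s us ss)
  also have "\<dots> = nsq u - (\<Sum>k\<in>A. (ip u (\<phi> k))\<^sup>2) + (\<Sum>k\<in>A. (t k - ip u (\<phi> k))\<^sup>2)"
    by (simp add: power2_diff sum.distrib sum_subtractf sum_distrib_left power2_eq_square algebra_simps)
  finally show ?thesis unfolding s_def .
qed

lemma bessel_finite:
  fixes \<phi> :: "nat \<Rightarrow> real \<Rightarrow> real"
  assumes "\<And>k. \<phi> k \<in> L2_space Iref" and "\<And>m n. ip (\<phi> m) (\<phi> n) = (if m = n then 1 else 0)"
    and u: "u \<in> L2_space Iref" and A: "finite A"
  shows "(\<Sum>k\<in>A. (ip u (\<phi> k))\<^sup>2) \<le> nsq u"
  using ip_orthonormal_diff[OF assms, of "\<lambda>k. ip u (\<phi> k)"]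
    ip_nonneg[of "\<lambda>x. u x - (\<Sum>k\<in>A. ip u (\<phi> k) * \<phi> k x)"] by simp

lemma bessel_summable:
  fixes \<phi> :: "nat \<Rightarrow> real \<Rightarrow> real"
  assumes "\<And>k. \<phi> k \<in> L2_space Iref" and "\<And>m n. ip (\<phi> m) (\<phi> n) = (if m = n then 1 else 0)"
    and u: "u \<in> L2_space Iref"
  shows "summable (\<lambda>k. (ip u (\<phi> k))\<^sup>2)"
  by (rule summableI_nonneg_bounded[where x = "nsq u"]) (auto intro: bessel_finite[OF assms])

text \<open>Differentiability is asked for in the open interval only, with continuity up to the
  endpoints. This suits Wronskians of prolate functions, whose derivative is not controlled at -1
  and 1.\<close>

lemma ip_FTC:
  fixes h :: "real \<Rightarrow> real"
  assumes cont: "continuous_on {-1..1} h"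
    and der: "\<And>x. x \<in> Iref \<Longrightarrow> (h has_real_derivative h' x) (at x)"
    and int: "integrable (lebesgue_on Iref) h'"
  shows "(\<integral>x. h' x \<partial>lebesgue_on Iref) = h 1 - h (-1)"
proof -
  have "(h' has_integral (h 1 - h (-1))) {-1..1}"
    by (rule fundamental_theorem_of_calculus_interior)
      (auto intro: cont der simp flip: has_real_derivative_iff_has_vector_derivative)
  then have 1: "(h' has_integral (h 1 - h (-1))) Iref"
    using has_integral_Icc_iff_Ioo by blast
  have "set_integrable lebesgue Iref h'" using int by (simp add: set_integrable_lebesgue_on)
  from has_integral_set_lebesgue[OF this] 1 show ?thesis
    by (metis LINT_lebesgue_on Iref_lebesgue has_integral_unique)
qed

lemma ip_add_right:
  assumes "f \<in> L2_space Iref" "g \<in> L2_space Iref" "h \<in> L2_space Iref"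
  shows "ip h (\<lambda>x. f x + g x) = ip h f + ip h g"
  using ip_add_left[OF assms] by (simp add: ip_commute)

section \<open>Orthogonality and norms of the Legendre polynomials\<close>

lemma leg_orthogonal:
  assumes "m \<noteq> n"
  shows "ip (Leg m) (Leg n) = 0"
proof -
  \<comment> \<open>The weighted Wronskian: it vanishes at both endpoints, and by Legendre's
    equation its derivative is the product of the two polynomials times the difference of their
    eigenvalues.\<close>
  let ?h = "\<lambda>x. (1 - x\<^sup>2) * dLeg m x * Leg n x - (1 - x\<^sup>2) * dLeg n x * Leg m x"
  define k where "k = real n * (real n + 1) - real m * (real m + 1)"
  have der: "(?h has_real_derivative k * (Leg m x * Leg n x)) (at x)" for x
  proof -
    have "(?h has_real_derivative
       (- (real m * (real m + 1) * Leg m x) * Leg n x + dLeg n x * ((1 - x\<^sup>2) * dLeg m x))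
       - (- (real n * (real n + 1) * Leg n x) * Leg m x + dLeg m x * ((1 - x\<^sup>2) * dLeg n x))) (at x)"
      by (intro DERIV_diff DERIV_mult leg_ode_deriv poly_DERIV)
    then show ?thesis by (simp add: k_def algebra_simps)
  qed
  have "(\<integral>x. k * (Leg m x * Leg n x) \<partial>lebesgue_on Iref) = ?h 1 - ?h (-1)"
    by (rule ip_FTC) (auto intro!: continuous_intros der integrable_mult_right L2_mult_integrable)
  then have "k * ip (Leg m) (Leg n) = 0" by (simp add: ip_def)
  moreover have "k = (real n - real m) * (real n + real m + 1)"
    by (simp add: k_def algebra_simps)
  then have "k \<noteq> 0" using assms by simp
  ultimately show ?thesis by simp
qed

lemma leg_ip_x: "ip (Leg m) (\<lambda>x. x * g x) = ip (\<lambda>x. x * Leg m x) g"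
  by (simp add: ip_def mult.assoc mult.left_commute)

text \<open>The inner product of x P_(n+1) with P_n is evaluated twice, expanding either x P_(n+1)
  or x P_n by the three-term recurrence. Orthogonality leaves one norm on each side, which relates
  consecutive norms.\<close>

lemma leg_norm: "nsq (Leg n) = 2 / (2 * real n + 1)"
proof (induction n)
  case 0
  have "(\<integral>x. 1 \<partial>lebesgue_on Iref) = 1 - (-1::real)"
    using L2_imp_integrable[OF one_L2]
    by (intro ip_FTC[where h = "\<lambda>x. x"]) (auto intro!: continuous_intros derivative_eq_intros)
  then show ?case by (simp add: ip_def)
next
  case (Suc n)
  have r: "x * Leg (Suc n) x = (real n + 2) / (2 * real n + 3) * Leg (Suc (Suc n)) x + (real n + 1) / (2 * real n + 3) * Leg n x" for x
  proof -
    have "x * Leg (Suc n) x = ((real n + 2) * Leg (Suc (Suc n)) x + (real n + 1) * Leg n x) / (2 * real n + 3)"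
      using leg_rec[of n x] by (simp add: nonzero_eq_divide_eq mult.commute)
    then show ?thesis by (simp only: times_divide_eq_left flip: add_divide_distrib)
  qed
  have "ip (\<lambda>x. x * Leg (Suc n) x) (Leg n) = (real n + 1) / (2 * real n + 3) * nsq (Leg n)"
    unfolding r by (subst ip_add_left) (simp_all add: L2_cmult ip_cmult_left leg_orthogonal del: times_divide_eq_left)
  moreover have "ip (\<lambda>x. x * Leg (Suc n) x) (Leg n) = ip (\<lambda>x. x * Leg n x) (Leg (Suc n))"
    by (simp only: leg_ip_x[symmetric] ip_commute[of "Leg (Suc n)"])
  moreover have "(2 * real n + 1) * ip (\<lambda>x. x * Leg n x) (Leg (Suc n)) = (real n + 1) * nsq (Leg (Suc n))"
  proof (cases n)
    case 0
    have "ip (\<lambda>x. x * Leg 0 x) (Leg (Suc 0)) = nsq (Leg (Suc 0))" by (rule ip_cong) auto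
    then show ?thesis using 0 by simp
  next
    case (Suc k)
    have "(2 * real n + 1) * (x * Leg n x) = (real n + 1) * Leg (Suc n) x + real n * Leg k x" for x
      using leg_rec[of k x] unfolding Suc by (simp add: algebra_simps)
    then have "ip (\<lambda>x. (2 * real n + 1) * (x * Leg n x)) (Leg (Suc n))
      = ip (\<lambda>x. (real n + 1) * Leg (Suc n) x + real n * Leg k x) (Leg (Suc n))" by simp
    then show ?thesis
      using Suc by (simp add: ip_add_left ip_cmult_left L2_cmult leg_orthogonal)
  qed
  ultimately have "(real n + 1) * nsq (Leg (Suc n))
      = (2 * real n + 1) * ((real n + 1) / (2 * real n + 3) * (2 / (2 * real n + 1)))"
    using Suc by simp
  also have "\<dots> = (real n + 1) * (2 / (2 * real n + 3))"
  proof -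
    have "A * (B / C * (2 / A)) = B * (2 / C)" if "A \<noteq> 0" for A B C :: real using that by simp
    from this[of "2 * real n + 1"] show ?thesis by (simp only:)
  qed
  finally have "nsq (Leg (Suc n)) = 2 / (2 * real n + 3)"
    using of_nat_0_le_iff[of n, where 'a = real] by (subst (asm) mult_cancel_left) linarith
  then show ?case by (simp add: algebra_simps)
qed

definition leg_on :: "nat \<Rightarrow> real \<Rightarrow> real" where
  "leg_on n x = sqrt (real n + 1/2) * Leg n x"

lemma leg_on_L2 [simp]: "leg_on n \<in> L2_space Iref"
  unfolding leg_on_def by (intro L2_continuous_Icc continuous_intros)

lemma leg_on_orthonormal: "ip (leg_on m) (leg_on n) = (if m = n then 1 else 0)"
proof -
  have "ip (leg_on m) (leg_on n) = sqrt (real m + 1/2) * (sqrt (real n + 1/2) * ip (Leg m) (Leg n))"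
    unfolding leg_on_def by (simp add: ip_cmult_left ip_cmult_right)
  also have "\<dots> = (if m = n then 1 else 0)"
  proof (cases "m = n")
    case True
    have "sqrt (real n + 1/2) * (sqrt (real n + 1/2) * nsq (Leg n)) = (real n + 1/2) * (2 / (2 * real n + 1))"
      by (simp only: leg_norm mult.assoc[symmetric] real_sqrt_mult_self)
    then show ?thesis using True by (simp add: field_simps)
  qed (simp add: leg_orthogonal)
  finally show ?thesis .
qed

definition coef :: "(real \<Rightarrow> real) \<Rightarrow> nat \<Rightarrow> real" where "coef u n = ip u (leg_on n)"

lemma coef_sq_summable: "u \<in> L2_space Iref \<Longrightarrow> summable (\<lambda>n. (coef u n)\<^sup>2)"
  unfolding coef_def by (rule bessel_summable) (auto simp: leg_on_orthonormal)

lemma poly_leg_on_span: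
  assumes "degree p \<le> n"
  shows "\<exists>t. \<forall>x. poly p x = (\<Sum>k\<le>n. t k * leg_on k x)"
proof -
  obtain t where t: "p = (\<Sum>k\<le>n. smult (t k) (leg k))" using leg_span[OF assms] by blast
  have "\<forall>x. poly p x = (\<Sum>k\<le>n. (t k / sqrt (real k + 1/2)) * leg_on k x)"
    unfolding leg_on_def by (subst t) (simp add: poly_sum)
  then show ?thesis by (intro exI[of _ "\<lambda>k. t k / sqrt (real k + 1/2)"])
qed

section \<open>Density of polynomials and Parseval's identity\<close>

lemma ip_sq_triangle:
  assumes "f \<in> L2_space Iref" "g \<in> L2_space Iref"
  shows "nsq (\<lambda>x. f x + g x) \<le> 2 * nsq f + 2 * nsq g"
proof -
  have "nsq (\<lambda>x. f x + g x) + nsq (\<lambda>x. f x - g x) = 2 * nsq f + 2 * nsq g"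
    using assms
    by (simp add: ip_diff_left ip_diff_right ip_add_left ip_add_right L2_add L2_diff ip_commute[of g f])
  then show ?thesis using ip_nonneg[of "\<lambda>x. f x - g x"] by linarith
qed

lemma ip_dominated_convergence:
  assumes f: "f \<in> borel_measurable (lebesgue_on Iref)"
    and s: "\<And>n. s n \<in> borel_measurable (lebesgue_on Iref)"
    and w: "integrable (lebesgue_on Iref) w"
    and lim: "AE x in lebesgue_on Iref. (\<lambda>n. s n x) \<longlonglongrightarrow> f x"
    and bd: "\<And>n x. x \<in> Iref \<Longrightarrow> (f x - s n x)\<^sup>2 \<le> w x"
  shows "(\<lambda>n. nsq (\<lambda>x. f x - s n x)) \<longlonglongrightarrow> 0"
proof -
  have "(\<lambda>n. \<integral>x. (f x - s n x)\<^sup>2 \<partial>lebesgue_on Iref) \<longlonglongrightarrow> (\<integral>x. 0 \<partial>lebesgue_on Iref)"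
  proof (rule integral_dominated_convergence[OF _ _ w])
    show "AE x in lebesgue_on Iref. (\<lambda>n. (f x - s n x)\<^sup>2) \<longlonglongrightarrow> 0"
      using lim
    proof eventually_elim
      case (elim x)
      have "(\<lambda>n. (f x - s n x)\<^sup>2) \<longlonglongrightarrow> (f x - f x)\<^sup>2" by (intro tendsto_intros elim)
      then show ?case by simp
    qed
  qed (use f s bd in \<open>auto intro!: borel_measurable_power borel_measurable_diff\<close>)
  then show ?thesis by (simp add: ip_def power2_eq_square)
qed

definition clip :: "real \<Rightarrow> real \<Rightarrow> real" where "clip M y = max (- M) (min M y)"

lemma clip_measurable [measurable]: "clip M \<in> borel_measurable borel"
  unfolding clip_def by measurable

lemma abs_clip_le: "M \<ge> 0 \<Longrightarrow> \<bar>clip M y\<bar> \<le> M" by (auto simp: clip_def)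

lemma clip_approx:
  assumes "u \<in> L2_space Iref" "e > 0"
  shows "\<exists>M\<ge>0. nsq (\<lambda>x. u x - clip M (u x)) < e"
proof -
  have u: "u \<in> borel_measurable (lebesgue_on Iref)" "integrable (lebesgue_on Iref) (\<lambda>x. (u x)\<^sup>2)"
    using assms(1) by (auto simp: L2_space_iff)
  have "(\<lambda>n. nsq (\<lambda>x. u x - clip (real n) (u x))) \<longlonglongrightarrow> 0"
  proof (rule ip_dominated_convergence[OF u(1) _ u(2)])
    show "(\<lambda>x. clip (real n) (u x)) \<in> borel_measurable (lebesgue_on Iref)" for n
      by (rule measurable_compose[OF u(1) clip_measurable])
    show "AE x in lebesgue_on Iref. (\<lambda>n. clip (real n) (u x)) \<longlonglongrightarrow> u x"
    proof (rule AE_I2)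
      fix x
      obtain N :: nat where N: "\<bar>u x\<bar> \<le> real N" using real_arch_simple by blast
      have "eventually (\<lambda>n. clip (real n) (u x) = u x) sequentially"
        using eventually_ge_at_top[of N] by eventually_elim (use N in \<open>auto simp: clip_def\<close>)
      then show "(\<lambda>n. clip (real n) (u x)) \<longlonglongrightarrow> u x" by (rule tendsto_eventually)
    qed
    show "(u x - clip (real n) (u x))\<^sup>2 \<le> (u x)\<^sup>2" for n x
      by (subst abs_le_square_iff[symmetric]) (auto simp: clip_def)
  qed
  then have "eventually (\<lambda>n. nsq (\<lambda>x. u x - clip (real n) (u x)) < e) sequentially"
    using assms(2) by (rule order_tendstoD)
  then obtain n where "nsq (\<lambda>x. u x - clip (real n) (u x)) < e"
    using eventually_happens'[OF sequentially_bot] by blast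
  then show ?thesis by (intro exI[of _ "real n"] conjI) simp
qed

text \<open>Measurability provides continuous functions that converge almost everywhere but need not
  be dominated. Clipping them at M as well supplies the majorant.\<close>

lemma continuous_approx_clip:
  assumes "u \<in> L2_space Iref" "e > 0" "M \<ge> 0"
  shows "\<exists>h. continuous_on UNIV h \<and> nsq (\<lambda>x. clip M (u x) - h x) < e"
proof -
  have u: "u \<in> borel_measurable (lebesgue_on Iref)"
    using assms(1) by (auto simp: L2_space_iff)
  then have "u measurable_on Iref" by (subst measurable_on_iff_borel_measurable) auto
  then obtain N g where N: "negligible N" and g: "\<And>n. continuous_on UNIV (g n)"
    and lim: "\<And>x. x \<notin> N \<Longrightarrow> (\<lambda>n. g n x) \<longlonglongrightarrow> (if x \<in> Iref then u x else 0)"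
    unfolding measurable_on_def by blast
  have gc: "continuous_on UNIV (\<lambda>x. clip M (g n x))" for n
    unfolding clip_def by (intro continuous_intros g)
  have "(\<lambda>n. nsq (\<lambda>x. clip M (u x) - clip M (g n x))) \<longlonglongrightarrow> 0"
  proof (rule ip_dominated_convergence)
    show "(\<lambda>x. clip M (u x)) \<in> borel_measurable (lebesgue_on Iref)"
      by (rule measurable_compose[OF u clip_measurable])
    show "(\<lambda>x. clip M (g n x)) \<in> borel_measurable (lebesgue_on Iref)" for n
      by (intro continuous_imp_measurable_on_sets_lebesgue continuous_on_subset[OF gc]) auto
    show "integrable (lebesgue_on Iref) (\<lambda>x. (2 * M)\<^sup>2 * 1)"
      by (intro integrable_mult_right L2_imp_integrable one_L2)
    have "AE x in lebesgue. x \<in> Iref \<longrightarrow> (\<lambda>n. clip M (g n x)) \<longlonglongrightarrow> clip M (u x)"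
    proof (rule AE_I')
      show "N \<in> null_sets lebesgue" using N by (simp add: negligible_iff_null_sets)
      have "(\<lambda>n. clip M (g n x)) \<longlonglongrightarrow> clip M (u x)" if "x \<notin> N" "x \<in> Iref" for x
      proof -
        have "(\<lambda>n. g n x) \<longlonglongrightarrow> u x" using lim[OF that(1)] that(2) by simp
        then show ?thesis unfolding clip_def by (intro tendsto_max tendsto_min tendsto_const)
      qed
      then show "{x \<in> space lebesgue. \<not> (x \<in> Iref \<longrightarrow> (\<lambda>n. clip M (g n x)) \<longlonglongrightarrow> clip M (u x))} \<subseteq> N"
        by blast
    qed
    then show "AE x in lebesgue_on Iref. (\<lambda>n. clip M (g n x)) \<longlonglongrightarrow> clip M (u x)"
      by (simp add: AE_restrict_space_iff)
    show "(clip M (u x) - clip M (g n x))\<^sup>2 \<le> (2 * M)\<^sup>2 * 1" for n x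
      using abs_clip_le[OF assms(3), of "u x"] abs_clip_le[OF assms(3), of "g n x"]
      by (simp only: mult_1_right abs_le_square_iff[symmetric])
  qed
  then have "eventually (\<lambda>n. nsq (\<lambda>x. clip M (u x) - clip M (g n x)) < e) sequentially"
    using assms(2) by (rule order_tendstoD)
  then obtain n where "nsq (\<lambda>x. clip M (u x) - clip M (g n x)) < e"
    using eventually_happens'[OF sequentially_bot] by blast
  with gc[of n] show ?thesis by (intro exI conjI)
qed

lemma poly_approx_continuous:
  assumes "continuous_on UNIV (h :: real \<Rightarrow> real)" "e > 0"
  shows "\<exists>p. nsq (\<lambda>x. h x - poly p x) < e"
proof -
  \<comment> \<open>The interval has length 2, so a uniform error d contributes at most 2 d^2 = 2 e
    / 3.\<close>
  define d where "d = sqrt (e / 3)"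
  have d: "d > 0" "d\<^sup>2 = e / 3" using assms(2) by (auto simp: d_def)
  obtain g where g: "real_polynomial_function g" "\<And>x. x \<in> {-1..1} \<Longrightarrow> \<bar>h x - g x\<bar> < d"
    by (rule Stone_Weierstrass_real_polynomial_function[OF compact_Icc continuous_on_subset[OF assms(1) subset_UNIV] d(1)])
      blast
  obtain a n where an: "g = (\<lambda>x. \<Sum>i\<le>n. a i * x ^ i)"
    using g(1) real_polynomial_function_iff_sum by auto
  define p where "p = (\<Sum>i\<le>n. monom (a i) i)"
  have gp: "g = poly p" by (auto simp: p_def an poly_sum poly_monom fun_eq_iff)
  have hL: "(\<lambda>x. h x - poly p x) \<in> L2_space Iref"
    by (intro L2_continuous_Icc continuous_intros continuous_on_subset[OF assms(1)]) auto
  have i1: "integrable (lebesgue_on Iref) (\<lambda>x. d\<^sup>2 * 1)"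
    by (intro integrable_mult_right L2_imp_integrable one_L2)
  have "nsq (\<lambda>x. h x - poly p x) \<le> (\<integral>x. d\<^sup>2 * 1 \<partial>lebesgue_on Iref)"
    unfolding ip_def
  proof (rule integral_mono[OF L2_mult_integrable[OF _ hL hL] i1])
    fix x assume "x \<in> space (lebesgue_on Iref)"
    then have "\<bar>h x - poly p x\<bar> \<le> d" using g(2)[of x] unfolding gp by force
    then show "(h x - poly p x) * (h x - poly p x) \<le> d\<^sup>2 * 1"
      using d(1) abs_le_square_iff[of "h x - poly p x" d] by (simp add: power2_eq_square)
  qed simp
  also have "\<dots> = d\<^sup>2 * nsq (Leg 0)" by (simp add: ip_def)
  also have "\<dots> = 2 * e / 3" by (simp only: leg_norm d) simp
  also have "\<dots> < e" using assms(2) by simp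
  finally show ?thesis by blast
qed

lemma poly_dense_L2:
  assumes u: "u \<in> L2_space Iref" and e: "e > 0"
  shows "\<exists>p. nsq (\<lambda>x. u x - poly p x) < e"
proof -
  \<comment> \<open>Each use of \<open>ip_sq_triangle\<close> doubles: e/32 and e/32 become e/8, and
    then e/32 and e/8 become 5 e / 16.\<close>
  obtain M where M: "M \<ge> 0" "nsq (\<lambda>x. u x - clip M (u x)) < e / 32"
    using clip_approx[OF u, of "e/32"] e by auto
  obtain h where h: "continuous_on UNIV h" "nsq (\<lambda>x. clip M (u x) - h x) < e / 32"
    using continuous_approx_clip[OF u, of "e/32" M] e M by auto
  obtain p where p: "nsq (\<lambda>x. h x - poly p x) < e / 32"
    using poly_approx_continuous[OF h(1), of "e/32"] e by auto
  have hL: "h \<in> L2_space Iref" using h(1) by (intro L2_continuous_Icc continuous_on_subset[OF h(1)]) auto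
  have u': "u \<in> borel_measurable (lebesgue_on Iref)" using u by (auto simp: L2_space_iff)
  have cL: "(\<lambda>x. clip M (u x)) \<in> L2_space Iref"
    using L2_times_bounded[OF _ one_L2 measurable_compose[OF u' clip_measurable] abs_clip_le[OF M(1)]] by simp
  have "nsq (\<lambda>x. clip M (u x) - poly p x) < e / 8"
    using ip_sq_triangle[of "\<lambda>x. clip M (u x) - h x" "\<lambda>x. h x - poly p x"] h(2) p
    by (simp add: L2_diff cL hL)
  moreover have "nsq (\<lambda>x. u x - poly p x)
    \<le> 2 * nsq (\<lambda>x. u x - clip M (u x)) + 2 * nsq (\<lambda>x. clip M (u x) - poly p x)"
    using ip_sq_triangle[of "\<lambda>x. u x - clip M (u x)" "\<lambda>x. clip M (u x) - poly p x"]
    by (simp add: L2_diff cL u)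
  ultimately have "nsq (\<lambda>x. u x - poly p x) < e"
    using M(2) e by linarith
  then show ?thesis by blast
qed

text \<open>Bessel's inequality is one half. For the other half, a partial Legendre sum is at least
  as close to u as any polynomial of the same degree, and polynomials are dense.\<close>

lemma parseval:
  assumes u: "u \<in> L2_space Iref"
  shows "(\<lambda>n. (coef u n)\<^sup>2) sums nsq u"
proof -
  have "nsq u \<le> suminf (\<lambda>n. (coef u n)\<^sup>2) + e" if e: "e > 0" for e
  proof -
    obtain p where p: "nsq (\<lambda>x. u x - poly p x) < e"
      using poly_dense_L2[OF u e] by blast
    obtain t where t: "\<forall>x. poly p x = (\<Sum>k\<le>degree p. t k * leg_on k x)"
      using poly_leg_on_span[of p "degree p"] by auto
    have "nsq u - (\<Sum>k\<le>degree p. (coef u k)\<^sup>2) \<le> nsq (\<lambda>x. u x - poly p x)"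
      using ip_orthonormal_diff[of leg_on u "{..degree p}" t] t u
      by (simp add: leg_on_orthonormal coef_def sum_nonneg)
    moreover have "(\<Sum>k\<le>degree p. (coef u k)\<^sup>2) \<le> suminf (\<lambda>n. (coef u n)\<^sup>2)"
      by (intro sum_le_suminf coef_sq_summable u) auto
    ultimately show ?thesis using p by linarith
  qed
  then have "nsq u \<le> suminf (\<lambda>n. (coef u n)\<^sup>2)" by (rule field_le_epsilon)
  moreover have "suminf (\<lambda>n. (coef u n)\<^sup>2) \<le> nsq u"
    using bessel_finite[of leg_on u] u
    by (intro suminf_le_const coef_sq_summable u) (auto simp: leg_on_orthonormal coef_def)
  ultimately show ?thesis using coef_sq_summable[OF u] by (simp add: sums_iff)
qed

lemma coef_add: "u \<in> L2_space Iref \<Longrightarrow> v \<in> L2_space Iref \<Longrightarrow> coef (\<lambda>x. u x + v x) n = coef u n + coef v n"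
  by (simp add: coef_def ip_add_left)

lemma coef_diff: "u \<in> L2_space Iref \<Longrightarrow> v \<in> L2_space Iref \<Longrightarrow> coef (\<lambda>x. u x - v x) n = coef u n - coef v n"
  by (simp add: coef_def ip_diff_left)

lemma coef_cmult: "coef (\<lambda>x. c * u x) n = c * coef u n"
  by (simp add: coef_def ip_cmult_left)

lemma coef_sum: "(\<And>k. k \<in> A \<Longrightarrow> f k \<in> L2_space Iref) \<Longrightarrow> coef (\<lambda>x. \<Sum>k\<in>A. f k x) n = (\<Sum>k\<in>A. coef (f k) n)"
  by (simp add: coef_def ip_sum_left)

lemma parseval_ip:
  assumes u: "u \<in> L2_space Iref" and v: "v \<in> L2_space Iref"
  shows "(\<lambda>n. coef u n * coef v n) sums ip u v"
proof -
  have 1: "(\<lambda>n. ((coef (\<lambda>x. u x + v x) n)\<^sup>2 - (coef (\<lambda>x. u x - v x) n)\<^sup>2) / 4) sums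
    ((nsq (\<lambda>x. u x + v x) - nsq (\<lambda>x. u x - v x)) / 4)"
    by (intro sums_divide sums_diff parseval L2_add L2_diff u v) simp_all
  have "nsq (\<lambda>x. u x + v x) = nsq u + 2 * ip u v + nsq v"
    using u v by (simp add: ip_add_left ip_add_right L2_add ip_commute[of v u])
  then have 2: "(nsq (\<lambda>x. u x + v x) - nsq (\<lambda>x. u x - v x)) / 4 = ip u v"
    using u v by (simp add: ip_diff_diff)
  have 3: "((coef (\<lambda>x. u x + v x) n)\<^sup>2 - (coef (\<lambda>x. u x - v x) n)\<^sup>2) / 4 = coef u n * coef v n" for n
    using u v by (simp add: coef_add coef_diff power2_eq_square algebra_simps)
  show ?thesis using 1 unfolding 2 3 .
qed

section \<open>The prolate operator on Legendre coefficients\<close>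

text \<open>The off-diagonal entries n / sqrt (4 n^2 - 1) of the Jacobi matrix of the orthonormal
  Legendre polynomials.\<close>

definition jac :: "nat \<Rightarrow> real" where
  "jac n = real n / (sqrt (2 * real n - 1) * sqrt (2 * real n + 1))"

text \<open>Multiplication by \<open>x\<close> in Legendre coefficients; at \<open>n = 0\<close> the truncated index \<open>n - 1\<close> is
  harmless because \<open>jac 0 = 0\<close>.\<close>

definition xop :: "(nat \<Rightarrow> real) \<Rightarrow> nat \<Rightarrow> real" where
  "xop a n = jac n * a (n - 1) + jac (Suc n) * a (Suc n)"

definition prol :: "real \<Rightarrow> (nat \<Rightarrow> real) \<Rightarrow> nat \<Rightarrow> real" where
  "prol c a n = real n * (real n + 1) * a n + c\<^sup>2 * xop (xop a) n"

definition ell2 :: "(nat \<Rightarrow> real) \<Rightarrow> bool" where "ell2 a \<longleftrightarrow> summable (\<lambda>n. (a n)\<^sup>2)"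

text \<open>Decay faster than any power. On this class the unbounded map \<open>prol\<close> is
  symmetric and can be iterated, and Legendre series are classically differentiable; eigenvectors
  turn out to lie in it.\<close>

definition rapid :: "(nat \<Rightarrow> real) \<Rightarrow> bool" where
  "rapid a \<longleftrightarrow> (\<forall>k. \<exists>C. \<forall>n. \<bar>a n\<bar> * (real n + 1) ^ k \<le> C)"

lemma jac_0 [simp]: "jac 0 = 0" by (simp add: jac_def)

lemma jac_nonneg: "jac n \<ge> 0"
  by (cases n) (auto simp: jac_def)

lemma jac_le_1: "jac n \<le> 1"
proof (cases "n = 0")
  case False
  then have n: "real n \<ge> 1" by simp
  have "real n = sqrt (real n * real n)" by simp
  also have "\<dots> \<le> sqrt ((2 * real n - 1) * (2 * real n + 1))"
  proof (rule real_sqrt_le_mono)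
    have "real n * real n \<ge> 1" using n by (simp add: mult_ge1_I)
    then show "real n * real n \<le> (2 * real n - 1) * (2 * real n + 1)" by (simp add: algebra_simps)
  qed
  finally have "real n \<le> sqrt (2 * real n - 1) * sqrt (2 * real n + 1)" by (simp add: real_sqrt_mult)
  then show ?thesis using n unfolding jac_def by (subst pos_divide_le_eq) auto
qed simp

lemma abs_xop_le: "\<bar>xop a n\<bar> \<le> \<bar>a (n - 1)\<bar> + \<bar>a (Suc n)\<bar>"
proof -
  have "\<bar>xop a n\<bar> \<le> jac n * \<bar>a (n - 1)\<bar> + jac (Suc n) * \<bar>a (Suc n)\<bar>"
    unfolding xop_def using jac_nonneg by (intro order_trans[OF abs_triangle_ineq]) (simp add: abs_mult)
  also have "\<dots> \<le> 1 * \<bar>a (n - 1)\<bar> + 1 * \<bar>a (Suc n)\<bar>"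
    by (intro add_mono mult_right_mono jac_le_1) auto
  finally show ?thesis by simp
qed

lemma xop_add: "xop (\<lambda>n. a n + b n) = (\<lambda>n. xop a n + xop b n)"
  by (auto simp: xop_def algebra_simps)

lemma xop_cmult: "xop (\<lambda>n. t * a n) = (\<lambda>n. t * xop a n)"
  by (auto simp: xop_def algebra_simps)

lemma prol_add: "prol c (\<lambda>n. a n + b n) = (\<lambda>n. prol c a n + prol c b n)"
  by (auto simp: prol_def xop_add algebra_simps)

lemma prol_cmult: "prol c (\<lambda>n. t * a n) = (\<lambda>n. t * prol c a n)"
  by (auto simp: prol_def xop_cmult algebra_simps)

lemma prol_zero: "prol c (\<lambda>n. 0) = (\<lambda>n. 0)"
  by (auto simp: prol_def xop_def)

lemma prol_sum: "finite S \<Longrightarrow> prol c (\<lambda>n. \<Sum>i\<in>S. a i n) = (\<lambda>n. \<Sum>i\<in>S. prol c (a i) n)"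
  by (induction S rule: finite_induct) (simp_all add: prol_zero prol_add)

lemma ell2_mult:
  assumes "ell2 a" "ell2 b"
  shows "summable (\<lambda>n. a n * b n)"
proof (rule summable_comparison_test')
  show "summable (\<lambda>n. (a n)\<^sup>2 + (b n)\<^sup>2)" using assms by (simp add: ell2_def summable_add)
  show "norm (a n * b n) \<le> (a n)\<^sup>2 + (b n)\<^sup>2" for n
    using sum_squares_bound[of "\<bar>a n\<bar>" "\<bar>b n\<bar>"] mult_nonneg_nonneg[OF abs_ge_zero abs_ge_zero, of "a n" "b n"]
    unfolding real_norm_def abs_mult power2_abs mult.assoc by linarith
qed

lemma ell2_cmult: "ell2 a \<Longrightarrow> ell2 (\<lambda>n. t * a n)"
  by (simp add: ell2_def power_mult_distrib summable_mult)

lemma ell2_add: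
  assumes "ell2 a" "ell2 b"
  shows "ell2 (\<lambda>n. a n + b n)"
proof -
  have "summable (\<lambda>n. (a n)\<^sup>2 + (b n)\<^sup>2 + 2 * (a n * b n))"
    using assms ell2_mult[OF assms] by (intro summable_add summable_mult) (auto simp: ell2_def)
  then show ?thesis by (simp add: ell2_def power2_sum mult.assoc)
qed

lemma ell2_diff: "ell2 a \<Longrightarrow> ell2 b \<Longrightarrow> ell2 (\<lambda>n. a n - b n)"
  using ell2_add[of a "\<lambda>n. (-1) * b n"] ell2_cmult[of b "-1"] by simp

lemma ell2_xop:
  assumes "ell2 a"
  shows "ell2 (xop a)"
proof -
  have s: "summable (\<lambda>n. (a n)\<^sup>2)" using assms by (simp add: ell2_def)
  have "summable (\<lambda>n. (a (Suc n - 1))\<^sup>2)" using s by simp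
  then have 1: "ell2 (\<lambda>n. a (n - 1))" unfolding ell2_def by (subst (asm) summable_Suc_iff)
  have 2: "ell2 (\<lambda>n. a (Suc n))" using s unfolding ell2_def by (subst summable_Suc_iff)
  have "ell2 (\<lambda>n. \<bar>a (n - 1)\<bar> + \<bar>a (Suc n)\<bar>)"
    by (rule ell2_add) (use 1 2 in \<open>simp_all add: ell2_def\<close>)
  then show ?thesis unfolding ell2_def
    by (rule summable_comparison_test'[where N = 0])
      (use abs_xop_le in \<open>simp add: abs_le_square_iff[symmetric]\<close>)
qed

text \<open>Summation by parts. Only the two shifted series are assumed summable, because the lemma
  serves both for pairs of square-summable sequences and for a rapidly decaying sequence against the
  growing values \<open>leg_on n x\<close>.\<close>

lemma xop_shift:
  assumes u: "summable (\<lambda>n. jac (Suc n) * (a n * b (Suc n)))"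
    and v: "summable (\<lambda>n. jac (Suc n) * (a (Suc n) * b n))"
  shows "(\<Sum>n. xop a n * b n) = (\<Sum>n. a n * xop b n)"
proof -
  let ?u = "\<lambda>n. jac (Suc n) * (a n * b (Suc n))" and ?v = "\<lambda>n. jac (Suc n) * (a (Suc n) * b n)"
  have shift: "(\<Sum>n. f n) = (\<Sum>n. f (Suc n))" "summable f" if "f 0 = 0" "summable (\<lambda>n. f (Suc n))" for f :: "nat \<Rightarrow> real"
    using that suminf_split_head[of f] by (simp_all add: summable_Suc_iff)
  let ?u' = "\<lambda>n. jac n * (a (n - 1) * b n)" and ?v' = "\<lambda>n. jac n * (a n * b (n - 1))"
  have u': "suminf ?u' = suminf ?u" "summable ?u'" and v': "suminf ?v' = suminf ?v" "summable ?v'"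
    using shift[of ?u'] shift[of ?v'] u v by simp_all
  have "(\<Sum>n. xop a n * b n) = (\<Sum>n. ?u' n + ?v n)"
    by (rule arg_cong[where f = suminf]) (auto simp: xop_def algebra_simps)
  also have "\<dots> = suminf ?u + suminf ?v" using suminf_add[OF u'(2) v] u'(1) by simp
  also have "\<dots> = (\<Sum>n. ?v' n + ?u n)" using suminf_add[OF v'(2) u] v'(1) by simp
  also have "\<dots> = (\<Sum>n. a n * xop b n)"
    by (rule arg_cong[where f = suminf]) (auto simp: xop_def algebra_simps)
  finally show ?thesis .
qed

lemma jac_mult_summable:
  assumes "summable (\<lambda>n. \<bar>f n\<bar>)"
  shows "summable (\<lambda>n. jac (Suc n) * f n)"
  by (rule summable_comparison_test'[OF assms])
    (use mult_right_mono[OF jac_le_1 abs_ge_zero] jac_nonneg in \<open>simp add: abs_mult\<close>)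

lemma xop_symmetric:
  assumes "ell2 a" "ell2 b"
  shows "(\<Sum>n. xop a n * b n) = (\<Sum>n. a n * xop b n)"
proof (rule xop_shift; rule jac_mult_summable)
  have S: "ell2 (\<lambda>n. \<bar>b (Suc n)\<bar>)" "ell2 (\<lambda>n. \<bar>a (Suc n)\<bar>)" "ell2 (\<lambda>n. \<bar>a n\<bar>)" "ell2 (\<lambda>n. \<bar>b n\<bar>)"
    using assms unfolding ell2_def power2_abs
    by (simp_all only: summable_Suc_iff[of "\<lambda>n. (b n)\<^sup>2"] summable_Suc_iff[of "\<lambda>n. (a n)\<^sup>2"])
  show "summable (\<lambda>n. \<bar>a n * b (Suc n)\<bar>)" "summable (\<lambda>n. \<bar>a (Suc n) * b n\<bar>)"
    unfolding abs_mult by (rule ell2_mult S)+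
qed

lemma rapid_bound:
  assumes "rapid a"
  shows "\<exists>C. C \<ge> 0 \<and> (\<forall>n. \<bar>a n\<bar> * (real n + 1) ^ k \<le> C)"
proof -
  obtain C where C: "\<And>n. \<bar>a n\<bar> * (real n + 1) ^ k \<le> C" using assms by (auto simp: rapid_def)
  have "0 \<le> C" using C[of 0] by (rule order_trans[rotated]) simp
  with C show ?thesis by blast
qed

lemma rapid_summable:
  assumes "rapid a"
  shows "summable (\<lambda>n. \<bar>a n\<bar> * (real n + 1) ^ k)"
proof -
  obtain C where C: "C \<ge> 0" "\<And>n. \<bar>a n\<bar> * (real n + 1) ^ (k + 2) \<le> C" using rapid_bound[OF assms, of "k + 2"] by blast
  show ?thesis
  proof (rule summable_comparison_test')
    have "summable (\<lambda>n. inverse ((real (Suc n))\<^sup>2))"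
      using inverse_power_summable[of 2, where 'a = real] by (subst summable_Suc_iff[of "\<lambda>n. inverse ((real n)\<^sup>2)"]) simp
    then show "summable (\<lambda>n. C * inverse ((real n + 1)\<^sup>2))" by (intro summable_mult) (simp add: add.commute)
    show "norm (\<bar>a n\<bar> * (real n + 1) ^ k) \<le> C * inverse ((real n + 1)\<^sup>2)" for n
      using C(2)[of n] unfolding divide_inverse[symmetric]
      by (subst pos_le_divide_eq) (simp_all add: abs_mult power2_eq_square mult_ac)
  qed
qed

lemma rapid_ell2:
  assumes "rapid a"
  shows "ell2 a"
proof -
  obtain C where C: "C \<ge> 0" "\<And>n. \<bar>a n\<bar> * (real n + 1) ^ 0 \<le> C" using rapid_bound[OF assms, of "0"] by blast
  show ?thesis unfolding ell2_def
  proof (rule summable_comparison_test')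
    show "summable (\<lambda>n. C * (\<bar>a n\<bar> * (real n + 1) ^ 0))" by (intro summable_mult rapid_summable assms)
    show "norm ((a n)\<^sup>2) \<le> C * (\<bar>a n\<bar> * (real n + 1) ^ 0)" for n
      using C(2)[of n] mult_right_mono[of "\<bar>a n\<bar>" C "\<bar>a n\<bar>"] by (simp add: power2_eq_square)
  qed
qed

lemma rapid_add:
  assumes "rapid a" "rapid b"
  shows "rapid (\<lambda>n. a n + b n)"
  unfolding rapid_def
proof
  fix k
  obtain C where C: "C \<ge> 0" "\<And>n. \<bar>a n\<bar> * (real n + 1) ^ k \<le> C" using rapid_bound[OF assms(1), of "k"] by blast
  obtain D where D: "D \<ge> 0" "\<And>n. \<bar>b n\<bar> * (real n + 1) ^ k \<le> D" using rapid_bound[OF assms(2), of "k"] by blast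
  have "\<bar>a n + b n\<bar> * (real n + 1) ^ k \<le> C + D" for n
  proof -
    have "\<bar>a n + b n\<bar> * (real n + 1) ^ k \<le> (\<bar>a n\<bar> + \<bar>b n\<bar>) * (real n + 1) ^ k"
      by (intro mult_right_mono abs_triangle_ineq) simp
    then show ?thesis using C(2)[of n] D(2)[of n] by (simp add: distrib_right)
  qed
  then show "\<exists>C. \<forall>n. \<bar>a n + b n\<bar> * (real n + 1) ^ k \<le> C" by blast
qed

lemma rapid_cmult:
  assumes "rapid a"
  shows "rapid (\<lambda>n. t * a n)"
  unfolding rapid_def
proof
  fix k
  obtain C where C: "C \<ge> 0" "\<And>n. \<bar>a n\<bar> * (real n + 1) ^ k \<le> C" using rapid_bound[OF assms(1), of "k"] by blast
  have "\<bar>t * a n\<bar> * (real n + 1) ^ k \<le> \<bar>t\<bar> * C" for n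
    using mult_left_mono[OF C(2)[of n], of "\<bar>t\<bar>"] by (simp add: abs_mult mult.assoc)
  then show "\<exists>C. \<forall>n. \<bar>t * a n\<bar> * (real n + 1) ^ k \<le> C" by blast
qed

lemma rapid_zero: "rapid (\<lambda>n. 0)" by (auto simp: rapid_def)

lemma rapid_sum: "finite S \<Longrightarrow> (\<And>i. i \<in> S \<Longrightarrow> rapid (a i)) \<Longrightarrow> rapid (\<lambda>n. \<Sum>i\<in>S. a i n)"
  by (induction S rule: finite_induct) (simp_all add: rapid_zero rapid_add)

lemma rapid_diff: "rapid a \<Longrightarrow> rapid b \<Longrightarrow> rapid (\<lambda>n. a n - b n)"
  using rapid_add[of a "\<lambda>n. (-1) * b n"] rapid_cmult[of b "-1"] by simp

lemma rapid_finite: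
  assumes "\<And>n. n > K \<Longrightarrow> a n = 0"
  shows "rapid a"
  unfolding rapid_def
proof
  fix k
  have "\<bar>a n\<bar> * (real n + 1) ^ k \<le> (\<Sum>m\<le>K. \<bar>a m\<bar> * (real m + 1) ^ k)" for n
  proof (cases "n \<le> K")
    case True
    then show ?thesis
      by (intro member_le_sum[where f = "\<lambda>m. \<bar>a m\<bar> * (real m + 1) ^ k"]) auto
  next
    case False
    then show ?thesis using assms[of n] by (auto intro!: sum_nonneg)
  qed
  then show "\<exists>C. \<forall>n. \<bar>a n\<bar> * (real n + 1) ^ k \<le> C" by blast
qed

text \<open>Moving the index by one changes the weight (n + 1)^k by a factor of at most 2^k, and
  each entry of \<open>xop a\<close> has two neighbours.\<close>

lemma xop_power_bound:
  assumes "\<And>n. \<bar>a n\<bar> * (real n + 1) ^ k \<le> C"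
  shows "\<bar>xop a n\<bar> * (real n + 1) ^ k \<le> 2 * 2 ^ k * C"
proof -
  have *: "\<bar>a m\<bar> * (real n + 1) ^ k \<le> 2 ^ k * C" if "real n + 1 \<le> 2 * (real m + 1)" for m
  proof -
    have "\<bar>a m\<bar> * (real n + 1) ^ k \<le> \<bar>a m\<bar> * (2 * (real m + 1)) ^ k"
      by (intro mult_left_mono power_mono that) auto
    also have "\<dots> = 2 ^ k * (\<bar>a m\<bar> * (real m + 1) ^ k)" by (simp only: power_mult_distrib mult_ac)
    also have "\<dots> \<le> 2 ^ k * C" by (intro mult_left_mono assms) auto
    finally show ?thesis .
  qed
  have "\<bar>xop a n\<bar> * (real n + 1) ^ k \<le> (\<bar>a (n - 1)\<bar> + \<bar>a (Suc n)\<bar>) * (real n + 1) ^ k"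
    by (intro mult_right_mono abs_xop_le) auto
  also have "\<dots> \<le> 2 ^ k * C + 2 ^ k * C"
    unfolding distrib_right by (intro add_mono *) (cases n; simp)+
  finally show ?thesis by (simp only: mult_2 distrib_right)
qed

lemma rapid_xop:
  assumes "rapid a"
  shows "rapid (xop a)"
  unfolding rapid_def
proof
  fix k
  obtain C where "\<And>n. \<bar>a n\<bar> * (real n + 1) ^ k \<le> C" using rapid_bound[OF assms, of k] by blast
  from xop_power_bound[OF this] show "\<exists>C. \<forall>n. \<bar>xop a n\<bar> * (real n + 1) ^ k \<le> C" by blast
qed

lemma rapid_weight:
  assumes "rapid a"
  shows "rapid (\<lambda>n. real n * (real n + 1) * a n)"
  unfolding rapid_def
proof
  fix k
  obtain C where C: "C \<ge> 0" "\<And>n. \<bar>a n\<bar> * (real n + 1) ^ (k + 2) \<le> C" using rapid_bound[OF assms, of "k + 2"] by blast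
  have "\<bar>real n * (real n + 1) * a n\<bar> * (real n + 1) ^ k \<le> C" for n
  proof -
    have "\<bar>real n * (real n + 1) * a n\<bar> * (real n + 1) ^ k = real n * (\<bar>a n\<bar> * (real n + 1) ^ (k + 1))"
      by (simp add: abs_mult)
    also have "\<dots> \<le> (real n + 1) * (\<bar>a n\<bar> * (real n + 1) ^ (k + 1))"
      by (intro mult_right_mono) auto
    also have "\<dots> = \<bar>a n\<bar> * (real n + 1) ^ (k + 2)" by simp
    finally show ?thesis using C(2)[of n] by linarith
  qed
  then show "\<exists>C. \<forall>n. \<bar>real n * (real n + 1) * a n\<bar> * (real n + 1) ^ k \<le> C" by blast
qed

lemma rapid_prol: "rapid a \<Longrightarrow> rapid (prol c a)"
  unfolding prol_def by (intro rapid_add rapid_weight rapid_cmult rapid_xop)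

text \<open>A bootstrap: in the eigenvalue equation \<open>a n\<close> carries the factor n (n + 1),
  while the remaining terms inherit the decay already known, so each round gains a power of n + 1.
  The factor vanishes at index 0, which is why \<open>\<bar>a 0\<bar>\<close> enters the
  bound.\<close>

lemma prol_eigen_rapid:
  assumes B: "\<And>n. \<bar>a n\<bar> \<le> B" and eig: "\<And>n. prol c a n = lam * a n"
  shows "rapid a"
proof -
  have "\<exists>C. \<forall>n. \<bar>a n\<bar> * (real n + 1) ^ k \<le> C" for k
  proof (induction k)
    case 0
    then show ?case using B by auto
  next
    case (Suc k)
    then obtain C where C: "\<And>n. \<bar>a n\<bar> * (real n + 1) ^ k \<le> C" by blast
    have C0: "0 \<le> C" using C[of 0] by (rule order_trans[rotated]) simp
    define E where "E = 2 * (\<bar>lam\<bar> * C + c\<^sup>2 * (2 * 2 ^ k * (2 * 2 ^ k * C)))"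
    have E0: "E \<ge> 0" using C0 by (auto simp: E_def)
    have "\<bar>a n\<bar> * (real n + 1) ^ Suc k \<le> max \<bar>a 0\<bar> E" for n
    proof (cases "n = 0")
      case False
      then have n1: "real n \<ge> 1" by simp
      have XX: "\<bar>xop (xop a) n\<bar> * (real n + 1) ^ k \<le> 2 * 2 ^ k * (2 * 2 ^ k * C)"
        by (intro xop_power_bound C)
      have "real n * (real n + 1) * a n = lam * a n - c\<^sup>2 * xop (xop a) n"
        using eig[of n] by (simp add: prol_def)
      then have "real n * (real n + 1) * \<bar>a n\<bar> \<le> \<bar>lam\<bar> * \<bar>a n\<bar> + c\<^sup>2 * \<bar>xop (xop a) n\<bar>"
      proof -
        have "\<bar>real n * (real n + 1) * a n\<bar> \<le> \<bar>lam * a n\<bar> + \<bar>c\<^sup>2 * xop (xop a) n\<bar>"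
          unfolding \<open>real n * (real n + 1) * a n = _\<close> by (rule abs_triangle_ineq4)
        then show ?thesis by (simp add: abs_mult)
      qed
      then have "real n * (real n + 1) * \<bar>a n\<bar> * (real n + 1) ^ k \<le> (\<bar>lam\<bar> * \<bar>a n\<bar> + c\<^sup>2 * \<bar>xop (xop a) n\<bar>) * (real n + 1) ^ k"
        by (intro mult_right_mono) auto
      also have "\<dots> = \<bar>lam\<bar> * (\<bar>a n\<bar> * (real n + 1) ^ k) + c\<^sup>2 * (\<bar>xop (xop a) n\<bar> * (real n + 1) ^ k)"
        by (simp add: algebra_simps)
      also have "\<dots> \<le> \<bar>lam\<bar> * C + c\<^sup>2 * (2 * 2 ^ k * (2 * 2 ^ k * C))"
        by (intro add_mono mult_left_mono C XX) auto
      finally have *: "real n * (\<bar>a n\<bar> * (real n + 1) ^ Suc k) \<le> \<bar>lam\<bar> * C + c\<^sup>2 * (2 * 2 ^ k * (2 * 2 ^ k * C))"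
        by (simp add: mult_ac)
      have "1 * (\<bar>a n\<bar> * (real n + 1) ^ Suc k) \<le> real n * (\<bar>a n\<bar> * (real n + 1) ^ Suc k)"
        by (intro mult_right_mono n1) auto
      with * E0 show ?thesis unfolding E_def max_def by (auto split: if_splits)
    qed simp
    then show ?case by blast
  qed
  then show ?thesis by (simp add: rapid_def)
qed

text \<open>The weak form of the operator. With the rapid sequence carrying the operator,
  \<open>a\<close> may be merely square summable, which is what a minimizer offers before its
  regularity is known.\<close>

lemma prol_form:
  assumes a: "ell2 a" and b: "rapid b"
  shows "(\<Sum>n. real n * (real n + 1) * (a n * b n) + c\<^sup>2 * (xop a n * xop b n)) = (\<Sum>n. a n * prol c b n)"
    and "summable (\<lambda>n. real n * (real n + 1) * (a n * b n) + c\<^sup>2 * (xop a n * xop b n))"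
proof -
  have b2: "ell2 b" using b by (rule rapid_ell2)
  have w: "summable (\<lambda>n. real n * (real n + 1) * (a n * b n))"
    using ell2_mult[OF a rapid_ell2[OF rapid_weight[OF b]]] by (simp add: mult_ac)
  have x: "summable (\<lambda>n. c\<^sup>2 * (xop a n * xop b n))"
    by (intro summable_mult ell2_mult ell2_xop a b2)
  have y: "summable (\<lambda>n. c\<^sup>2 * (a n * xop (xop b) n))"
    by (intro summable_mult ell2_mult ell2_xop a b2)
  show "summable (\<lambda>n. real n * (real n + 1) * (a n * b n) + c\<^sup>2 * (xop a n * xop b n))"
    by (rule summable_add[OF w x])
  have "(\<Sum>n. c\<^sup>2 * (xop a n * xop b n)) = (\<Sum>n. c\<^sup>2 * (a n * xop (xop b) n))"
    using xop_symmetric[OF a ell2_xop[OF b2]]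
    by (simp add: suminf_mult ell2_mult ell2_xop a b2)
  then have "(\<Sum>n. real n * (real n + 1) * (a n * b n) + c\<^sup>2 * (xop a n * xop b n))
     = (\<Sum>n. real n * (real n + 1) * (a n * b n)) + (\<Sum>n. c\<^sup>2 * (a n * xop (xop b) n))"
    using suminf_add[OF w x] by simp
  also have "\<dots> = (\<Sum>n. a n * prol c b n)"
    using suminf_add[OF w y] by (simp add: prol_def algebra_simps)
  finally show "(\<Sum>n. real n * (real n + 1) * (a n * b n) + c\<^sup>2 * (xop a n * xop b n)) = (\<Sum>n. a n * prol c b n)" .
qed

lemma prol_symmetric:
  assumes "rapid a" "rapid b"
  shows "(\<Sum>n. prol c a n * b n) = (\<Sum>n. a n * prol c b n)"
proof -
  have "(\<Sum>n. real n * (real n + 1) * (b n * a n) + c\<^sup>2 * (xop b n * xop a n)) = (\<Sum>n. b n * prol c a n)"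
    by (rule prol_form(1)[OF rapid_ell2[OF assms(2)] assms(1)])
  then show ?thesis using prol_form(1)[OF rapid_ell2[OF assms(1)] assms(2)] by (simp add: mult.commute)
qed

section \<open>Spectral gap\<close>

definition dotp :: "(nat \<Rightarrow> real) \<Rightarrow> (nat \<Rightarrow> real) \<Rightarrow> real" where
  "dotp a b = (\<Sum>n. a n * b n)"

abbreviation sq :: "(nat \<Rightarrow> real) \<Rightarrow> real" where "sq a \<equiv> dotp a a"

lemma dotp_commute: "dotp a b = dotp b a" by (simp add: dotp_def mult.commute)

lemma dotp_add_left: "ell2 a \<Longrightarrow> ell2 b \<Longrightarrow> ell2 d \<Longrightarrow> dotp (\<lambda>n. a n + b n) d = dotp a d + dotp b d"
  unfolding dotp_def distrib_right by (rule suminf_add[symmetric]; rule ell2_mult)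

lemma dotp_diff_left: "ell2 a \<Longrightarrow> ell2 b \<Longrightarrow> ell2 d \<Longrightarrow> dotp (\<lambda>n. a n - b n) d = dotp a d - dotp b d"
  unfolding dotp_def left_diff_distrib by (rule suminf_diff[symmetric]; rule ell2_mult)

lemma dotp_cmult_left: "ell2 a \<Longrightarrow> ell2 d \<Longrightarrow> dotp (\<lambda>n. t * a n) d = t * dotp a d"
  unfolding dotp_def mult.assoc by (rule suminf_mult; rule ell2_mult)

lemma ell2_zero: "ell2 (\<lambda>n. 0)" by (simp add: ell2_def)

lemma ell2_sum: "finite S \<Longrightarrow> (\<And>i. i \<in> S \<Longrightarrow> ell2 (a i)) \<Longrightarrow> ell2 (\<lambda>n. \<Sum>i\<in>S. a i n)"
  by (induction S rule: finite_induct) (simp_all add: ell2_zero ell2_add)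

lemma dotp_sum_left: "finite S \<Longrightarrow> (\<And>i. i \<in> S \<Longrightarrow> ell2 (a i)) \<Longrightarrow> ell2 d \<Longrightarrow>
    dotp (\<lambda>n. \<Sum>i\<in>S. a i n) d = (\<Sum>i\<in>S. dotp (a i) d)"
proof (induction S rule: finite_induct)
  case empty
  then show ?case by (simp add: dotp_def)
next
  case (insert i S)
  then show ?case using dotp_add_left[of "a i" "\<lambda>n. \<Sum>i\<in>S. a i n" d] by (simp add: ell2_sum)
qed

lemma dotp_nonneg: "ell2 a \<Longrightarrow> sq a \<ge> 0"
  unfolding dotp_def by (rule suminf_nonneg) (auto simp: ell2_mult)

lemma dotp_self_zero:
  assumes "ell2 a" "sq a = 0"
  shows "a = (\<lambda>n. 0)"
  using suminf_eq_zero_iff[OF ell2_mult[OF assms(1) assms(1)]] assms(2) by (auto simp: dotp_def)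

definition delta :: "nat \<Rightarrow> nat \<Rightarrow> real" where "delta k n = (if n = k then 1 else 0)"

lemma rapid_delta: "rapid (delta k)"
  by (rule rapid_finite[of k]) (simp add: delta_def)

lemma dotp_delta: "dotp a (delta k) = a k"
proof -
  have "(\<lambda>n. a n * delta k n) = (\<lambda>n. if n = k then a n else 0)" by (auto simp: delta_def)
  then show ?thesis using sums_unique[OF sums_If_finite_set[of "{k}" a]]
    by (simp add: dotp_def)
qed

text \<open>Testing with unit vectors turns a weak eigenvalue equation into an equation for each
  entry.\<close>

lemma dotp_prol_delta:
  assumes "ell2 a"
  shows "dotp a (prol c (delta k)) = prol c a k"
proof -
  have d: "ell2 (delta k)" by (rule rapid_ell2[OF rapid_delta])
  have 1: "dotp a (xop (xop (delta k))) = xop (xop a) k"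
    using xop_symmetric[OF assms ell2_xop[OF d]] xop_symmetric[OF ell2_xop[OF assms] d]
      dotp_delta[of "xop (xop a)" k]
    by (simp add: dotp_def)
  have "prol c (delta k) = (\<lambda>n. real k * (real k + 1) * delta k n + c\<^sup>2 * xop (xop (delta k)) n)"
    by (auto simp: prol_def delta_def fun_eq_iff)
  then have "dotp a (prol c (delta k)) = dotp (\<lambda>n. real k * (real k + 1) * delta k n + c\<^sup>2 * xop (xop (delta k)) n) a"
    by (simp add: dotp_commute)
  also have "\<dots> = real k * (real k + 1) * dotp (delta k) a + c\<^sup>2 * dotp (xop (xop (delta k))) a"
    by (simp only: dotp_add_left dotp_cmult_left ell2_cmult ell2_xop d assms)
  also have "\<dots> = prol c a k"
    using 1 by (simp add: dotp_commute[of _ a] dotp_delta prol_def)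
  finally show ?thesis .
qed

lemma dotp_prol_symmetric: "rapid a \<Longrightarrow> rapid b \<Longrightarrow> dotp (prol c a) b = dotp a (prol c b)"
  unfolding dotp_def by (rule prol_symmetric)

text \<open>The quadratic form of \<open>prol\<close> plus the identity. The added 1 makes it
  positive definite even at index 0, so that bounded energy bounds every entry.\<close>

definition energy :: "real \<Rightarrow> (nat \<Rightarrow> real) \<Rightarrow> nat \<Rightarrow> real" where
  "energy c v n = (real n * (real n + 1) + 1) * (v n)\<^sup>2 + c\<^sup>2 * (xop v n)\<^sup>2"

lemma energy_nonneg: "energy c v n \<ge> 0" by (simp add: energy_def)

lemma energy_suminf:
  assumes "rapid v"
  shows "summable (energy c v)" "suminf (energy c v) = dotp v (prol c v) + sq v"
proof -
  have v: "ell2 v" using assms by (rule rapid_ell2)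
  have e: "energy c v = (\<lambda>n. (real n * (real n + 1) * (v n * v n) + c\<^sup>2 * (xop v n * xop v n)) + v n * v n)"
    by (auto simp: energy_def power2_eq_square algebra_simps)
  note S = prol_form(2)[OF v assms, of c] ell2_mult[OF v v]
  show "summable (energy c v)" unfolding e by (rule summable_add[OF S])
  show "suminf (energy c v) = dotp v (prol c v) + sq v"
    unfolding e suminf_add[OF S, symmetric] dotp_def using prol_form(1)[OF v assms, of c] by simp
qed

text \<open>The first-order condition behind \<open>euler_lagrange\<close>. The test value t = - p /
  k is the minimizer once the quadratic coefficient has been enlarged to k > 0.\<close>

lemma linear_coefficient_zero:
  fixes p r :: real
  assumes "\<And>t. 0 \<le> 2 * t * p + t\<^sup>2 * r"
  shows "p = 0"
proof (rule ccontr)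
  assume p: "p \<noteq> 0"
  define k where "k = \<bar>r\<bar> + 1"
  have k: "k > 0" "r \<le> k" by (auto simp: k_def)
  have "0 \<le> 2 * (- p / k) * p + (- p / k)\<^sup>2 * r" by (rule assms)
  also have "\<dots> \<le> 2 * (- p / k) * p + (- p / k)\<^sup>2 * k" by (intro add_left_mono mult_left_mono k) auto
  also have "\<dots> = - p\<^sup>2 / k" using k by (simp add: field_simps power2_eq_square)
  also have "\<dots> < 0" using p k by (simp add: divide_neg_pos)
  finally show False by simp
qed

lemma quadratic_pos [simp]: "real n * (real n + 1) + 1 > 0"
  by (intro add_nonneg_pos mult_nonneg_nonneg) auto

lemma summable_inverse_quadratic: "summable (\<lambda>n. 1 / (real n * (real n + 1) + 1))"
proof (rule summable_comparison_test'[where N = 1])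
  show "summable (\<lambda>n. inverse ((real n)\<^sup>2))"
    using inverse_power_summable[of 2, where 'a = real] by simp
  show "norm (1 / (real n * (real n + 1) + 1)) \<le> inverse ((real n)\<^sup>2)" if "n \<ge> 1" for n
  proof -
    have "(real n)\<^sup>2 \<le> real n * (real n + 1) + 1" by (simp add: power2_eq_square distrib_left)
    moreover have "(real n)\<^sup>2 > 0" using that by simp
    ultimately show ?thesis using quadratic_pos[of n]
      by (simp add: inverse_eq_divide divide_left_mono)
  qed
qed

text \<open>The prolate system seen through its Legendre coefficients. The assumption
  \<open>exhaust\<close> joins two facts, that all eigenvalues are listed and that they are simple:
  an eigenvector cannot be orthogonal to the \<open>\<alpha> j\<close> that shares its
  eigenvalue.\<close>

locale pswf_seq =
  fixes c :: real and chi :: "nat \<Rightarrow> real" and \<alpha> :: "nat \<Rightarrow> nat \<Rightarrow> real"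
  assumes mono: "strict_mono chi"
    and rapid: "rapid (\<alpha> i)"
    and eig: "prol c (\<alpha> i) n = chi i * \<alpha> i n"
    and orth: "dotp (\<alpha> i) (\<alpha> j) = (if i = j then 1 else 0)"
    and exhaust: "rapid a \<Longrightarrow> (\<And>n. prol c a n = lam * a n) \<Longrightarrow> a \<noteq> (\<lambda>n. 0) \<Longrightarrow>
       \<exists>j. lam = chi j \<and> dotp a (\<alpha> j) \<noteq> 0"
begin

lemma ell2_\<alpha>: "ell2 (\<alpha> i)" by (rule rapid_ell2[OF rapid])

text \<open>The operator I - \<pi> on coefficient sequences; the projection error in the theorem is
  its negative.\<close>

definition R :: "nat \<Rightarrow> (nat \<Rightarrow> real) \<Rightarrow> nat \<Rightarrow> real" where
  "R N p n = p n - (\<Sum>i\<le>N. dotp p (\<alpha> i) * \<alpha> i n)"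

lemma ell2_proj: "ell2 (\<lambda>n. \<Sum>i\<le>N. t i * \<alpha> i n)"
  by (intro ell2_sum ell2_cmult ell2_\<alpha>) simp

lemma dotp_proj: "ell2 d \<Longrightarrow> dotp (\<lambda>n. \<Sum>i\<le>N. t i * \<alpha> i n) d = (\<Sum>i\<le>N. t i * dotp (\<alpha> i) d)"
  by (subst dotp_sum_left) (auto simp: ell2_cmult ell2_\<alpha> dotp_cmult_left)

lemma ell2_R: "ell2 p \<Longrightarrow> ell2 (R N p)"
  unfolding R_def by (intro ell2_diff ell2_proj)

lemma rapid_R: "rapid p \<Longrightarrow> rapid (R N p)"
  unfolding R_def by (intro rapid_diff rapid_sum rapid_cmult rapid) auto

lemma dotp_R: "ell2 p \<Longrightarrow> ell2 d \<Longrightarrow> dotp (R N p) d = dotp p d - (\<Sum>i\<le>N. dotp p (\<alpha> i) * dotp (\<alpha> i) d)"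
  unfolding R_def by (simp add: dotp_diff_left ell2_proj dotp_proj)

lemma R_orth:
  assumes "ell2 p" "i \<le> N"
  shows "dotp (R N p) (\<alpha> i) = 0"
  using assms by (simp add: dotp_R ell2_\<alpha> orth if_distrib cong: if_cong)

lemma R_sq:
  assumes "ell2 p"
  shows "sq (R N p) = sq p - (\<Sum>i\<le>N. (dotp p (\<alpha> i))\<^sup>2)"
proof -
  have "sq (R N p) = dotp p (R N p) - (\<Sum>i\<le>N. dotp p (\<alpha> i) * dotp (\<alpha> i) (R N p))"
    by (rule dotp_R[OF assms ell2_R[OF assms]])
  also have "(\<Sum>i\<le>N. dotp p (\<alpha> i) * dotp (\<alpha> i) (R N p)) = 0"
    by (intro sum.neutral) (simp add: dotp_commute[of "\<alpha> _"] R_orth assms)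
  also have "dotp p (R N p) = dotp (R N p) p" by (rule dotp_commute)
  also have "\<dots> = sq p - (\<Sum>i\<le>N. (dotp p (\<alpha> i))\<^sup>2)"
    by (simp add: dotp_R assms dotp_commute[of "\<alpha> _"] power2_eq_square)
  finally show ?thesis by simp
qed

lemma R_contract: "ell2 p \<Longrightarrow> sq (R N p) \<le> sq p"
  using R_sq[of p N] by (simp add: sum_nonneg)

text \<open>Symmetry moves \<open>prol\<close> onto the eigenvectors in the coefficients of the
  projection. The commutation keeps all iterates of \<open>prol\<close> in the complement on which
  the gap holds.\<close>

lemma R_prol:
  assumes "rapid p"
  shows "prol c (R N p) = R N (prol c p)"
proof -
  have "prol c (R N p) = prol c (\<lambda>n. p n + (-1) * (\<Sum>i\<le>N. dotp p (\<alpha> i) * \<alpha> i n))"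
    by (rule arg_cong[where f = "prol c"]) (simp add: R_def fun_eq_iff)
  also have "\<dots> = (\<lambda>n. prol c p n - (\<Sum>i\<le>N. dotp p (\<alpha> i) * (chi i * \<alpha> i n)))"
    by (simp only: prol_add prol_cmult prol_sum finite_atMost eig) simp
  also have "\<dots> = R N (prol c p)"
  proof -
    have "dotp (prol c p) (\<alpha> i) = chi i * dotp p (\<alpha> i)" for i
    proof -
      have "dotp (prol c p) (\<alpha> i) = dotp p (prol c (\<alpha> i))"
        by (rule dotp_prol_symmetric[OF assms rapid])
      also have "prol c (\<alpha> i) = (\<lambda>n. chi i * \<alpha> i n)" by (auto simp: eig)
      also have "dotp p (\<lambda>n. chi i * \<alpha> i n) = dotp (\<lambda>n. chi i * \<alpha> i n) p" by (rule dotp_commute)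
      also have "\<dots> = chi i * dotp (\<alpha> i) p" by (rule dotp_cmult_left[OF ell2_\<alpha> rapid_ell2[OF assms]])
      finally show ?thesis by (simp only: dotp_commute[of p])
    qed
    then show ?thesis by (simp add: R_def fun_eq_iff mult_ac)
  qed
  finally show ?thesis .
qed

text \<open>The energy bound is imposed on partial sums: in this form it contains summability and
  passes to entrywise limits.\<close>

definition adm :: "nat \<Rightarrow> (nat \<Rightarrow> real) set" where
  "adm N = {v. (\<forall>m. (\<Sum>n<m. energy c v n) \<le> 1) \<and> (\<forall>i\<le>N. dotp v (\<alpha> i) = 0)}"

lemma adm_sq_le:
  assumes "v \<in> adm N"
  shows "(v n)\<^sup>2 \<le> 1 / (real n * (real n + 1) + 1)"
proof -
  have "energy c v n \<le> (\<Sum>k<Suc n. energy c v k)"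
    by (intro member_le_sum) (auto simp: energy_nonneg)
  also have "\<dots> \<le> 1" using assms unfolding adm_def by blast
  finally have "(real n * (real n + 1) + 1) * (v n)\<^sup>2 \<le> 1"
    unfolding energy_def by (rule order_trans[rotated]) simp
  then show ?thesis by (subst pos_le_divide_eq[OF quadratic_pos]) (simp only: mult.commute)
qed

lemma adm_abs_le: "v \<in> adm N \<Longrightarrow> \<bar>v n\<bar> \<le> 1"
proof -
  assume "v \<in> adm N"
  from adm_sq_le[OF this, of n] have "(v n)\<^sup>2 \<le> 1 / (real n * (real n + 1) + 1)" .
  also have "\<dots> \<le> 1" by (subst divide_le_eq_1_pos[OF quadratic_pos]) simp
  finally show ?thesis by (simp add: abs_square_le_1)
qed

lemma adm_ell2: "v \<in> adm N \<Longrightarrow> ell2 v"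
  unfolding ell2_def using adm_sq_le
  by (intro summable_comparison_test'[OF summable_inverse_quadratic, where N = 0]) auto

lemma adm_summable: "v \<in> adm N \<Longrightarrow> summable (energy c v)"
  by (rule summableI_nonneg_bounded[where x = 1]) (auto simp: adm_def energy_nonneg)

lemma adm_suminf: "v \<in> adm N \<Longrightarrow> suminf (energy c v) \<le> 1"
  by (rule suminf_le_const[OF adm_summable]) (auto simp: adm_def)

text \<open>Here the compactness lies: bounded energy gives the summable majorant 1 / (n (n + 1) +
  1) for the squared entries, so Tannery's theorem takes entrywise limits through \<open>sq\<close>.
  The orthogonality constraints survive because each \<open>\<alpha> i\<close> is summable.\<close>

lemma adm_limit:
  assumes f: "\<And>j. f j \<in> adm N" and l: "\<And>n. (\<lambda>j. f j n) \<longlonglongrightarrow> l n"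
  shows "l \<in> adm N" and "(\<lambda>j. sq (f j)) \<longlonglongrightarrow> sq l"
proof -
  have "(\<Sum>n<m. energy c l n) \<le> 1" for m
  proof (rule LIMSEQ_le_const2)
    show "(\<lambda>j. \<Sum>n<m. energy c (f j) n) \<longlonglongrightarrow> (\<Sum>n<m. energy c l n)"
      unfolding energy_def xop_def by (intro tendsto_intros l)
    show "\<exists>J. \<forall>j\<ge>J. (\<Sum>n<m. energy c (f j) n) \<le> 1" using f by (auto simp: adm_def)
  qed
  moreover have "dotp l (\<alpha> i) = 0" if "i \<le> N" for i
  proof -
    have s: "summable (\<lambda>n. \<bar>\<alpha> i n\<bar>)" using rapid_summable[OF rapid, of i 0] by simp
    have "(\<lambda>j. \<Sum>n. f j n * \<alpha> i n) \<longlonglongrightarrow> (\<Sum>n. l n * \<alpha> i n)"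
    proof (rule conjunct2[OF conjunct2[OF tannerys_theorem[OF _ _ s]]])
      show "(\<lambda>j. f j n * \<alpha> i n) \<longlonglongrightarrow> l n * \<alpha> i n" for n by (intro tendsto_intros l)
      show "\<forall>\<^sub>F (n, j) in sequentially \<times>\<^sub>F sequentially. norm (f j n * \<alpha> i n) \<le> \<bar>\<alpha> i n\<bar>"
        using mult_right_mono[OF adm_abs_le[OF f], of "\<bar>\<alpha> i _\<bar>"]
        by (intro always_eventually) (auto simp: abs_mult)
    qed simp
    moreover have "(\<Sum>n. f j n * \<alpha> i n) = 0" for j using f[of j] that by (simp add: adm_def dotp_def)
    ultimately show ?thesis unfolding dotp_def using LIMSEQ_unique[OF _ tendsto_const[of 0]] by simp
  qed
  ultimately show "l \<in> adm N" by (simp add: adm_def)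
  have "(\<lambda>j. \<Sum>n. f j n * f j n) \<longlonglongrightarrow> (\<Sum>n. l n * l n)"
  proof (rule conjunct2[OF conjunct2[OF tannerys_theorem[OF _ _ summable_inverse_quadratic]]])
    show "(\<lambda>j. f j n * f j n) \<longlonglongrightarrow> l n * l n" for n by (intro tendsto_intros l)
    show "\<forall>\<^sub>F (n, j) in sequentially \<times>\<^sub>F sequentially. norm (f j n * f j n) \<le> 1 / (real n * (real n + 1) + 1)"
      using adm_sq_le[OF f] by (intro always_eventually) (auto simp: power2_eq_square)
  qed simp
  then show "(\<lambda>j. sq (f j)) \<longlonglongrightarrow> sq l" by (simp add: dotp_def)
qed

text \<open>Maximizing the norm at bounded energy is minimizing the Rayleigh quotient. All entries
  are bounded by 1, so a maximizing sequence has a diagonal subsequence that converges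
  entrywise.\<close>

lemma maximizer:
  "\<exists>a \<in> adm N. \<forall>v \<in> adm N. sq v \<le> sq a"
proof -
  let ?D = "(\<lambda>v. sq v) ` adm N"
  have z: "(\<lambda>n. 0) \<in> adm N" by (simp add: adm_def energy_def xop_def dotp_def)
  have "sq v \<le> (\<Sum>n. 1 / (real n * (real n + 1) + 1))" if "v \<in> adm N" for v
    unfolding dotp_def using adm_sq_le[OF that]
    by (intro suminf_le summable_inverse_quadratic ell2_mult adm_ell2[OF that]) (simp add: power2_eq_square)
  then have bdd: "bdd_above ?D" by (rule bdd_aboveI2)
  have "\<exists>v\<in>adm N. Sup ?D - inverse (real (Suc j)) < sq v" for j
    using less_cSUP_iff[OF _ bdd, of "Sup ?D - inverse (real (Suc j))"] z by auto
  then obtain f where f: "\<And>j. f j \<in> adm N" "\<And>j. Sup ?D - inverse (real (Suc j)) < sq (f j)"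
    by metis
  obtain k where k: "strict_mono (k :: nat \<Rightarrow> nat)" "\<And>n. n \<in> UNIV \<Longrightarrow> \<exists>l. (\<lambda>j. f (k j) n) \<longlonglongrightarrow> l"
    using function_convergent_subsequence[of "UNIV :: nat set" f 1] adm_abs_le[OF f(1)] by auto
  then obtain l where l: "\<And>n. (\<lambda>j. f (k j) n) \<longlonglongrightarrow> l n" by (metis UNIV_I)
  note L = adm_limit[OF f(1) l]
  have "(\<lambda>j. Sup ?D - inverse (real (Suc j))) \<longlonglongrightarrow> Sup ?D - 0"
    by (intro tendsto_diff tendsto_const LIMSEQ_inverse_real_of_nat)
  then have "((\<lambda>j. Sup ?D - inverse (real (Suc j))) \<circ> k) \<longlonglongrightarrow> Sup ?D"
    using LIMSEQ_subseq_LIMSEQ[OF _ k(1)] by simp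
  then have "Sup ?D \<le> sq l"
    by (rule LIMSEQ_le[OF _ L(2)]) (use f(2) in \<open>auto simp: less_imp_le\<close>)
  moreover have "sq v \<le> Sup ?D" if "v \<in> adm N" for v
    using bdd that by (intro cSup_upper) auto
  ultimately show ?thesis using L(1) by (meson order_trans)
qed

text \<open>Homogeneity: dividing by the root of the energy makes u admissible. Energy 0, where this
  is impossible, forces u = 0.\<close>

lemma rayleigh_scaled:
  assumes max: "\<And>v. v \<in> adm N \<Longrightarrow> sq v \<le> s" and u: "ell2 u" "summable (energy c u)"
    and o: "\<And>i. i \<le> N \<Longrightarrow> dotp u (\<alpha> i) = 0"
  shows "sq u \<le> s * suminf (energy c u)"
proof (cases "suminf (energy c u) = 0")
  case True
  then have e: "energy c u n = 0" for n
    using suminf_eq_zero_iff[OF u(2)] energy_nonneg by blast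
  have "u n = 0" for n
  proof (rule ccontr)
    assume "u n \<noteq> 0"
    then have "(real n * (real n + 1) + 1) * (u n)\<^sup>2 > 0" by (intro mult_pos_pos quadratic_pos) auto
    then have "energy c u n > 0" unfolding energy_def by (rule add_pos_nonneg) simp
    then show False using e[of n] by simp
  qed
  then show ?thesis using True by (simp add: dotp_def)
next
  case False
  define E where "E = suminf (energy c u)"
  have E: "E > 0" using False suminf_nonneg[OF u(2) energy_nonneg] by (simp add: E_def)
  define t where "t = 1 / sqrt E"
  have t2: "t * t = 1 / E" using E by (simp add: t_def)
  have e: "energy c (\<lambda>n. t * u n) n = 1 / E * energy c u n" for n
    unfolding t2[symmetric] by (simp add: energy_def xop_cmult power2_eq_square algebra_simps)
  have "(\<lambda>n. t * u n) \<in> adm N"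
    unfolding adm_def
  proof (intro CollectI conjI allI impI)
    fix m
    have "(\<Sum>n<m. energy c u n) \<le> E"
      unfolding E_def by (intro sum_le_suminf u(2)) (auto simp: energy_nonneg)
    then show "(\<Sum>n<m. energy c (\<lambda>n. t * u n) n) \<le> 1"
      unfolding e sum_distrib_left[symmetric] using E by (simp add: field_simps)
  qed (simp add: dotp_cmult_left u ell2_\<alpha> o)
  from max[OF this] have "t * t * sq u \<le> s"
    by (simp add: dotp_cmult_left ell2_cmult u dotp_commute[of u "\<lambda>n. t * u n"])
  then show ?thesis unfolding t2 E_def[symmetric] using E by (simp add: field_simps)
qed

text \<open>Inserts a + t v into \<open>rayleigh_scaled\<close> and reads off the linear term in t.
  The operator falls on the rapid direction v, so no regularity of \<open>a\<close> beyond finite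
  energy enters.\<close>

lemma euler_lagrange:
  assumes a: "a \<in> adm N" and max: "\<And>v. v \<in> adm N \<Longrightarrow> sq v \<le> sq a"
    and v: "rapid v" and o: "\<And>i. i \<le> N \<Longrightarrow> dotp v (\<alpha> i) = 0"
  shows "sq a * (dotp a (prol c v) + dotp a v) = dotp a v"
proof -
  define s where "s = sq a"
  note a2 = adm_ell2[OF a]
  have v2: "ell2 v" using v by (rule rapid_ell2)
  have s0: "s \<ge> 0" unfolding s_def by (rule dotp_nonneg[OF a2])
  let ?b = "\<lambda>n. (real n * (real n + 1) * (a n * v n) + c\<^sup>2 * (xop a n * xop v n)) + a n * v n"
  note bs = prol_form(2)[OF a2 v, of c] ell2_mult[OF a2 v2]
  have b: "summable ?b" "suminf ?b = dotp a (prol c v) + dotp a v"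
    using summable_add[OF bs] suminf_add[OF bs] prol_form(1)[OF a2 v, of c] by (simp_all add: dotp_def)
  note ev = energy_suminf(1)[OF v, of c]
  define D where "D = dotp a v"
  have "0 \<le> 2 * t * (s * suminf ?b - D) + t\<^sup>2 * (s * suminf (energy c v) - sq v)" for t
  proof -
    let ?u = "\<lambda>n. a n + t * v n"
    have u2: "ell2 ?u" by (intro ell2_add ell2_cmult a2 v2)
    have e: "energy c ?u = (\<lambda>n. energy c a n + (2 * t * ?b n + t\<^sup>2 * energy c v n))"
      by (auto simp: energy_def xop_add xop_cmult power2_eq_square algebra_simps)
    have S1: "summable (\<lambda>n. 2 * t * ?b n)" and S2: "summable (\<lambda>n. t\<^sup>2 * energy c v n)"
      by (intro summable_mult b ev)+
    have se: "summable (energy c ?u)"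
      unfolding e by (intro summable_add[OF adm_summable[OF a]] summable_add[OF S1 S2])
    have "suminf (energy c ?u) = suminf (energy c a) + (2 * t * suminf ?b + t\<^sup>2 * suminf (energy c v))"
      unfolding e suminf_add[OF adm_summable[OF a] summable_add[OF S1 S2], symmetric]
        suminf_add[OF S1 S2, symmetric] suminf_mult[OF b(1)] suminf_mult[OF ev] ..
    then have eu: "suminf (energy c ?u) \<le> 1 + (2 * t * suminf ?b + t\<^sup>2 * suminf (energy c v))"
      using adm_suminf[OF a] by simp
    have "sq ?u = dotp a ?u + t * dotp v ?u"
      by (simp add: dotp_add_left dotp_cmult_left ell2_cmult u2 a2 v2)
    also have "\<dots> = dotp ?u a + t * dotp ?u v" by (simp add: dotp_commute)
    also have "\<dots> = s + 2 * t * D + t\<^sup>2 * sq v"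
      by (simp add: dotp_add_left dotp_cmult_left ell2_cmult a2 v2 s_def D_def dotp_commute[of v a]
          power2_eq_square algebra_simps)
    finally have du: "sq ?u = s + 2 * t * D + t\<^sup>2 * sq v" .
    have "dotp ?u (\<alpha> i) = 0" if "i \<le> N" for i
      using a that by (simp add: dotp_add_left dotp_cmult_left ell2_cmult a2 v2 ell2_\<alpha> o adm_def)
    from rayleigh_scaled[OF max u2 se this] have "sq ?u \<le> s * suminf (energy c ?u)"
      by (simp add: s_def)
    also have "\<dots> \<le> s * (1 + (2 * t * suminf ?b + t\<^sup>2 * suminf (energy c v)))"
      by (rule mult_left_mono[OF eu s0])
    finally show ?thesis unfolding du by (simp add: algebra_simps)
  qed
  from linear_coefficient_zero[OF this] show ?thesis by (simp add: b(2) D_def s_def)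
qed

text \<open>If the maximum s is positive, the maximizer is an eigenvector for 1 / s - 1. By
  \<open>exhaust\<close> this is some \<open>chi j\<close> whose \<open>\<alpha> j\<close> is not
  orthogonal to the maximizer, hence j > N; the Rayleigh bound with 1 / s - 1 >=
  \<open>chi N\<close> is the claim.\<close>

lemma spectral_gap:
  assumes v: "rapid v" and o: "\<And>i. i \<le> N \<Longrightarrow> dotp v (\<alpha> i) = 0"
  shows "chi N * sq v \<le> dotp v (prol c v)"
proof -
  obtain a where a: "a \<in> adm N" and max: "\<And>v. v \<in> adm N \<Longrightarrow> sq v \<le> sq a"
    using maximizer by blast
  define s where "s = sq a"
  note a2 = adm_ell2[OF a]
  have s0: "s \<ge> 0" unfolding s_def by (rule dotp_nonneg[OF a2])
  note v2 = rapid_ell2[OF v]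
  have vv: "sq v \<le> s * (dotp v (prol c v) + sq v)"
    using rayleigh_scaled[OF max v2 energy_suminf(1)[OF v] o] energy_suminf(2)[OF v, of c] by (simp add: s_def)
  have "s * (prol c a k + a k) = a k" for k
  proof -
    \<comment> \<open>A unit vector is not an allowed variation, but its image under
      \<open>R N\<close> is. Since \<open>a\<close> is orthogonal to the removed eigenvectors and
      \<open>R N\<close> commutes with \<open>prol c\<close>, testing with w still yields the k-th
      entry of the equation.\<close>
    define w where "w = R N (delta k)"
    have d2: "ell2 (delta k)" by (rule rapid_ell2[OF rapid_delta])
    have w: "rapid w" unfolding w_def by (rule rapid_R[OF rapid_delta])
    have ow: "dotp w (\<alpha> i) = 0" if "i \<le> N" for i
      unfolding w_def using R_orth[OF d2 that] .
    have z: "dotp a (\<alpha> i) = 0" if "i \<le> N" for i using a that by (simp add: adm_def)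
    have z2: "(\<Sum>i\<le>N. t i * dotp (\<alpha> i) a) = 0" for t
      by (rule sum.neutral) (simp add: dotp_commute[of "\<alpha> _"] z)
    have "dotp a w = dotp w a" by (rule dotp_commute)
    also have "\<dots> = a k" unfolding w_def
      by (simp add: dotp_R[OF d2 a2] z2 dotp_commute[of "delta k"] dotp_delta)
    finally have aw: "dotp a w = a k" .
    have "dotp a (prol c w) = dotp (R N (prol c (delta k))) a"
      unfolding w_def R_prol[OF rapid_delta] by (rule dotp_commute)
    also have "\<dots> = prol c a k"
      by (simp add: dotp_R[OF rapid_ell2[OF rapid_prol[OF rapid_delta]] a2] z2
          dotp_commute[of "prol c (delta k)"] dotp_prol_delta[OF a2])
    finally have apw: "dotp a (prol c w) = prol c a k" .
    show ?thesis using euler_lagrange[OF a max w ow] unfolding aw apw s_def .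
  qed
  then have el: "s * (prol c a k + a k) = a k" for k .
  show ?thesis
  proof (cases "s = 0")
    case True
    then have "sq v = 0" using vv dotp_nonneg[OF v2] by simp
    then show ?thesis using dotp_self_zero[OF v2] by (simp add: dotp_def)
  next
    case False
    then have s: "s > 0" using s0 by simp
    define lam where "lam = 1 / s - 1"
    have "prol c a k = lam * a k" for k
      using el[of k] s by (simp add: lam_def field_simps)
    moreover have "rapid a" by (rule prol_eigen_rapid[OF adm_abs_le[OF a] calculation])
    moreover have "a \<noteq> (\<lambda>n. 0)" using False by (auto simp: s_def dotp_def)
    ultimately obtain j where j: "lam = chi j" "dotp a (\<alpha> j) \<noteq> 0" using exhaust by blast
    have "\<not> j \<le> N" using j(2) a by (auto simp: adm_def)
    then have "chi N \<le> lam" using mono j(1) by (simp add: strict_mono_less_eq)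
    then have "chi N * sq v \<le> lam * sq v" by (intro mult_right_mono dotp_nonneg v2)
    also have "\<dots> \<le> dotp v (prol c v)" using vv s by (simp add: lam_def field_simps)
    finally show ?thesis .
  qed
qed

text \<open>Expands the nonnegative squared norm of A v - chi_N v and bounds its cross term by the
  gap.\<close>

lemma prol_lower:
  assumes v: "rapid v" and o: "\<And>i. i \<le> N \<Longrightarrow> dotp v (\<alpha> i) = 0" and "chi N \<ge> 0"
  shows "(chi N)\<^sup>2 * sq v \<le> sq (prol c v)"
proof -
  note v2 = rapid_ell2[OF v] and p2 = rapid_ell2[OF rapid_prol[OF v, of c]]
  let ?d = "\<lambda>n. prol c v n - chi N * v n"
  have d2: "ell2 ?d" by (intro ell2_diff ell2_cmult p2 v2)
  have "0 \<le> sq ?d" by (rule dotp_nonneg[OF d2])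
  also have "\<dots> = dotp ?d (prol c v) - chi N * dotp ?d v"
    by (subst dotp_diff_left) (auto simp: p2 v2 d2 ell2_cmult dotp_cmult_left dotp_commute)
  also have "\<dots> = sq (prol c v) - 2 * chi N * dotp v (prol c v) + (chi N)\<^sup>2 * sq v"
    by (simp add: dotp_diff_left p2 v2 ell2_cmult dotp_cmult_left dotp_commute[of "prol c v" v] power2_eq_square algebra_simps)
  also have "\<dots> \<le> sq (prol c v) - 2 * chi N * (chi N * sq v) + (chi N)\<^sup>2 * sq v"
    using mult_left_mono[OF spectral_gap[OF v o] assms(3)] by simp
  finally show ?thesis by (simp add: power2_eq_square algebra_simps)
qed

text \<open>By \<open>R_prol\<close> each iterate of the error stays in the complement, so
  \<open>prol_lower\<close> applies m times; the contraction property removes \<open>R N\<close> at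
  the end.\<close>

lemma R_iterate:
  assumes "rapid p" "chi N \<ge> 0"
  shows "(chi N) ^ (2 * m) * sq (R N p) \<le> sq ((prol c ^^ m) p)"
proof -
  have "(chi N) ^ (2 * m) * sq (R N p) \<le> sq (R N ((prol c ^^ m) p))
      \<and> rapid ((prol c ^^ m) p)"
  proof (induction m)
    case (Suc m)
    let ?p = "(prol c ^^ m) p"
    have r: "rapid ?p" using Suc by simp
    have "(chi N) ^ (2 * Suc m) * sq (R N p) \<le> (chi N)\<^sup>2 * sq (R N ?p)"
      using mult_left_mono[OF conjunct1[OF Suc], of "(chi N)\<^sup>2"] by (simp add: power2_eq_square mult.assoc)
    also have "\<dots> \<le> sq (prol c (R N ?p))"
      by (rule prol_lower) (auto simp: rapid_R r R_orth rapid_ell2 assms)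
    also have "\<dots> = sq (R N (prol c ?p))" by (simp add: R_prol r)
    finally show ?case using r by (simp add: rapid_prol)
  qed (simp add: assms)
  then show ?thesis using R_contract[OF rapid_ell2] by (meson order_trans)
qed

text \<open>Summing the Rayleigh quotients of the first \<open>N + 1\<close> eigenvectors replaces the min-max
  principle: the weights \<open>\<Sum>i\<le>N. (\<alpha> i n)\<^sup>2\<close> are at most 1 and add up to \<open>N + 1\<close>.\<close>

lemma chi_lower: "real N ^ 2 / 8 \<le> chi N"
proof -
  \<comment> \<open>With K about N / 2, the product K (K + 1) (N + 1 - K) is at least (N / 2)^2 (N +
    1) / 2; this is the source of the 1/8.\<close>
  define K where "K = (N + 1) div 2"
  have K: "real N / 2 \<le> real K" "real K \<le> (real N + 1) / 2"
  proof -
    have "N \<le> 2 * K" "2 * K \<le> N + 1" unfolding K_def by simp_all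
    then have "real N \<le> 2 * real K" "2 * real K \<le> real N + 1" by linarith+
    then show "real N / 2 \<le> real K" "real K \<le> (real N + 1) / 2" by simp_all
  qed
  \<comment> \<open>Diagonal entries from index K on are at least K (K + 1), so the Rayleigh
    quotient of \<open>\<alpha> i\<close> is at least this number times its mass there.\<close>
  have 1: "real K * (real K + 1) * (1 - (\<Sum>n<K. (\<alpha> i n)\<^sup>2)) \<le> chi i" for i
  proof -
    let ?a = "\<alpha> i"
    have s: "summable (\<lambda>n. (?a n)\<^sup>2)" using ell2_\<alpha> by (simp add: ell2_def)
    have t: "(\<lambda>n. if n < K then (?a n)\<^sup>2 else 0) sums (\<Sum>n<K. (?a n)\<^sup>2)"
      using sums_If_finite_set[of "{..<K}" "\<lambda>n. (?a n)\<^sup>2"] by simp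
    have "suminf (\<lambda>n. (?a n)\<^sup>2) = 1" using orth[of i i] by (simp add: dotp_def power2_eq_square)
    then have "(\<lambda>n. real K * (real K + 1) * ((?a n)\<^sup>2 - (if n < K then (?a n)\<^sup>2 else 0)))
       sums (real K * (real K + 1) * (1 - (\<Sum>n<K. (?a n)\<^sup>2)))"
      using s t by (intro sums_mult sums_diff) (simp_all add: sums_iff)
    moreover have "(\<lambda>n. real n * (real n + 1) * (?a n * ?a n) + c\<^sup>2 * (xop ?a n * xop ?a n)) sums chi i"
    proof -
      have "(\<Sum>n. ?a n * prol c ?a n) = chi i * sq ?a"
        using suminf_mult[OF ell2_mult[OF ell2_\<alpha>[of i] ell2_\<alpha>[of i]], of "chi i"] by (simp add: eig dotp_def mult_ac)
      then show ?thesis using prol_form[OF ell2_\<alpha>[of i] rapid[of i], of c] orth[of i i] by (simp add: sums_iff)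
    qed
    moreover have "real K * (real K + 1) * ((?a n)\<^sup>2 - (if n < K then (?a n)\<^sup>2 else 0))
       \<le> real n * (real n + 1) * (?a n * ?a n) + c\<^sup>2 * (xop ?a n * xop ?a n)" for n
    proof (cases "n < K")
      case False
      then have "real K * (real K + 1) * (?a n * ?a n) \<le> real n * (real n + 1) * (?a n * ?a n)"
        by (intro mult_right_mono mult_mono) auto
      then show ?thesis using False by (simp add: power2_eq_square add_increasing2)
    qed simp
    ultimately show ?thesis by (rule sums_le[rotated 1])
  qed
  \<comment> \<open>Bessel's inequality for the n-th unit vector.\<close>
  have 2: "(\<Sum>i\<le>N. (\<alpha> i n)\<^sup>2) \<le> 1" for n
    using R_sq[OF rapid_ell2[OF rapid_delta[of n]], of N] dotp_nonneg[OF ell2_R[OF rapid_ell2[OF rapid_delta[of n]]], of N]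
    by (simp add: dotp_commute[of "delta n" "\<alpha> _"] dotp_delta) (simp add: delta_def)
  have "real K * (real K + 1) * (real (N + 1) - real K) \<le> real K * (real K + 1) * (real (N + 1) - (\<Sum>n<K. \<Sum>i\<le>N. (\<alpha> i n)\<^sup>2))"
    using sum_mono[of "{..<K}" "\<lambda>n. \<Sum>i\<le>N. (\<alpha> i n)\<^sup>2" "\<lambda>_. 1"] 2 by (intro mult_left_mono) auto
  also have "(\<Sum>n<K. \<Sum>i\<le>N. (\<alpha> i n)\<^sup>2) = (\<Sum>i\<le>N. \<Sum>n<K. (\<alpha> i n)\<^sup>2)" by (rule sum.swap)
  also have "real K * (real K + 1) * (real (N + 1) - (\<Sum>i\<le>N. \<Sum>n<K. (\<alpha> i n)\<^sup>2))
      = (\<Sum>i\<le>N. real K * (real K + 1) * (1 - (\<Sum>n<K. (\<alpha> i n)\<^sup>2)))"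
    by (simp add: sum_distrib_left[symmetric] sum_subtractf)
  also have "\<dots> \<le> (\<Sum>i\<le>N. chi N)"
    using mono by (intro sum_mono order_trans[OF 1]) (simp add: strict_mono_less_eq)
  finally have "real K * (real K + 1) * (real N + 1 - real K) \<le> (real N + 1) * chi N" by (simp add: add.commute)
  moreover have "(real N / 2)\<^sup>2 * ((real N + 1) / 2) \<le> real K * (real K + 1) * (real N + 1 - real K)"
    using K unfolding power2_eq_square by (intro mult_mono) auto
  ultimately have "(real N + 1) * (real N ^ 2 / 8) \<le> (real N + 1) * chi N"
    by (simp add: power2_eq_square field_simps)
  then show ?thesis by (rule mult_left_le_imp_le) simp
qed

end

section \<open>Prolate eigenfunctions\<close>

lemma divide_times_sqrt:
  fixes A t :: real
  assumes "A > 0"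
  shows "t / A * sqrt A = t / sqrt A"
proof -
  have "t / A * sqrt A = t * (sqrt A / A)" by (simp only: times_divide_eq_left times_divide_eq_right)
  also have "sqrt A / A = inverse (sqrt A)" by (rule sqrt_divide_self_eq) (use assms in simp)
  finally show ?thesis by (simp only: divide_inverse)
qed

text \<open>Normalization makes the three-term recurrence symmetric, so that multiplication by x
  acts on coefficients by the same matrix \<open>xop\<close>.\<close>

lemma leg_on_times_x: "x * leg_on n x = jac n * leg_on (n - 1) x + jac (Suc n) * leg_on (Suc n) x"
proof -
  define g where "g n = sqrt (real n + 1/2)" for n
  have g: "g n = sqrt (2 * real n + 1) / sqrt 2" for n
    unfolding g_def real_sqrt_divide[symmetric] by (simp add: field_simps)
  have up: "jac (Suc n) * g (Suc n) = (real n + 1) / (2 * real n + 1) * g n"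
  proof -
    have "(real n + 1) / (2 * real n + 1) * sqrt (2 * real n + 1) = (real n + 1) / sqrt (2 * real n + 1)"
      by (rule divide_times_sqrt) simp
    moreover have "jac (Suc n) * g (Suc n) = (real n + 1) / sqrt (2 * real n + 1) / sqrt 2"
      unfolding jac_def g by (simp add: add.commute)
    ultimately show ?thesis unfolding g by simp
  qed
  show ?thesis
  proof (cases n)
    case 0
    then show ?thesis using up[unfolded g_def] by (simp add: leg_on_def)
  next
    case (Suc m)
    have down: "jac n * g m = real n / (2 * real n + 1) * g n"
    proof -
      have "real n / (2 * real n + 1) * sqrt (2 * real n + 1) = real n / sqrt (2 * real n + 1)"
        by (rule divide_times_sqrt) simp
      moreover have "jac n * g m = real n / sqrt (2 * real n + 1) / sqrt 2"
        unfolding jac_def g Suc by (simp add: add.commute)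
      ultimately show ?thesis unfolding g by simp
    qed
    have "x * Leg n x = (real n + 1) / (2 * real n + 1) * Leg (Suc n) x + real n / (2 * real n + 1) * Leg m x"
      using leg_rec[of m x] unfolding Suc by (simp add: divide_simps) (simp add: algebra_simps)
    then have "x * leg_on n x = ((real n + 1) / (2 * real n + 1) * g n) * Leg (Suc n) x + (real n / (2 * real n + 1) * g n) * Leg m x"
      unfolding leg_on_def g_def[symmetric] by algebra
    also have "\<dots> = jac n * leg_on m x + jac (Suc n) * leg_on (Suc n) x"
      unfolding up[symmetric] down[symmetric] leg_on_def g_def[symmetric] by (simp add: algebra_simps)
    finally show ?thesis using Suc by simp
  qed
qed

lemma L2_times_x: "u \<in> L2_space Iref \<Longrightarrow> (\<lambda>x. x * u x) \<in> L2_space Iref"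
  by (rule L2_times_bounded[where B = 1]) (auto intro: continuous_imp_measurable_on_sets_lebesgue continuous_intros)

lemma coef_times_x:
  assumes "u \<in> L2_space Iref"
  shows "coef (\<lambda>x. x * u x) = xop (coef u)"
proof
  fix n
  have "coef (\<lambda>x. x * u x) n = ip u (\<lambda>x. x * leg_on n x)"
    unfolding coef_def ip_def by (rule Bochner_Integration.integral_cong) auto
  also have "\<dots> = ip u (\<lambda>x. jac n * leg_on (n - 1) x + jac (Suc n) * leg_on (Suc n) x)"
    by (simp only: leg_on_times_x)
  also have "\<dots> = xop (coef u) n"
    by (simp add: ip_add_right ip_cmult_right L2_cmult assms xop_def coef_def)
  finally show "coef (\<lambda>x. x * u x) n = xop (coef u) n" .
qed

lemma ell2_coef: "u \<in> L2_space Iref \<Longrightarrow> ell2 (coef u)"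
  unfolding ell2_def by (rule coef_sq_summable)

lemma dotp_coef: "u \<in> L2_space Iref \<Longrightarrow> v \<in> L2_space Iref \<Longrightarrow> dotp (coef u) (coef v) = ip u v"
  using parseval_ip[of u v] by (simp add: dotp_def sums_iff)

text \<open>The triangle inequality in squared form, relative to a common scale s. The
  Cauchy-Schwarz step comes from the nonnegative squared norm of B u - A v.\<close>

lemma dotp_minkowski:
  assumes u: "ell2 u" and v: "ell2 v" and A: "A \<ge> 0" "sq u \<le> A\<^sup>2 * s"
    and B: "B \<ge> 0" "sq v \<le> B\<^sup>2 * s"
  shows "sq (\<lambda>n. u n + v n) \<le> (A + B)\<^sup>2 * s"
proof -
  have e: "sq (\<lambda>n. x * u n + y * v n)
      = x\<^sup>2 * sq u + 2 * x * y * dotp u v + y\<^sup>2 * sq v" for x y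
  proof -
    let ?w = "\<lambda>n. x * u n + y * v n"
    have w: "ell2 ?w" by (intro ell2_add ell2_cmult u v)
    have "sq ?w = x * dotp ?w u + y * dotp ?w v"
      by (subst dotp_add_left) (simp_all add: ell2_cmult u v w dotp_cmult_left dotp_commute)
    then show ?thesis
      by (simp add: dotp_add_left dotp_cmult_left ell2_cmult u v dotp_commute[of v u] power2_eq_square algebra_simps)
  qed
  have "dotp u v \<le> A * B * s"
  proof (cases "A = 0 \<or> B = 0")
    case True
    then have "sq u = 0 \<or> sq v = 0" using A B dotp_nonneg[OF u] dotp_nonneg[OF v] by auto
    then have "u = (\<lambda>n. 0) \<or> v = (\<lambda>n. 0)" using dotp_self_zero u v by blast
    then show ?thesis using True by (auto simp: dotp_def)
  next
    case False
    then have AB: "A > 0" "B > 0" using A B by auto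
    have "0 \<le> sq (\<lambda>n. B * u n + (-A) * v n)"
      by (intro dotp_nonneg ell2_add ell2_cmult u v)
    also have "\<dots> = B\<^sup>2 * sq u - 2 * A * B * dotp u v + A\<^sup>2 * sq v" by (simp only: e) simp
    also have "\<dots> \<le> B\<^sup>2 * (A\<^sup>2 * s) - 2 * A * B * dotp u v + A\<^sup>2 * (B\<^sup>2 * s)"
      by (intro add_mono diff_right_mono mult_left_mono A B) auto
    finally have "(2 * A * B) * dotp u v \<le> (2 * A * B) * (A * B * s)"
      by (simp add: power2_eq_square algebra_simps)
    then show ?thesis using AB by (subst (asm) mult_le_cancel_left_pos) auto
  qed
  moreover have "sq (\<lambda>n. u n + v n) = sq u + 2 * dotp u v + sq v"
    using e[of 1 1] by simp
  ultimately show ?thesis using A B by (simp add: power2_eq_square algebra_simps)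
qed

lemma coef_leg_sum: "coef (\<lambda>x. \<Sum>n\<le>K. p n * leg_on n x) n = (if n \<le> K then p n else 0)"
proof -
  have "coef (\<lambda>x. \<Sum>n\<le>K. p n * leg_on n x) n = (\<Sum>k\<le>K. p k * coef (leg_on k) n)"
    by (subst coef_sum) (auto simp: L2_cmult coef_cmult)
  then show ?thesis by (simp add: coef_def leg_on_orthonormal if_distrib cong: if_cong)
qed

text \<open>The bound 1 for multiplication by x^2 is read off on the function side, where |x| < 1,
  and carried over by Parseval. Its exact value matters, as c^2 may be as large as q^2 chi_N with q
  close to 1.\<close>

lemma prol_finite_bound:
  assumes K: "\<And>n. n > K \<Longrightarrow> p n = 0"
  shows "sq (prol c p) \<le> (real K * (real K + 1) + c\<^sup>2)\<^sup>2 * sq p"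
    and "\<And>n. n > K + 2 \<Longrightarrow> prol c p n = 0"
proof -
  show "prol c p n = 0" if "n > K + 2" for n
    using that by (auto simp: prol_def xop_def K)
  define f where "f = (\<lambda>x. \<Sum>n\<le>K. p n * leg_on n x)"
  have f: "f \<in> L2_space Iref" unfolding f_def by (intro L2_sum L2_cmult) auto
  have cf: "coef f = p" unfolding f_def by (auto simp: coef_leg_sum K fun_eq_iff)
  let ?g = "\<lambda>x. x * (x * f x)"
  have g: "?g \<in> L2_space Iref" by (intro L2_times_x f)
  have cg: "coef ?g = xop (xop p)" by (simp only: coef_times_x L2_times_x f cf)
  have p2: "ell2 p" using ell2_coef[OF f] cf by simp
  have "nsq ?g \<le> nsq f"
    unfolding ip_def
  proof (rule integral_mono)
    fix x assume "x \<in> space (lebesgue_on Iref)"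
    then have "\<bar>x\<bar> \<le> 1" by auto
    then have "x\<^sup>2 \<le> 1" by (simp add: abs_square_le_1)
    then have "\<bar>x * x\<bar> \<le> 1" by (simp add: power2_eq_square)
    then have "(x * x)\<^sup>2 \<le> 1" by (simp add: abs_square_le_1)
    then show "?g x * ?g x \<le> f x * f x"
      using mult_right_mono[of "(x * x)\<^sup>2" 1 "f x * f x"] by (simp add: power2_eq_square mult_ac)
  qed (auto intro: L2_mult_integrable f g)
  then have xx: "sq (xop (xop p)) \<le> sq p"
    using dotp_coef[OF g g] dotp_coef[OF f f] by (simp add: cg cf)
  have w2: "ell2 (\<lambda>n. real n * (real n + 1) * p n)"
    by (rule rapid_ell2, rule rapid_weight, rule rapid_finite[of K]) (rule K)
  show "sq (prol c p) \<le> (real K * (real K + 1) + c\<^sup>2)\<^sup>2 * sq p"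
    unfolding prol_def
  proof (rule dotp_minkowski[OF w2 ell2_cmult[OF ell2_xop[OF ell2_xop[OF p2]]]])
    show "sq (\<lambda>n. real n * (real n + 1) * p n) \<le> (real K * (real K + 1))\<^sup>2 * sq p"
      unfolding dotp_def suminf_mult[OF ell2_mult[OF p2 p2], symmetric]
    proof (rule suminf_le)
      fix n
      show "real n * (real n + 1) * p n * (real n * (real n + 1) * p n) \<le> (real K * (real K + 1))\<^sup>2 * (p n * p n)"
      proof (cases "n \<le> K")
        case True
        then have "(real n * (real n + 1))\<^sup>2 \<le> (real K * (real K + 1))\<^sup>2"
          by (intro power_mono mult_mono) auto
        from mult_right_mono[OF this, of "p n * p n"] show ?thesis by (simp add: power2_eq_square mult_ac)
      qed (simp add: K)
    qed (use ell2_mult[OF w2 w2] summable_mult[OF ell2_mult[OF p2 p2]] in auto)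
    show "sq (\<lambda>n. c\<^sup>2 * xop (xop p) n) \<le> (c\<^sup>2)\<^sup>2 * sq p"
    proof -
      have x2: "ell2 (xop (xop p))" by (intro ell2_xop p2)
      have "sq (\<lambda>n. c\<^sup>2 * xop (xop p) n) = (c\<^sup>2)\<^sup>2 * sq (xop (xop p))"
        using suminf_mult[OF ell2_mult[OF x2 x2], of "(c\<^sup>2)\<^sup>2"]
        by (simp add: dotp_def power2_eq_square mult_ac)
      then show ?thesis using xx by (simp add: mult_left_mono)
    qed
  qed auto
qed

text \<open>If the flux did not vanish at the endpoint, \<open>f\<close> would grow like \<open>ln (1 - y)\<close>.\<close>

lemma flux_le_dist_right:
  fixes f F :: "real \<Rightarrow> real"
  assumes der: "\<And>y. y \<in> Iref \<Longrightarrow> (f has_real_derivative F y / (1 - y\<^sup>2)) (at y)"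
    and lip: "\<And>y z. y \<in> Iref \<Longrightarrow> z \<in> Iref \<Longrightarrow> \<bar>F y - F z\<bar> \<le> B * \<bar>y - z\<bar>"
    and bd: "\<And>y. y \<in> Iref \<Longrightarrow> \<bar>f y\<bar> \<le> M"
    and y0: "y0 \<in> Iref"
  shows "F y0 \<le> B * (1 - y0)"
proof (rule ccontr)
  assume asm: "\<not> F y0 \<le> B * (1 - y0)"
  define e where "e = F y0 - B * (1 - y0)"
  have e: "e > 0" using asm by (simp add: e_def)
  have "M \<ge> 0" using bd[OF y0] by linarith
  have "B \<ge> 0" using lip[of 0 "1/2"] by (simp add: abs_if split: if_splits)
  \<comment> \<open>So close to 1 that ln (1 - y) drops by (4 M + 1) / e between y0 and y1. At the
    rate e / 2 used below, f would rise by 2 M + 1/2, which the bound M forbids.\<close>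
  define y1 where "y1 = 1 - (1 - y0) * exp (- ((4 * M + 1) / e))"
  have ex: "exp (- ((4 * M + 1) / e)) < 1" using e \<open>M \<ge> 0\<close> by (simp add: divide_pos_pos)
  then have k1: "(1 - y0) * exp (- ((4 * M + 1) / e)) \<le> (1 - y0) * 1"
    using y0 by (intro mult_left_mono) auto
  have k2: "0 < (1 - y0) * exp (- ((4 * M + 1) / e))" using y0 by simp
  have y1: "y0 \<le> y1" unfolding y1_def using k1 by (simp only: mult_1_right le_diff_eq diff_le_eq add.commute)
  have y1': "y1 < 1" unfolding y1_def using k2 by (simp only: diff_less_eq less_add_same_cancel1)
  \<comment> \<open>Monotone because the flux stays above e, whence f' >= e / (1 - y^2) >= e / (2 (1
    - y)).\<close>
  let ?h = "\<lambda>y. f y + e / 2 * ln (1 - y)"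
  have "?h y0 \<le> ?h y1"
  proof (rule DERIV_nonneg_imp_nondecreasing[where f = ?h, OF y1])
    fix y assume y: "y0 \<le> y" "y \<le> y1"
    then have yI: "y \<in> Iref" using y0 y1 y1' by auto
    have d: "(?h has_real_derivative F y / (1 - y\<^sup>2) + e / 2 * (- 1 / (1 - y))) (at y)"
    proof -
      have "((\<lambda>y. ln (1 - y)) has_real_derivative - 1 / (1 - y)) (at y)"
        using yI by (auto intro!: derivative_eq_intros)
      then show ?thesis by (intro DERIV_add der yI DERIV_cmult)
    qed
    have "F y \<ge> F y0 - B * (y - y0)" using lip[OF yI y0] y by simp
    moreover have "B * (y - y0) \<le> B * (1 - y0)" using \<open>B \<ge> 0\<close> yI by (intro mult_left_mono) auto
    ultimately have "F y \<ge> e" by (simp add: e_def)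
    have "e / 2 * (1 / (1 - y)) = e / (2 * (1 - y))" by (simp only: times_divide_times_eq mult_1_right)
    also have "\<dots> \<le> e / (1 - y\<^sup>2)"
    proof (rule divide_left_mono)
      have "(1 - y) * (1 + y) \<le> (1 - y) * 2" using yI by (intro mult_left_mono) auto
      then show "1 - y\<^sup>2 \<le> 2 * (1 - y)" by (simp add: power2_eq_square algebra_simps)
      show "0 < 2 * (1 - y) * (1 - y\<^sup>2)" using yI by (auto intro!: mult_pos_pos simp: abs_square_less_1)
    qed (use e in simp)
    also have "\<dots> \<le> F y / (1 - y\<^sup>2)"
      using \<open>F y \<ge> e\<close> yI by (intro divide_right_mono) (auto simp: abs_square_le_1)
    finally have "0 \<le> F y / (1 - y\<^sup>2) + e / 2 * (- 1 / (1 - y))" by simp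
    with d show "\<exists>z. (?h has_real_derivative z) (at y) \<and> 0 \<le> z" by (intro exI conjI)
  qed
  moreover have "ln (1 - y1) = ln (1 - y0) - (4 * M + 1) / e"
    using y0 by (simp add: y1_def ln_mult)
  ultimately have "f y0 + e / 2 * ((4 * M + 1) / e) \<le> f y1"
    by (simp add: algebra_simps)
  moreover have "e / 2 * ((4 * M + 1) / e) = 2 * M + 1 / 2" using e by (simp add: field_simps)
  ultimately have "f y0 + (2 * M + 1 / 2) \<le> f y1" by linarith
  then show False using bd[OF y0] bd[of y1] y0 y1 y1' by auto
qed

text \<open>\<open>F\<close> is the flux \<open>(1 - y\<^sup>2) f'\<close>; the last conjunct makes it vanish at both endpoints.\<close>

definition green_pair :: "(real \<Rightarrow> real) \<Rightarrow> (real \<Rightarrow> real) \<Rightarrow> (real \<Rightarrow> real) \<Rightarrow> bool" where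
  "green_pair f F f2 \<longleftrightarrow>
     (\<forall>y\<in>Iref. (f has_real_derivative F y / (1 - y\<^sup>2)) (at y) \<and> (F has_real_derivative f2 y) (at y)) \<and>
     (\<exists>M. \<forall>y\<in>Iref. \<bar>f y\<bar> \<le> M \<and> \<bar>F y\<bar> \<le> M * (1 - \<bar>y\<bar>))"

lemma one_minus_sq_pos: "y \<in> Iref \<Longrightarrow> 0 < 1 - y\<^sup>2" for y :: real
  by (auto simp: abs_square_less_1)

lemma green_pair_poly: "green_pair (poly p) (\<lambda>y. (1 - y\<^sup>2) * poly (pderiv p) y)
    (poly ([:1, 0, -1:] * pderiv (pderiv p) - [:0, 2:] * pderiv p))"
proof -
  obtain A B where A: "\<And>x. x \<in> Iref \<Longrightarrow> \<bar>poly p x\<bar> \<le> A" and B: "\<And>x. x \<in> Iref \<Longrightarrow> \<bar>poly (pderiv p) x\<bar> \<le> B"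
    using poly_bounded_Iref[of p] poly_bounded_Iref[of "pderiv p"] by blast
  have B0: "B \<ge> 0" using B[of 0] by simp
  have "\<bar>(1 - y\<^sup>2) * poly (pderiv p) y\<bar> \<le> max A (2 * B) * (1 - \<bar>y\<bar>)" if y: "y \<in> Iref" for y
  proof -
    have "\<bar>(1 - y\<^sup>2) * poly (pderiv p) y\<bar> = (1 - y\<^sup>2) * \<bar>poly (pderiv p) y\<bar>"
      using one_minus_sq_pos[OF y] by (simp add: abs_mult)
    also have "\<dots> = (1 + \<bar>y\<bar>) * (1 - \<bar>y\<bar>) * \<bar>poly (pderiv p) y\<bar>"
      by (simp add: algebra_simps power2_eq_square flip: abs_mult)
    also have "\<dots> \<le> 2 * (1 - \<bar>y\<bar>) * B"
      using y by (intro mult_mono B) (auto intro!: mult_nonneg_nonneg)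
    also have "\<dots> \<le> max A (2 * B) * (1 - \<bar>y\<bar>)"
      using y by (subst mult.assoc, subst mult.left_commute, subst mult.commute) (auto intro!: mult_right_mono)
    finally show ?thesis .
  qed
  moreover have "\<bar>poly p y\<bar> \<le> max A (2 * B)" if "y \<in> Iref" for y using A[OF that] by simp
  moreover have "((\<lambda>y. (1 - y\<^sup>2) * poly (pderiv p) y) has_real_derivative
      poly ([:1, 0, -1:] * pderiv (pderiv p) - [:0, 2:] * pderiv p) y) (at y)" for y
    by (rule derivative_eq_intros poly_DERIV refl)+ (simp add: algebra_simps power2_eq_square)
  moreover have "(poly p has_real_derivative (1 - y\<^sup>2) * poly (pderiv p) y / (1 - y\<^sup>2)) (at y)" if "y \<in> Iref" for y
    using one_minus_sq_pos[OF that] poly_DERIV[of p y] by simp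
  ultimately show ?thesis unfolding green_pair_def by blast
qed

lemma green_pair_L2:
  assumes "green_pair f F f2"
  shows "f \<in> L2_space Iref"
proof -
  obtain M where M: "\<And>y. y \<in> Iref \<Longrightarrow> \<bar>f y\<bar> \<le> M" using assms unfolding green_pair_def by metis
  have "isCont f y" if "y \<in> Iref" for y
    using assms that unfolding green_pair_def by (intro DERIV_isCont) auto
  then have "continuous_on Iref f" by (intro continuous_at_imp_continuous_on) simp
  then show ?thesis by (rule L2_bounded_continuous[OF _ M])
qed

text \<open>Both functions are bounded and both fluxes are O(1 - |y|), so the weighted Wronskian
  extends continuously by 0. Boundary terms in Green's identity therefore vanish.\<close>

lemma wronskian:
  assumes f: "green_pair f F f2" and g: "green_pair g G g2"
  defines "h \<equiv> \<lambda>y. if y \<in> Iref then F y * g y - f y * G y else 0"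
  shows "continuous_on {-1..1} h"
    and "\<And>y. y \<in> Iref \<Longrightarrow> (h has_real_derivative f2 y * g y - f y * g2 y) (at y)"
proof -
  obtain M where M: "\<And>y. y \<in> Iref \<Longrightarrow> \<bar>f y\<bar> \<le> M" "\<And>y. y \<in> Iref \<Longrightarrow> \<bar>F y\<bar> \<le> M * (1 - \<bar>y\<bar>)"
    using f unfolding green_pair_def by blast
  obtain N where N: "\<And>y. y \<in> Iref \<Longrightarrow> \<bar>g y\<bar> \<le> N" "\<And>y. y \<in> Iref \<Longrightarrow> \<bar>G y\<bar> \<le> N * (1 - \<bar>y\<bar>)"
    using g unfolding green_pair_def by blast
  have M0: "M \<ge> 0" "N \<ge> 0" using M(1)[of 0] N(1)[of 0] by auto
  show der: "(h has_real_derivative f2 y * g y - f y * g2 y) (at y)" if y: "y \<in> Iref" for y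
  proof -
    have d: "(f has_real_derivative F y / (1 - y\<^sup>2)) (at y)" "(F has_real_derivative f2 y) (at y)"
      "(g has_real_derivative G y / (1 - y\<^sup>2)) (at y)" "(G has_real_derivative g2 y) (at y)"
      using f g y by (auto simp: green_pair_def)
    have "((\<lambda>y. F y * g y - f y * G y) has_real_derivative
       (f2 y * g y + G y / (1 - y\<^sup>2) * F y) - (F y / (1 - y\<^sup>2) * G y + g2 y * f y)) (at y)"
      by (intro DERIV_diff DERIV_mult d)
    then have "((\<lambda>y. F y * g y - f y * G y) has_real_derivative f2 y * g y - f y * g2 y) (at y)"
      by (simp add: algebra_simps)
    then show ?thesis
      by (rule has_field_derivative_transform_within_open[of _ _ _ Iref]) (use y in \<open>auto simp: h_def\<close>)
  qed
  have bound: "\<bar>h y\<bar> \<le> 2 * M * N * (1 - \<bar>y\<bar>)" if y: "y \<in> {-1..1}" for y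
  proof (cases "y \<in> Iref")
    case True
    have "\<bar>h y\<bar> \<le> \<bar>F y\<bar> * \<bar>g y\<bar> + \<bar>f y\<bar> * \<bar>G y\<bar>"
      using True abs_triangle_ineq4[of "F y * g y" "f y * G y"] by (simp add: h_def abs_mult)
    also have "\<dots> \<le> M * (1 - \<bar>y\<bar>) * N + M * (N * (1 - \<bar>y\<bar>))"
      using True M0 by (intro add_mono mult_mono M N) auto
    finally show ?thesis by (simp add: algebra_simps)
  next
    case False
    then show ?thesis using M0 y by (auto simp: h_def intro!: mult_nonneg_nonneg)
  qed
  show "continuous_on {-1..1} h"
    unfolding continuous_on
  proof
    fix y :: real assume y: "y \<in> {-1..1}"
    show "(h \<longlongrightarrow> h y) (at y within {-1..1})"
    proof (cases "y \<in> Iref")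
      case True
      then show ?thesis using DERIV_isCont[OF der[OF True]]
        by (simp add: isCont_def tendsto_within_subset[OF _ subset_UNIV])
    next
      case False
      then have "\<bar>y\<bar> = 1" using y by auto
      have "((\<lambda>z. 2 * M * N * (1 - \<bar>z\<bar>)) \<longlongrightarrow> 2 * M * N * (1 - \<bar>y\<bar>)) (at y within {-1..1})"
        by (intro tendsto_intros)
      then have "((\<lambda>z. 2 * M * N * (1 - \<bar>z\<bar>)) \<longlongrightarrow> 0) (at y within {-1..1})" using \<open>\<bar>y\<bar> = 1\<close> by simp
      then have "(h \<longlongrightarrow> 0) (at y within {-1..1})"
        by (rule Lim_null_comparison[rotated])
          (auto simp: eventually_at_filter intro!: always_eventually bound)
      moreover have "h y = 0" unfolding h_def using False by (simp only: if_False)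
      ultimately show ?thesis by simp
    qed
  qed
qed

lemma green_identity:
  assumes f: "green_pair f F f2" and g: "green_pair g G g2"
    and f2: "f2 \<in> L2_space Iref" and g2: "g2 \<in> L2_space Iref"
  shows "ip f2 g = ip f g2"
proof -
  note L = L2_mult_integrable[OF Iref_lebesgue f2 green_pair_L2[OF g]]
    L2_mult_integrable[OF Iref_lebesgue green_pair_L2[OF f] g2]
  have "(\<integral>x. f2 x * g x - f x * g2 x \<partial>lebesgue_on Iref) = 0 - 0"
    by (subst ip_FTC[OF wronskian[OF f g]]) (auto intro: Bochner_Integration.integrable_diff L)
  then show ?thesis unfolding ip_def using Bochner_Integration.integral_diff[OF L] by simp
qed

text \<open>The equation bounds the derivative of the flux, so the flux is Lipschitz and
  \<open>flux_le_dist_right\<close> applies. That bound is one-sided and concerns the right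
  endpoint; sign changes and reflection supply the other three cases.\<close>

lemma prolate_green_pair:
  assumes "prolate_eigenfunction c lam f"
  shows "green_pair f (\<lambda>y. (1 - y\<^sup>2) * deriv f y) (\<lambda>y. (c\<^sup>2 * y\<^sup>2 - lam) * f y)"
proof -
  let ?F = "\<lambda>y. (1 - y\<^sup>2) * deriv f y"
  have "bounded (f ` Iref)" using assms by (simp add: prolate_eigenfunction_def)
  then obtain M where "\<forall>x\<in>Iref. \<bar>f x\<bar> \<le> M" by (auto simp: bounded_iff)
  then have M: "\<And>y. y \<in> Iref \<Longrightarrow> \<bar>f y\<bar> \<le> M" by blast
  have M0: "M \<ge> 0" using M[of 0] by simp
  have d1: "(f has_real_derivative ?F y / (1 - y\<^sup>2)) (at y)" if "y \<in> Iref" for y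
    using assms that one_minus_sq_pos[OF that]
    by (simp add: prolate_eigenfunction_def DERIV_deriv_iff_real_differentiable)
  have d2: "(?F has_real_derivative (c\<^sup>2 * y\<^sup>2 - lam) * f y) (at y)" if "y \<in> Iref" for y
  proof -
    have "(?F has_real_derivative deriv ?F y) (at y)"
      using assms that by (simp add: prolate_eigenfunction_def DERIV_deriv_iff_real_differentiable)
    moreover have "- deriv ?F y + c\<^sup>2 * y\<^sup>2 * f y = lam * f y"
      using assms that unfolding prolate_eigenfunction_def by blast
    then have "deriv ?F y = (c\<^sup>2 * y\<^sup>2 - lam) * f y" unfolding left_diff_distrib by linarith
    ultimately show ?thesis by (simp only:)
  qed
  define B where "B = (c\<^sup>2 + \<bar>lam\<bar>) * M"
  have G: "\<bar>(c\<^sup>2 * y\<^sup>2 - lam) * f y\<bar> \<le> B" if y: "y \<in> Iref" for y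
  proof -
    have "y\<^sup>2 \<le> 1" using one_minus_sq_pos[OF y] by simp
    then have "c\<^sup>2 * y\<^sup>2 \<le> c\<^sup>2 * 1" by (intro mult_left_mono) auto
    then have "\<bar>c\<^sup>2 * y\<^sup>2 - lam\<bar> \<le> c\<^sup>2 + \<bar>lam\<bar>"
    proof -
      have "0 \<le> c\<^sup>2 * y\<^sup>2" "lam \<le> \<bar>lam\<bar>" "- lam \<le> \<bar>lam\<bar>" by auto
      then show ?thesis using \<open>c\<^sup>2 * y\<^sup>2 \<le> c\<^sup>2 * 1\<close> unfolding abs_le_iff by linarith
    qed
    then show ?thesis unfolding B_def abs_mult by (intro mult_mono M y) auto
  qed
  have lip: "\<bar>?F y - ?F z\<bar> \<le> B * \<bar>y - z\<bar>" if "y \<in> Iref" "z \<in> Iref" for y z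
    unfolding real_norm_def[symmetric]
    by (rule field_differentiable_bound[of Iref, OF _ has_field_derivative_at_within[OF d2]])
      (use G that in auto)
  have b1: "?F y \<le> B * (1 - y)" if "y \<in> Iref" for y
    by (rule flux_le_dist_right[OF d1 lip M that])
  have b2: "- ?F y \<le> B * (1 - y)" if y: "y \<in> Iref" for y
  proof (rule flux_le_dist_right[of "\<lambda>y. - f y" "\<lambda>y. - ?F y", OF _ _ _ y])
    show "((\<lambda>y. - f y) has_real_derivative - ?F y / (1 - y\<^sup>2)) (at y)" if "y \<in> Iref" for y
      using DERIV_minus[OF d1[OF that]] by (simp only: minus_divide_left)
    show "\<bar>- ?F y - - ?F z\<bar> \<le> B * \<bar>y - z\<bar>" if "y \<in> Iref" "z \<in> Iref" for y z
      using lip[OF that] by (simp only: minus_diff_minus abs_minus_cancel)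
    show "\<bar>- f y\<bar> \<le> M" if "y \<in> Iref" for y using M[OF that] by simp
  qed
  \<comment> \<open>Reflection reverses the sign of the flux, hence the factor - s in front of f; s
    = 1 and s = -1 give the two bounds at the left endpoint.\<close>
  have b3: "s * ?F (- y) \<le> B * (1 - y)" if y: "y \<in> Iref" and s: "\<bar>s\<bar> = 1" for y s
  proof (rule flux_le_dist_right[of "\<lambda>y. - s * f (- y)" "\<lambda>y. s * ?F (- y)", OF _ _ _ y])
    fix y assume y: "y \<in> Iref"
    have "((\<lambda>y. f (- y)) has_real_derivative ?F (- y) / (1 - (- y)\<^sup>2) * (- 1)) (at y)"
      by (rule DERIV_chain2[OF d1]) (use y in \<open>auto intro!: derivative_eq_intros\<close>)
    from DERIV_cmult[OF this, of "- s"]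
    show "((\<lambda>y. - s * f (- y)) has_real_derivative s * ?F (- y) / (1 - y\<^sup>2)) (at y)"
      by (rule DERIV_cong) (simp only: power2_minus mult_minus_right mult_minus_left mult_1_right minus_minus times_divide_eq_right)
    show "\<bar>- s * f (- y)\<bar> \<le> M" using M[of "- y"] y s by (simp add: abs_mult)
    fix z assume z: "z \<in> Iref"
    have "\<bar>s * ?F (- y) - s * ?F (- z)\<bar> = \<bar>s\<bar> * \<bar>?F (- y) - ?F (- z)\<bar>"
      unfolding right_diff_distrib[symmetric] abs_mult ..
    also have "\<dots> \<le> B * \<bar>y - z\<bar>" using lip[of "- y" "- z"] y z s by (simp add: abs_minus_commute)
    finally show "\<bar>s * ?F (- y) - s * ?F (- z)\<bar> \<le> B * \<bar>y - z\<bar>" .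
  qed
  have F: "\<bar>?F y\<bar> \<le> max M B * (1 - \<bar>y\<bar>)" if y: "y \<in> Iref" for y
  proof -
    have y': "- y \<in> Iref" using y by auto
    have "?F y \<le> B * (1 + y)" "- ?F y \<le> B * (1 + y)"
      using b3[OF y', of 1] b3[OF y', of "- 1"] by simp_all
    with b1[OF y] b2[OF y] have "\<bar>?F y\<bar> \<le> B * (1 - \<bar>y\<bar>)"
      by (cases "y \<ge> 0") (simp_all only: abs_le_iff abs_of_nonneg abs_of_neg not_le diff_minus_eq_add simp_thms)
    also have "\<dots> \<le> max M B * (1 - \<bar>y\<bar>)" using y by (intro mult_right_mono) auto
    finally show ?thesis .
  qed
  have "\<bar>f y\<bar> \<le> max M B" if "y \<in> Iref" for y using M[OF that] by simp
  with F have "\<forall>y\<in>Iref. \<bar>f y\<bar> \<le> max M B \<and> \<bar>?F y\<bar> \<le> max M B * (1 - \<bar>y\<bar>)" by simp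
  then show ?thesis unfolding green_pair_def using d1 d2 by (intro conjI ballI exI[of _ "max M B"]) auto
qed

text \<open>Green's identity against P_n moves the differential operator onto P_n, where it acts as
  n (n + 1). Bessel's inequality bounds the coefficients, which starts the bootstrap for their
  decay.\<close>

lemma prolate_coef:
  assumes "prolate_eigenfunction c lam f"
  shows "prol c (coef f) n = lam * coef f n" and "rapid (coef f)"
proof -
  note gp = prolate_green_pair[OF assms]
  note fL = green_pair_L2[OF gp]
  have xL: "(\<lambda>x. x * (x * f x)) \<in> L2_space Iref" by (intro L2_times_x fL)
  have g: "(\<lambda>y. (c\<^sup>2 * y\<^sup>2 - lam) * f y) = (\<lambda>y. c\<^sup>2 * (y * (y * f y)) - lam * f y)"
    by (auto simp: power2_eq_square algebra_simps)
  have gL: "(\<lambda>y. c\<^sup>2 * (y * (y * f y)) - lam * f y) \<in> L2_space Iref"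
    by (intro L2_diff L2_cmult xL fL) auto
  have eq: "prol c (coef f) n = lam * coef f n" for n
  proof -
    let ?q = "[:1, 0, -1:] * pderiv (pderiv (leg n)) - [:0, 2:] * pderiv (leg n)"
    have q: "poly ?q x = - (real n * (real n + 1)) * Leg n x" for x
    proof (rule DERIV_unique)
      show "((\<lambda>x. (1 - x\<^sup>2) * dLeg n x) has_real_derivative poly ?q x) (at x)"
        by (rule derivative_eq_intros poly_DERIV refl)+ (simp add: algebra_simps power2_eq_square)
      show "((\<lambda>x. (1 - x\<^sup>2) * dLeg n x) has_real_derivative - (real n * (real n + 1)) * Leg n x) (at x)"
        using leg_ode_deriv[of n x] by simp
    qed
    have "ip (\<lambda>y. c\<^sup>2 * (y * (y * f y)) - lam * f y) (Leg n) = ip f (poly ?q)"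
      using green_identity[OF gp green_pair_poly, of "leg n"] gL unfolding g by simp
    also have "\<dots> = - (real n * (real n + 1)) * ip f (Leg n)"
    proof -
      have "poly ?q = (\<lambda>x. - (real n * (real n + 1)) * Leg n x)" using q by blast
      then show ?thesis by (simp only: ip_cmult_right)
    qed
    finally have "sqrt (real n + 1/2) * ip (\<lambda>y. c\<^sup>2 * (y * (y * f y)) - lam * f y) (Leg n)
       = - (real n * (real n + 1)) * (sqrt (real n + 1/2) * ip f (Leg n))" by simp
    then have "coef (\<lambda>y. c\<^sup>2 * (y * (y * f y)) - lam * f y) n = - (real n * (real n + 1)) * coef f n"
      unfolding coef_def leg_on_def by (simp only: ip_cmult_right)
    moreover have "coef (\<lambda>y. c\<^sup>2 * (y * (y * f y)) - lam * f y) n = c\<^sup>2 * xop (xop (coef f)) n - lam * coef f n"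
      by (subst coef_diff) (simp_all add: L2_cmult xL fL coef_cmult coef_times_x L2_times_x)
    ultimately show ?thesis unfolding prol_def by simp
  qed
  then show "prol c (coef f) n = lam * coef f n" .
  show "rapid (coef f)"
  proof (rule prol_eigen_rapid[OF _ eq])
    fix n
    have "(coef f n)\<^sup>2 \<le> nsq f"
      using bessel_finite[of leg_on f "{n}"] fL by (simp add: leg_on_orthonormal coef_def)
    then have "sqrt ((coef f n)\<^sup>2) \<le> sqrt (nsq f)" by (rule real_sqrt_le_mono)
    then show "\<bar>coef f n\<bar> \<le> sqrt (nsq f)" by simp
  qed
qed

text \<open>Gronwall's argument for E = h^2 + H^2. On |x| <= r < 1 the coefficients are bounded, so
  |E'| <= K E, and E times exp (- K x) or exp (K x) is monotone to the right or left of y0.\<close>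

lemma linear_ode_zero:
  fixes h H :: "real \<Rightarrow> real"
  assumes d: "\<And>y. y \<in> Iref \<Longrightarrow> (h has_real_derivative H y / (1 - y\<^sup>2)) (at y)"
    "\<And>y. y \<in> Iref \<Longrightarrow> (H has_real_derivative (c\<^sup>2 * y\<^sup>2 - lam) * h y) (at y)"
    and z: "y0 \<in> Iref" "h y0 = 0" "H y0 = 0" and y: "y \<in> Iref"
  shows "h y = 0"
proof -
  define r where "r = max \<bar>y0\<bar> \<bar>y\<bar>"
  have r: "0 \<le> r" "r < 1" using z y by (auto simp: r_def)
  then have r2: "r\<^sup>2 < 1" by (simp add: abs_square_less_1)
  define K where "K = 1 / (1 - r\<^sup>2) + c\<^sup>2 + \<bar>lam\<bar>"
  define E where "E x = (h x)\<^sup>2 + (H x)\<^sup>2" for x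
  define E' where "E' x = 2 * h x * (H x / (1 - x\<^sup>2)) + 2 * H x * ((c\<^sup>2 * x\<^sup>2 - lam) * h x)" for x
  have inI: "x \<in> Iref" if "\<bar>x\<bar> \<le> r" for x using that r by auto
  have dE: "(E has_real_derivative E' x) (at x)" if "\<bar>x\<bar> \<le> r" for x
    unfolding E_def E'_def
    by (rule derivative_eq_intros d inI[OF that] refl)+ (simp add: power2_eq_square)
  have E0: "E x \<ge> 0" for x by (simp add: E_def)
  have bE: "\<bar>E' x\<bar> \<le> K * E x" if x: "\<bar>x\<bar> \<le> r" for x
  proof -
    have x2: "x\<^sup>2 \<le> r\<^sup>2" using x r by (simp add: abs_le_square_iff[symmetric])
    have p: "0 < 1 - x\<^sup>2" using x2 r2 by linarith
    have "1 / (1 - x\<^sup>2) \<le> 1 / (1 - r\<^sup>2)" using x2 r2 by (intro divide_left_mono) auto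
    moreover have "\<bar>c\<^sup>2 * x\<^sup>2 - lam\<bar> \<le> c\<^sup>2 + \<bar>lam\<bar>"
    proof -
      have "c\<^sup>2 * x\<^sup>2 \<le> c\<^sup>2 * 1" using x2 r2 by (intro mult_left_mono) auto
      moreover have "0 \<le> c\<^sup>2 * x\<^sup>2" "lam \<le> \<bar>lam\<bar>" "- lam \<le> \<bar>lam\<bar>" by auto
      ultimately show ?thesis unfolding abs_le_iff by linarith
    qed
    ultimately have k: "\<bar>1 / (1 - x\<^sup>2) + (c\<^sup>2 * x\<^sup>2 - lam)\<bar> \<le> K"
      using p unfolding K_def by (intro order_trans[OF abs_triangle_ineq]) auto
    have "E' x = (2 * h x * H x) * (1 / (1 - x\<^sup>2) + (c\<^sup>2 * x\<^sup>2 - lam))"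
      by (simp add: E'_def algebra_simps)
    then have "\<bar>E' x\<bar> = \<bar>2 * h x * H x\<bar> * \<bar>1 / (1 - x\<^sup>2) + (c\<^sup>2 * x\<^sup>2 - lam)\<bar>" by (simp only: abs_mult)
    also have "\<dots> \<le> E x * K"
    proof (intro mult_mono k)
      show "\<bar>2 * h x * H x\<bar> \<le> E x" unfolding E_def
        using sum_squares_bound[of "\<bar>h x\<bar>" "\<bar>H x\<bar>"] by (simp add: abs_mult)
    qed (auto simp: E0)
    finally show ?thesis by (simp add: mult.commute)
  qed
  have "E y \<le> 0"
  proof (cases "y0 \<le> y")
    case True
    have "E y * exp (- K * y) \<le> E y0 * exp (- K * y0)"
    proof (rule DERIV_nonpos_imp_nonincreasing[where f = "\<lambda>x. E x * exp (- K * x)", OF True])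
      fix x assume "y0 \<le> x" "x \<le> y"
      then have x: "\<bar>x\<bar> \<le> r" by (auto simp: r_def)
      have "((\<lambda>x. E x * exp (- K * x)) has_real_derivative (E' x - K * E x) * exp (- K * x)) (at x)"
        by (rule derivative_eq_intros dE[OF x] refl)+ (simp add: algebra_simps)
      moreover have "(E' x - K * E x) * exp (- K * x) \<le> 0"
        using bE[OF x] by (intro mult_nonpos_nonneg) auto
      ultimately show "\<exists>z. ((\<lambda>x. E x * exp (- K * x)) has_real_derivative z) (at x) \<and> z \<le> 0"
        by (intro exI conjI)
    qed
    also have "\<dots> = 0" using z by (simp add: E_def)
    finally show ?thesis by (simp add: mult_le_0_iff)
  next
    case False
    then have le: "y \<le> y0" by simp
    have "E y * exp (K * y) \<le> E y0 * exp (K * y0)"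
    proof (rule DERIV_nonneg_imp_nondecreasing[where f = "\<lambda>x. E x * exp (K * x)", OF le])
      fix x assume "y \<le> x" "x \<le> y0"
      then have x: "\<bar>x\<bar> \<le> r" by (auto simp: r_def)
      have "((\<lambda>x. E x * exp (K * x)) has_real_derivative (E' x + K * E x) * exp (K * x)) (at x)"
        by (rule derivative_eq_intros dE[OF x] refl)+ (simp add: algebra_simps)
      moreover have "(E' x + K * E x) * exp (K * x) \<ge> 0"
        using bE[OF x] by (intro mult_nonneg_nonneg) auto
      ultimately show "\<exists>z. ((\<lambda>x. E x * exp (K * x)) has_real_derivative z) (at x) \<and> 0 \<le> z"
        by (intro exI conjI)
    qed
    also have "\<dots> = 0" using z by (simp add: E_def)
    finally show ?thesis by (simp add: mult_le_0_iff)
  qed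
  then have "(h y)\<^sup>2 \<le> 0" unfolding E_def using zero_le_power2[of "H y"] by linarith
  then show ?thesis by simp
qed

text \<open>The weighted Wronskian of two bounded solutions is constant and vanishes at the
  endpoints. At a point with g nonzero the initial data are thus proportional, and uniqueness for
  the initial value problem spreads this over the interval.\<close>

lemma prolate_eigenvalue_simple:
  assumes f: "prolate_eigenfunction c lam f" and g: "prolate_eigenfunction c lam g"
  shows "\<exists>\<kappa>. \<kappa> \<noteq> 0 \<and> (\<forall>y\<in>Iref. f y = \<kappa> * g y)"
proof -
  let ?F = "\<lambda>y. (1 - y\<^sup>2) * deriv f y" and ?G = "\<lambda>y. (1 - y\<^sup>2) * deriv g y"
  note gf = prolate_green_pair[OF f] and gg = prolate_green_pair[OF g]
  define h where "h = (\<lambda>y. if y \<in> Iref then ?F y * g y - f y * ?G y else 0)"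
  have hc: "continuous_on {-1..1} h" unfolding h_def by (rule wronskian(1)[OF gf gg])
  have hd: "(h has_real_derivative 0) (at y)" if "y \<in> Iref" for y
    using wronskian(2)[OF gf gg that] unfolding h_def by (simp add: algebra_simps)
  have w: "?F y * g y = f y * ?G y" if y: "y \<in> Iref" for y
  proof -
    have "h y = h (-1)"
      by (rule DERIV_isconst2[of "-1" 1 h]) (use hc hd y in auto)
    then show ?thesis using y by (simp add: h_def)
  qed
  obtain y0 where y0: "y0 \<in> Iref" "g y0 \<noteq> 0" using g by (auto simp: prolate_eigenfunction_def)
  define \<kappa> where "\<kappa> = f y0 / g y0"
  have eq: "f y = \<kappa> * g y" if y: "y \<in> Iref" for y
  proof -
    have "f y - \<kappa> * g y = 0"
    proof (rule linear_ode_zero[of "\<lambda>y. f y - \<kappa> * g y" "\<lambda>y. ?F y - \<kappa> * ?G y" c lam y0])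
      fix x assume x: "x \<in> Iref"
      have "(f has_real_derivative ?F x / (1 - x\<^sup>2)) (at x)" "(?F has_real_derivative (c\<^sup>2 * x\<^sup>2 - lam) * f x) (at x)"
        "(g has_real_derivative ?G x / (1 - x\<^sup>2)) (at x)" "(?G has_real_derivative (c\<^sup>2 * x\<^sup>2 - lam) * g x) (at x)"
        using gf gg x unfolding green_pair_def by blast+
      note d = this
      show "((\<lambda>y. f y - \<kappa> * g y) has_real_derivative (?F x - \<kappa> * ?G x) / (1 - x\<^sup>2)) (at x)"
        using DERIV_diff[OF d(1) DERIV_cmult[OF d(3), of \<kappa>]]
        by (simp only: diff_divide_distrib times_divide_eq_right)
      show "((\<lambda>y. ?F y - \<kappa> * ?G y) has_real_derivative (c\<^sup>2 * x\<^sup>2 - lam) * (f x - \<kappa> * g x)) (at x)"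
        using DERIV_diff[OF d(2) DERIV_cmult[OF d(4), of \<kappa>]]
        by (rule DERIV_cong) (simp add: algebra_simps)
    next
      show "y0 \<in> Iref" by fact
      show "f y0 - \<kappa> * g y0 = 0" using y0 by (simp add: \<kappa>_def)
      have "(?F y0 - \<kappa> * ?G y0) * g y0 = 0"
        using w[OF y0(1)] y0(2) by (simp only: \<kappa>_def left_diff_distrib) (simp add: mult_ac)
      then show "?F y0 - \<kappa> * ?G y0 = 0" using y0(2) by (simp only: mult_eq_0_iff) simp
    qed (rule y)
    then show ?thesis by simp
  qed
  moreover have "\<kappa> \<noteq> 0"
  proof
    assume "\<kappa> = 0"
    then have "\<forall>y\<in>Iref. f y = 0" using eq by simp
    then show False using f by (auto simp: prolate_eigenfunction_def)
  qed
  ultimately show ?thesis by blast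
qed

section \<open>Legendre series with rapidly decaying coefficients\<close>

lemma abs_leg_on_le: "x \<in> {-1..1} \<Longrightarrow> \<bar>leg_on n x\<bar> \<le> real n + 1"
  and abs_dleg_on_le: "x \<in> {-1..1} \<Longrightarrow> \<bar>sqrt (real n + 1/2) * dLeg n x\<bar> \<le> (real n + 1) ^ 3"
proof -
  have s: "sqrt (real n + 1/2) \<le> real n + 1"
    by (rule real_le_lsqrt) (simp_all add: power2_eq_square algebra_simps)
  assume x: "x \<in> {-1..1}"
  have "\<bar>leg_on n x\<bar> \<le> (real n + 1) * 1"
    unfolding leg_on_def abs_mult using s abs_leg_le_1[OF x, of n] by (intro mult_mono) auto
  then show "\<bar>leg_on n x\<bar> \<le> real n + 1" by simp
  have "\<bar>sqrt (real n + 1/2) * dLeg n x\<bar> \<le> (real n + 1) * (real n + 1)\<^sup>2"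
    unfolding abs_mult using s abs_dleg_le[OF x, of n] by (intro mult_mono) auto
  then show "\<bar>sqrt (real n + 1/2) * dLeg n x\<bar> \<le> (real n + 1) ^ 3" by (simp add: power3_eq_cube power2_eq_square)
qed

definition leg_series :: "(nat \<Rightarrow> real) \<Rightarrow> real \<Rightarrow> real" where
  "leg_series a x = (\<Sum>n. a n * leg_on n x)"

lemma leg_series_bound:
  assumes "x \<in> {-1..1}"
  shows "\<bar>a n * leg_on n x\<bar> \<le> \<bar>a n\<bar> * (real n + 1) ^ 1"
  using mult_left_mono[OF abs_leg_on_le[OF assms, of n], of "\<bar>a n\<bar>"] by (simp add: abs_mult)

lemma leg_series_summable:
  assumes "rapid a" "x \<in> {-1..1}"
  shows "summable (\<lambda>n. a n * leg_on n x)"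
  by (rule summable_comparison_test'[OF rapid_summable[OF assms(1), of 1]])
    (use leg_series_bound[OF assms(2)] in simp)

lemma leg_series_bounded:
  assumes "rapid a" "x \<in> {-1..1}"
  shows "\<bar>leg_series a x\<bar> \<le> (\<Sum>n. \<bar>a n\<bar> * (real n + 1) ^ 1)"
proof -
  note s = rapid_summable[OF assms(1), of 1]
  have a: "summable (\<lambda>n. \<bar>a n * leg_on n x\<bar>)"
    by (rule summable_comparison_test'[OF s]) (use leg_series_bound[OF assms(2)] in simp)
  have "\<bar>leg_series a x\<bar> \<le> (\<Sum>n. \<bar>a n * leg_on n x\<bar>)"
    unfolding leg_series_def by (rule summable_rabs[OF a])
  also have "\<dots> \<le> (\<Sum>n. \<bar>a n\<bar> * (real n + 1) ^ 1)"
    by (rule suminf_le[OF _ a s]) (rule leg_series_bound[OF assms(2)])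
  finally show ?thesis .
qed

lemma xop_leg_on: "xop (\<lambda>n. leg_on n x) n = x * leg_on n x"
  by (simp add: xop_def leg_on_times_x[of x n])

lemma leg_series_times_x:
  assumes a: "rapid a" and x: "x \<in> {-1..1}"
  shows "x * leg_series a x = leg_series (xop a) x"
proof -
  have s2: "summable (\<lambda>n. 2 * (\<bar>a n\<bar> * (real n + 1) ^ 1))" by (intro summable_mult rapid_summable a)
  have s1: "summable (\<lambda>n. \<bar>a (Suc n)\<bar> * (real (Suc n) + 1) ^ 1)"
    using rapid_summable[OF a, of 1] by (subst summable_Suc_iff[of "\<lambda>n. \<bar>a n\<bar> * (real n + 1) ^ 1"])
  have "(\<Sum>n. xop a n * leg_on n x) = (\<Sum>n. a n * xop (\<lambda>n. leg_on n x) n)"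
  proof (rule xop_shift; rule jac_mult_summable)
    show "summable (\<lambda>n. \<bar>a n * leg_on (Suc n) x\<bar>)"
    proof (rule summable_comparison_test'[OF s2])
      fix n
      have "\<bar>a n\<bar> * \<bar>leg_on (Suc n) x\<bar> \<le> \<bar>a n\<bar> * (2 * (real n + 1))"
        using abs_leg_on_le[OF x, of "Suc n"] by (intro mult_left_mono) auto
      then show "norm \<bar>a n * leg_on (Suc n) x\<bar> \<le> 2 * (\<bar>a n\<bar> * (real n + 1) ^ 1)"
        by (simp add: abs_mult algebra_simps)
    qed
    show "summable (\<lambda>n. \<bar>a (Suc n) * leg_on n x\<bar>)"
    proof (rule summable_comparison_test'[OF s1])
      fix n
      have "\<bar>a (Suc n)\<bar> * \<bar>leg_on n x\<bar> \<le> \<bar>a (Suc n)\<bar> * (real (Suc n) + 1)"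
        using abs_leg_on_le[OF x, of n] by (intro mult_left_mono) auto
      then show "norm \<bar>a (Suc n) * leg_on n x\<bar> \<le> \<bar>a (Suc n)\<bar> * (real (Suc n) + 1) ^ 1"
        by (simp add: abs_mult)
    qed
  qed
  also have "\<dots> = (\<Sum>n. x * (a n * leg_on n x))" by (simp only: xop_leg_on mult.left_commute)
  also have "\<dots> = x * leg_series a x"
    unfolding leg_series_def by (rule suminf_mult[OF leg_series_summable[OF a x]])
  finally show ?thesis by (simp add: leg_series_def)
qed

lemma leg_series_deriv:
  assumes a: "rapid a" and x: "x \<in> Iref"
  shows "(leg_series a has_real_derivative (\<Sum>n. a n * (sqrt (real n + 1/2) * dLeg n x))) (at x)"
proof -
  have "((\<lambda>x. \<Sum>n. a n * leg_on n x) has_real_derivative (\<Sum>n. a n * (sqrt (real n + 1/2) * dLeg n x))) (at x)"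
  proof (rule has_field_derivative_series'(2)[of "{-1..1}" _ _ 0])
    show "((\<lambda>x. a n * leg_on n x) has_real_derivative a n * (sqrt (real n + 1/2) * dLeg n y)) (at y within {-1..1})" for n y
      unfolding leg_on_def by (intro DERIV_cmult has_field_derivative_at_within[OF poly_DERIV])
    show "uniformly_convergent_on {-1..1} (\<lambda>n x. \<Sum>i<n. a i * (sqrt (real i + 1/2) * dLeg i x))"
    proof (rule Weierstrass_m_test'[OF _ rapid_summable[OF a, of 3]])
      fix n and y :: real assume "y \<in> {-1..1}"
      then show "norm (a n * (sqrt (real n + 1/2) * dLeg n y)) \<le> \<bar>a n\<bar> * (real n + 1) ^ 3"
        using mult_left_mono[OF abs_dleg_on_le[of y n], of "\<bar>a n\<bar>"] by (simp only: real_norm_def abs_mult abs_ge_zero)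
    qed
    show "summable (\<lambda>n. a n * leg_on n 0)" by (rule leg_series_summable[OF a]) simp
    show "x \<in> interior {-1..1}" using x by (simp add: interior_atLeastAtMost_real)
  qed auto
  then show ?thesis by (simp add: leg_series_def[abs_def])
qed

text \<open>Legendre's equation turns the derivative of each flux term into a multiple of P_n, so
  uniform convergence of the differentiated series rests on the bound for P_n and not on second
  derivatives.\<close>

lemma leg_series_flux_deriv:
  assumes a: "rapid a" and x: "x \<in> Iref"
  shows "((\<lambda>x. (1 - x\<^sup>2) * (\<Sum>n. a n * (sqrt (real n + 1/2) * dLeg n x))) has_real_derivative
     - leg_series (\<lambda>n. real n * (real n + 1) * a n) x) (at x)"
proof -
  define w where "w n x = (1 - x\<^sup>2) * (a n * (sqrt (real n + 1/2) * dLeg n x))" for n x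
  define w' where "w' n x = - (real n * (real n + 1) * a n * leg_on n x)" for n x
  note wa = rapid_weight[OF a]
  have dw: "(w n has_real_derivative w' n y) (at y)" for n y
  proof -
    have "w n = (\<lambda>x. (a n * sqrt (real n + 1/2)) * ((1 - x\<^sup>2) * dLeg n x))"
      by (auto simp: w_def)
    moreover have "((\<lambda>x. (a n * sqrt (real n + 1/2)) * ((1 - x\<^sup>2) * dLeg n x)) has_real_derivative
        (a n * sqrt (real n + 1/2)) * - (real n * (real n + 1) * Leg n y)) (at y)"
      by (intro DERIV_cmult leg_ode_deriv)
    ultimately show ?thesis by (simp add: w'_def leg_on_def mult_ac)
  qed
  have sd: "summable (\<lambda>n. a n * (sqrt (real n + 1/2) * dLeg n y))" if "y \<in> {-1..1}" for y
  proof (rule summable_comparison_test'[OF rapid_summable[OF a, of 3]])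
    show "norm (a n * (sqrt (real n + 1/2) * dLeg n y)) \<le> \<bar>a n\<bar> * (real n + 1) ^ 3" for n
      using mult_left_mono[OF abs_dleg_on_le[OF that, of n], of "\<bar>a n\<bar>"] by (simp only: real_norm_def abs_mult abs_ge_zero)
  qed
  have "((\<lambda>x. \<Sum>n. w n x) has_real_derivative (\<Sum>n. w' n x)) (at x)"
  proof (rule has_field_derivative_series'(2)[of "{-1..1}" _ _ 0])
    show "(w n has_real_derivative w' n y) (at y within {-1..1})" for n y
      by (rule has_field_derivative_at_within[OF dw])
    show "uniformly_convergent_on {-1..1} (\<lambda>n x. \<Sum>i<n. w' i x)"
    proof (rule Weierstrass_m_test'[OF _ rapid_summable[OF wa, of 1]])
      fix n and y :: real assume "y \<in> {-1..1}"
      from leg_series_bound[OF this, of "\<lambda>n. real n * (real n + 1) * a n" n]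
      show "norm (w' n y) \<le> \<bar>real n * (real n + 1) * a n\<bar> * (real n + 1) ^ 1" by (simp add: w'_def)
    qed
    show "summable (\<lambda>n. w n 0)" using sd[of 0] by (simp add: w_def)
    show "x \<in> interior {-1..1}" using x by (simp add: interior_atLeastAtMost_real)
  qed auto
  moreover have "(\<Sum>n. w' n x) = - leg_series (\<lambda>n. real n * (real n + 1) * a n) x"
    unfolding w'_def leg_series_def by (rule suminf_minus) (use leg_series_summable[OF wa] x in auto)
  ultimately have "((\<lambda>x. \<Sum>n. w n x) has_real_derivative - leg_series (\<lambda>n. real n * (real n + 1) * a n) x) (at x)"
    by simp
  then show ?thesis
  proof (rule has_field_derivative_transform_within_open[of _ _ _ Iref])
    fix y assume "y \<in> Iref"
    then show "(\<Sum>n. w n y) = (1 - y\<^sup>2) * (\<Sum>n. a n * (sqrt (real n + 1/2) * dLeg n y))"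
      unfolding w_def by (intro suminf_mult sd) auto
  qed (use x in auto)
qed

lemma leg_series_L2:
  assumes "rapid a"
  shows "leg_series a \<in> L2_space Iref"
proof (rule L2_bounded_continuous)
  show "continuous_on Iref (leg_series a)"
    by (intro continuous_at_imp_continuous_on ballI DERIV_isCont[OF leg_series_deriv[OF assms]])
  show "\<bar>leg_series a x\<bar> \<le> (\<Sum>n. \<bar>a n\<bar> * (real n + 1) ^ 1)" if "x \<in> Iref" for x
    by (rule leg_series_bounded[OF assms]) (use that in auto)
qed

lemma ip_leg_series:
  assumes a: "rapid a" and g: "g \<in> L2_space Iref"
  shows "(\<lambda>n. a n * ip (leg_on n) g) sums ip (leg_series a) g"
proof -
  define C where "C = (\<Sum>n. \<bar>a n\<bar> * (real n + 1) ^ 1)"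
  have "(\<lambda>k. \<integral>x. (\<Sum>n<k. a n * leg_on n x) * g x \<partial>lebesgue_on Iref) \<longlonglongrightarrow> (\<integral>x. leg_series a x * g x \<partial>lebesgue_on Iref)"
  proof (rule integral_dominated_convergence[where w = "\<lambda>x. C * \<bar>g x\<bar>"])
    show "(\<lambda>x. leg_series a x * g x) \<in> borel_measurable (lebesgue_on Iref)"
      using L2_mult_integrable[OF _ leg_series_L2[OF a] g] by (intro borel_measurable_integrable) simp
    show "(\<lambda>x. (\<Sum>n<k. a n * leg_on n x) * g x) \<in> borel_measurable (lebesgue_on Iref)" for k
      by (intro borel_measurable_integrable L2_mult_integrable L2_sum L2_cmult g) auto
    show "integrable (lebesgue_on Iref) (\<lambda>x. C * \<bar>g x\<bar>)"
      by (intro integrable_mult_right integrable_abs L2_imp_integrable g)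
    show "AE x in lebesgue_on Iref. (\<lambda>k. (\<Sum>n<k. a n * leg_on n x) * g x) \<longlonglongrightarrow> leg_series a x * g x"
    proof (rule AE_I2)
      fix x assume "x \<in> space (lebesgue_on Iref)"
      then have "x \<in> {-1..1}" by simp
      from summable_LIMSEQ[OF leg_series_summable[OF a this]]
      show "(\<lambda>k. (\<Sum>n<k. a n * leg_on n x) * g x) \<longlonglongrightarrow> leg_series a x * g x"
        unfolding leg_series_def by (intro tendsto_mult tendsto_const)
    qed
    show "AE x in lebesgue_on Iref. norm ((\<Sum>n<k. a n * leg_on n x) * g x) \<le> C * \<bar>g x\<bar>" for k
    proof (rule AE_I2)
      fix x assume "x \<in> space (lebesgue_on Iref)"
      then have x: "x \<in> {-1..1}" by simp
      have "\<bar>\<Sum>n<k. a n * leg_on n x\<bar> \<le> (\<Sum>n<k. \<bar>a n * leg_on n x\<bar>)" by (rule sum_abs)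
      also have "\<dots> \<le> (\<Sum>n<k. \<bar>a n\<bar> * (real n + 1) ^ 1)" by (intro sum_mono leg_series_bound x)
      also have "\<dots> \<le> C" unfolding C_def by (intro sum_le_suminf rapid_summable a) auto
      finally show "norm ((\<Sum>n<k. a n * leg_on n x) * g x) \<le> C * \<bar>g x\<bar>"
        by (simp add: abs_mult mult_right_mono)
    qed
  qed
  moreover have "(\<integral>x. (\<Sum>n<k. a n * leg_on n x) * g x \<partial>lebesgue_on Iref) = (\<Sum>n<k. a n * ip (leg_on n) g)" for k
  proof -
    have "ip (\<lambda>x. \<Sum>n<k. a n * leg_on n x) g = (\<Sum>n<k. a n * ip (leg_on n) g)"
      by (subst ip_sum_left) (auto simp: L2_cmult g ip_cmult_left)
    then show ?thesis by (simp add: ip_def)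
  qed
  ultimately show ?thesis unfolding sums_def ip_def by simp
qed

lemma coef_leg_series:
  assumes "rapid a"
  shows "coef (leg_series a) = a"
proof
  fix n
  have "(\<lambda>m. a m * ip (leg_on m) (leg_on n)) sums coef (leg_series a) n"
    unfolding coef_def by (rule ip_leg_series[OF assms]) simp
  moreover have "(\<lambda>m. a m * ip (leg_on m) (leg_on n)) = (\<lambda>m. if m = n then a m else 0)"
    by (auto simp: leg_on_orthonormal)
  moreover have "(\<lambda>m. if m = n then a m else 0) sums a n"
    using sums_If_finite_set[of "{n}" a] by simp
  ultimately show "coef (leg_series a) n = a n" using sums_unique2 by metis
qed

text \<open>The converse of \<open>prolate_coef\<close>: it brings an eigenvector of the matrix
  under the classical definition of eigenvalue. The sum is nontrivial because its coefficients give
  back the sequence.\<close>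

lemma leg_series_prolate:
  assumes a: "rapid a" and eig: "\<And>n. prol c a n = lam * a n" and nz: "a \<noteq> (\<lambda>n. 0)"
  shows "prolate_eigenfunction c lam (leg_series a)"
proof -
  let ?f = "leg_series a"
  let ?D = "\<lambda>x. \<Sum>n. a n * (sqrt (real n + 1/2) * dLeg n x)"
  let ?G = "leg_series (\<lambda>n. real n * (real n + 1) * a n)"
  note wa = rapid_weight[OF a]
  have d1: "(?f has_real_derivative ?D x) (at x)" if "x \<in> Iref" for x by (rule leg_series_deriv[OF a that])
  have d2: "((\<lambda>t. (1 - t\<^sup>2) * deriv ?f t) has_real_derivative - ?G x) (at x)" if "x \<in> Iref" for x
    using leg_series_flux_deriv[OF a that]
  proof (rule has_field_derivative_transform_within_open[of _ _ _ Iref])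
    fix y assume "y \<in> Iref"
    then show "(1 - y\<^sup>2) * ?D y = (1 - y\<^sup>2) * deriv ?f y" using DERIV_imp_deriv[OF d1] by simp
  qed (use that in auto)
  have eq: "?G x + c\<^sup>2 * x\<^sup>2 * ?f x = lam * ?f x" if x: "x \<in> Iref" for x
  proof -
    have x': "x \<in> {-1..1}" using x by auto
    have xx: "x\<^sup>2 * ?f x = leg_series (xop (xop a)) x"
      using leg_series_times_x[OF rapid_xop[OF a] x'] leg_series_times_x[OF a x']
      by (simp add: power2_eq_square mult.assoc)
    note s1 = leg_series_summable[OF wa x']
      and s2 = summable_mult[OF leg_series_summable[OF rapid_xop[OF rapid_xop[OF a]] x'], of "c\<^sup>2"]
    have "?G x + c\<^sup>2 * (x\<^sup>2 * ?f x) = (\<Sum>n. real n * (real n + 1) * a n * leg_on n x) + (\<Sum>n. c\<^sup>2 * (xop (xop a) n * leg_on n x))"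
      by (simp only: xx) (simp only: leg_series_def suminf_mult[OF leg_series_summable[OF rapid_xop[OF rapid_xop[OF a]] x']])
    also have "\<dots> = (\<Sum>n. real n * (real n + 1) * a n * leg_on n x + c\<^sup>2 * (xop (xop a) n * leg_on n x))"
      by (rule suminf_add[OF s1 s2])
    also have "\<dots> = (\<Sum>n. prol c a n * leg_on n x)"
      by (rule arg_cong[where f = suminf]) (auto simp: prol_def algebra_simps)
    also have "\<dots> = (\<Sum>n. lam * (a n * leg_on n x))" by (simp only: eig mult.assoc)
    also have "\<dots> = lam * ?f x"
      unfolding leg_series_def by (rule suminf_mult[OF leg_series_summable[OF a x']])
    finally show ?thesis by (simp only: mult.assoc)
  qed
  have "\<exists>y\<in>Iref. ?f y \<noteq> 0"
  proof (rule ccontr)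
    assume "\<not> ?thesis"
    then have "coef ?f n = coef (\<lambda>x. 0) n" for n
      unfolding coef_def by (intro ip_cong) auto
    then have "a n = 0" for n using coef_leg_series[OF a] by (simp add: coef_def ip_def)
    then show False using nz by auto
  qed
  moreover have "bounded (?f ` Iref)"
    unfolding bounded_iff
    by (intro exI[of _ "\<Sum>n. \<bar>a n\<bar> * (real n + 1) ^ 1"]) (use leg_series_bounded[OF a] in auto)
  moreover have "?f differentiable (at y) \<and> (\<lambda>t. (1 - t\<^sup>2) * deriv ?f t) differentiable (at y) \<and>
      - deriv (\<lambda>t. (1 - t\<^sup>2) * deriv ?f t) y + c\<^sup>2 * y\<^sup>2 * ?f y = lam * ?f y" if y: "y \<in> Iref" for y
    using d1[OF y] d2[OF y] eq[OF y] DERIV_imp_deriv[OF d2[OF y]]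
    by (auto simp: real_differentiable_def)
  ultimately show ?thesis unfolding prolate_eigenfunction_def by blast
qed

text \<open>For \<open>exhaust\<close>: the Legendre series of an eigenvector is a classical
  eigenfunction, so its eigenvalue is listed; simplicity makes it a nonzero multiple of
  \<open>\<psi> j\<close>, and the inner product with \<open>\<psi> j\<close> is that
  factor.\<close>

lemma pswf_system_seq:
  assumes "pswf_system c chi \<psi>"
  shows "pswf_seq c chi (\<lambda>i. coef (\<psi> i))"
proof -
  have ef: "prolate_eigenfunction c (chi i) (\<psi> i)" for i
    using assms by (simp add: pswf_system_def)
  have L: "\<psi> i \<in> L2_space Iref" for i by (rule green_pair_L2[OF prolate_green_pair[OF ef]])
  have on: "ip (\<psi> i) (\<psi> j) = (if i = j then 1 else 0)" for i j
    using assms by (auto simp: pswf_system_def ip_LINT)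
  show ?thesis
  proof
    show "strict_mono chi" using assms by (simp add: pswf_system_def)
    show "rapid (coef (\<psi> i))" for i by (rule prolate_coef(2)[OF ef])
    show "prol c (coef (\<psi> i)) n = chi i * coef (\<psi> i) n" for i n by (rule prolate_coef(1)[OF ef])
    show "dotp (coef (\<psi> i)) (coef (\<psi> j)) = (if i = j then 1 else 0)" for i j
      by (simp add: dotp_coef L on)
    fix a lam
    assume a: "rapid a" "\<And>n. prol c a n = lam * a n" "a \<noteq> (\<lambda>n. 0)"
    note f = leg_series_prolate[OF a]
    then have "lam \<in> range chi"
      using assms by (auto simp: pswf_system_def prolate_eigenvalue_def)
    then obtain j where j: "lam = chi j" by blast
    obtain \<kappa> where \<kappa>: "\<kappa> \<noteq> 0" "\<forall>y\<in>Iref. leg_series a y = \<kappa> * \<psi> j y"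
      using prolate_eigenvalue_simple[OF f] ef[of j] j by blast
    have "dotp a (coef (\<psi> j)) = ip (leg_series a) (\<psi> j)"
      using dotp_coef[OF leg_series_L2[OF a(1)] L, of j] coef_leg_series[OF a(1)] by simp
    also have "\<dots> = ip (\<lambda>y. \<kappa> * \<psi> j y) (\<psi> j)" by (rule ip_cong) (use \<kappa> in auto)
    also have "\<dots> = \<kappa>" by (simp add: ip_cmult_left on)
    finally show "\<exists>j. lam = chi j \<and> dotp a (coef (\<psi> j)) \<noteq> 0" using j \<kappa>(1) by auto
  qed
qed

section \<open>Decay of the projection error\<close>

lemma dotp_sq_triangle:
  assumes "ell2 u" "ell2 v"
  shows "sq (\<lambda>n. u n + v n) \<le> 2 * sq u + 2 * sq v"
proof -
  note s = ell2_mult[OF assms(1) assms(1)] ell2_mult[OF assms(2) assms(2)]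
  have "2 * sq u + 2 * sq v = (\<Sum>n. 2 * (u n * u n) + 2 * (v n * v n))"
    unfolding dotp_def suminf_mult[OF s(1), symmetric] suminf_mult[OF s(2), symmetric]
    by (intro suminf_add summable_mult s)
  moreover have "sq (\<lambda>n. u n + v n) \<le> (\<Sum>n. 2 * (u n * u n) + 2 * (v n * v n))"
    unfolding dotp_def
  proof (rule suminf_le)
    fix n
    have "0 \<le> (u n - v n) * (u n - v n)" by simp
    then show "(u n + v n) * (u n + v n) \<le> 2 * (u n * u n) + 2 * (v n * v n)"
      by (simp add: algebra_simps)
  qed (intro ell2_mult ell2_add summable_add summable_mult s assms)+
  ultimately show ?thesis by simp
qed

context pswf_seq
begin

text \<open>Each application raises the top index by 2. Up to step m the diagonal therefore stays
  below (K + 2 m + 1)^2, and one bound B serves all steps.\<close>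

lemma prol_iterate_bound:
  assumes K: "\<And>n. n > K \<Longrightarrow> p n = 0" and B: "(real K + 2 * real m + 1)\<^sup>2 + c\<^sup>2 \<le> B"
  shows "sq ((prol c ^^ m) p) \<le> B ^ (2 * m) * sq p"
proof -
  have "j \<le> m \<Longrightarrow> (\<forall>n. n > K + 2 * j \<longrightarrow> (prol c ^^ j) p n = 0) \<and>
     sq ((prol c ^^ j) p) \<le> B ^ (2 * j) * sq p" for j
  proof (induction j)
    case 0
    then show ?case using K by simp
  next
    case (Suc j)
    let ?p = "(prol c ^^ j) p" and ?L = "K + 2 * j"
    have z: "\<And>n. n > ?L \<Longrightarrow> ?p n = 0" and IH: "sq ?p \<le> B ^ (2 * j) * sq p"
      using Suc by auto
    have p2: "ell2 ?p" by (rule rapid_ell2, rule rapid_finite[of ?L]) (rule z)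
    have "real ?L * (real ?L + 1) \<le> (real K + 2 * real m + 1)\<^sup>2"
      unfolding power2_eq_square using Suc.prems by (intro mult_mono) auto
    then have L: "real ?L * (real ?L + 1) + c\<^sup>2 \<le> B" using B by linarith
    have "sq (prol c ?p) \<le> (real ?L * (real ?L + 1) + c\<^sup>2)\<^sup>2 * sq ?p"
      by (rule prol_finite_bound(1)) (rule z)
    also have "\<dots> \<le> B\<^sup>2 * (B ^ (2 * j) * sq p)"
      by (intro mult_mono power_mono L IH dotp_nonneg p2) auto
    finally have "sq (prol c ?p) \<le> B ^ (2 * Suc j) * sq p"
      by (simp add: power2_eq_square mult.assoc)
    then show ?case using prol_finite_bound(2)[of ?L ?p _ c, OF z] by auto
  qed
  then show ?thesis by simp
qed

lemma R_finite_decay: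
  assumes K: "\<And>n. n > K \<Longrightarrow> p n = 0" and N: "N \<ge> 1" and q: "0 < q" "q < 1" and c: "c\<^sup>2 \<le> q\<^sup>2 * chi N"
    and e: "e = sqrt ((q - q\<^sup>2) / 128)" and small: "1 \<le> e * real N" "real K \<le> e * real N" "real m \<le> e * real N"
  shows "sq (R N p) \<le> q ^ (2 * m) * sq p"
proof -
  have chi: "chi N > 0" "real N ^ 2 / 8 \<le> chi N" using chi_lower[of N] N
    by (auto intro: less_le_trans[OF _ chi_lower[of N]])
  have qq: "q - q\<^sup>2 \<ge> 0" using q by (simp add: power2_eq_square mult_left_le)
  \<comment> \<open>The choice of e: the left side is at most (4 e N)^2, and 16 / 128 = 1/8 matches
    the constant in \<open>chi_lower\<close>. The leftover q^2 chi_N is reserved for c^2.\<close>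
  have "(real K + 2 * real m + 1)\<^sup>2 \<le> (4 * (e * real N))\<^sup>2"
    using small by (intro power_mono) auto
  also have "\<dots> = (q - q\<^sup>2) * (real N ^ 2 / 8)" using qq by (simp add: e power_mult_distrib)
  also have "\<dots> \<le> (q - q\<^sup>2) * chi N" by (intro mult_left_mono chi qq)
  finally have "(real K + 2 * real m + 1)\<^sup>2 + c\<^sup>2 \<le> q * chi N"
    using c by (simp add: algebra_simps)
  from prol_iterate_bound[where m = m and p = p, OF K this]
  have "sq ((prol c ^^ m) p) \<le> (q * chi N) ^ (2 * m) * sq p" by simp
  moreover have "chi N ^ (2 * m) * sq (R N p) \<le> sq ((prol c ^^ m) p)"
    by (rule R_iterate[OF rapid_finite[OF K]]) (use chi in auto)
  ultimately have "chi N ^ (2 * m) * sq (R N p) \<le> chi N ^ (2 * m) * (q ^ (2 * m) * sq p)"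
    by (simp add: power_mult_distrib mult_ac)
  then show ?thesis using chi(1) by (subst (asm) mult_le_cancel_left_pos) auto
qed

text \<open>Entries up to K form a finite sum that gains the power of q; on the rest only
  contraction is used. The factors 2 come from the squared triangle inequality.\<close>

lemma R_decay:
  assumes a: "ell2 a" and N: "N \<ge> 1" and q: "0 < q" "q < 1" and c: "c\<^sup>2 \<le> q\<^sup>2 * chi N"
    and e: "e = sqrt ((q - q\<^sup>2) / 128)" and small: "1 \<le> e * real N" "real K \<le> e * real N" "real m \<le> e * real N"
  shows "sq (R N a) \<le> 2 * q ^ (2 * m) * sq a + 2 * (\<Sum>n. (a (n + Suc K))\<^sup>2)"
proof -
  define l where "l n = (if n \<le> K then a n else 0)" for n
  define h where "h n = (if n \<le> K then 0 else a n)" for n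
  have l2: "ell2 l" by (rule rapid_ell2, rule rapid_finite[of K]) (simp add: l_def)
  have h2: "ell2 h" unfolding ell2_def
    by (rule summable_comparison_test'[OF a[unfolded ell2_def], of 0]) (simp add: h_def)
  have alh: "a = (\<lambda>n. l n + h n)" by (auto simp: l_def h_def)
  have "R N a = (\<lambda>n. R N l n + R N h n)"
    unfolding alh by (rule ext) (simp add: R_def dotp_add_left l2 h2 ell2_\<alpha> algebra_simps sum.distrib)
  then have "sq (R N a) \<le> 2 * sq (R N l) + 2 * sq (R N h)"
    using dotp_sq_triangle[OF ell2_R[OF l2] ell2_R[OF h2]] by simp
  also have "\<dots> \<le> 2 * (q ^ (2 * m) * sq l) + 2 * sq h"
    using R_finite_decay[where p = l, OF _ N q c e small] R_contract[OF h2]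
    by (intro add_mono mult_left_mono) (auto simp: l_def)
  also have "sq l \<le> sq a"
    unfolding dotp_def by (intro suminf_le ell2_mult l2 a) (simp add: l_def)
  also have "sq h = (\<Sum>n. (a (n + Suc K))\<^sup>2)"
    using suminf_split_initial_segment[OF ell2_mult[OF h2 h2], of "Suc K"]
    by (simp add: dotp_def h_def power2_eq_square)
  finally show ?thesis using q by (simp add: mult.assoc mult_left_mono)
qed

end

lemma ref_projection_error:
  assumes sys: "pswf_system c chi \<psi>" and v: "v \<in> L2_space Iref"
  shows "(\<lambda>x. ref_projection \<psi> N v x - v x) \<in> L2_space Iref"
    and "nsq (\<lambda>x. ref_projection \<psi> N v x - v x)
      = sq (pswf_seq.R (\<lambda>i. coef (\<psi> i)) N (coef v))"
proof -
  interpret pswf_seq c chi "\<lambda>i. coef (\<psi> i)" by (rule pswf_system_seq[OF sys])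
  have ef: "prolate_eigenfunction c (chi i) (\<psi> i)" for i
    using sys by (simp add: pswf_system_def)
  have L: "\<psi> i \<in> L2_space Iref" for i by (rule green_pair_L2[OF prolate_green_pair[OF ef]])
  have rp: "ref_projection \<psi> N v = (\<lambda>x. \<Sum>n\<le>N. ip v (\<psi> n) * \<psi> n x)"
    by (auto simp: ref_projection_def ip_LINT)
  have rL: "ref_projection \<psi> N v \<in> L2_space Iref"
    unfolding rp by (intro L2_sum L2_cmult L) auto
  let ?w = "\<lambda>x. ref_projection \<psi> N v x - v x"
  show w: "?w \<in> L2_space Iref" by (intro L2_diff rL v) auto
  have "coef ?w n = - R N (coef v) n" for n
  proof -
    have "coef (ref_projection \<psi> N v) n = (\<Sum>i\<le>N. dotp (coef v) (coef (\<psi> i)) * coef (\<psi> i) n)"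
      unfolding rp by (subst coef_sum) (auto simp: L2_cmult L coef_cmult dotp_coef v)
    then show ?thesis by (simp add: coef_diff rL v R_def)
  qed
  then have "sq (coef ?w) = sq (R N (coef v))" by (simp add: dotp_def)
  then show "nsq ?w = sq (R N (coef v))" by (simp add: dotp_coef w)
qed

lemma ref_projection_contract:
  assumes sys: "pswf_system c chi \<psi>" and v: "v \<in> L2_space Iref"
  shows "nsq (\<lambda>x. ref_projection \<psi> N v x - v x) \<le> nsq v"
  using pswf_seq.R_contract[OF pswf_system_seq[OF sys] ell2_coef[OF v], of N]
  by (simp add: ref_projection_error(2)[OF assms] dotp_coef v)

lemma ref_projection_decay:
  assumes sys: "pswf_system c chi \<psi>" and v: "v \<in> L2_space Iref"
    and N: "N \<ge> 1" and q: "0 < q" "q < 1" and c: "c \<ge> 0" "c / sqrt (chi N) \<le> q / root 6 2"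
    and e: "e = sqrt ((q - q\<^sup>2) / 128)" and small: "1 \<le> e * real N" "real K \<le> e * real N" "real m \<le> e * real N"
  shows "nsq (\<lambda>x. ref_projection \<psi> N v x - v x)
     \<le> 2 * q ^ (2 * m) * nsq v + 2 * (\<Sum>n. (coef v (n + Suc K))\<^sup>2)"
proof -
  interpret pswf_seq c chi "\<lambda>i. coef (\<psi> i)" by (rule pswf_system_seq[OF sys])
  have chi: "chi N > 0" using N by (intro less_le_trans[OF _ chi_lower[of N]]) simp
  have "1 \<le> root 6 (2::real)" by simp
  then have "q / root 6 2 \<le> q / 1" using q by (intro divide_left_mono) auto
  then have "c / sqrt (chi N) \<le> q" using c(2) by simp
  then have "c \<le> q * sqrt (chi N)" using chi by (simp add: field_simps)
  then have "c\<^sup>2 \<le> (q * sqrt (chi N))\<^sup>2" using c(1) by (intro power_mono) auto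
  then have c': "c\<^sup>2 \<le> q\<^sup>2 * chi N" using chi by (simp add: power_mult_distrib)
  show ?thesis
    using R_decay[OF ell2_coef[OF v] N q c' e small]
    by (simp add: ref_projection_error(2)[OF sys v] dotp_coef v)
qed

section \<open>Weak derivatives and Legendre coefficients\<close>

lemma power_div_fact_le_exp:
  fixes z :: real
  assumes "z \<ge> 0"
  shows "z ^ n / fact n \<le> exp z"
proof -
  have s: "(\<lambda>k. z ^ k / fact k) sums exp z" using exp_converges[of z] by (simp add: divide_inverse mult.commute)
  have "(\<Sum>k\<in>{n}. z ^ k / fact k) \<le> (\<Sum>k. z ^ k / fact k)"
    using assms by (intro sum_le_suminf sums_summable[OF s]) auto
  then show ?thesis using sums_unique[OF s] by simp
qed

text \<open>The family is closed under differentiation, so all its members are smooth.\<close>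

definition cutoff :: "real \<Rightarrow> real \<Rightarrow> real poly \<Rightarrow> nat \<Rightarrow> real \<Rightarrow> real" where
  "cutoff r e p k x = (if x\<^sup>2 < r then poly p x * (1 / (r - x\<^sup>2)) ^ k * exp (- (e / (r - x\<^sup>2))) else 0)"

text \<open>The numerator after one differentiation. With w = 1 / (r - x^2) one has w' = 2 x w^2;
  all terms are brought to the power k + 2 of w, missing powers being paid for by factors r -
  x^2.\<close>

definition cutoff_dpoly :: "real \<Rightarrow> real \<Rightarrow> real poly \<Rightarrow> nat \<Rightarrow> real poly" where
  "cutoff_dpoly r e p k = pderiv p * [:r, 0, -1:]\<^sup>2 + smult (2 * real k) ([:0, 1:] * p * [:r, 0, -1:]) - smult (2 * e) ([:0, 1:] * p)"

lemma cutoff_deriv_inside: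
  assumes x: "x\<^sup>2 < r"
  shows "(cutoff r e p k has_real_derivative cutoff r e (cutoff_dpoly r e p k) (k + 2) x) (at x)"
proof -
  define w where "w y = 1 / (r - y\<^sup>2)" for y
  have s: "r - x\<^sup>2 \<noteq> 0" using x by simp
  have ws: "w x * (r - x\<^sup>2) = 1" using s by (simp add: w_def)
  have dw: "(w has_real_derivative 2 * x * (w x)\<^sup>2) (at x)"
    unfolding w_def by (rule derivative_eq_intros refl s | simp add: power2_eq_square)+
  have ev: "(\<lambda>y. poly p y * w y ^ k * exp (- (e * w y))) y = cutoff r e p k y" if "y \<in> {y. y\<^sup>2 < r}" for y
    using that by (simp add: cutoff_def w_def)
  have op: "open {y. y\<^sup>2 < r}" by (intro open_Collect_less continuous_intros)
  have "((\<lambda>y. poly p y * w y ^ k * exp (- (e * w y))) has_real_derivative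
     (poly (pderiv p) x * w x ^ k + poly p x * (real k * w x ^ (k - 1) * (2 * x * (w x)\<^sup>2))) * exp (- (e * w x))
      + poly p x * w x ^ k * (exp (- (e * w x)) * - (e * (2 * x * (w x)\<^sup>2)))) (at x)"
    by (rule derivative_eq_intros dw poly_DERIV refl)+ (simp add: algebra_simps)
  moreover have "(poly (pderiv p) x * w x ^ k + poly p x * (real k * w x ^ (k - 1) * (2 * x * (w x)\<^sup>2))) * exp (- (e * w x))
      + poly p x * w x ^ k * (exp (- (e * w x)) * - (e * (2 * x * (w x)\<^sup>2)))
     = cutoff r e (cutoff_dpoly r e p k) (k + 2) x"
  proof -
    have k: "real k * w x ^ (k - 1) * (w x)\<^sup>2 = real k * w x ^ (k + 1)"
      by (cases k) (simp_all add: power2_eq_square)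
    have "poly (pderiv p) x * w x ^ k = poly (pderiv p) x * w x ^ k * (w x * (r - x\<^sup>2))\<^sup>2"
      by (simp add: ws)
    also have "\<dots> = poly (pderiv p) x * (r - x\<^sup>2)\<^sup>2 * w x ^ (k + 2)"
      by (simp only: power_mult_distrib power_add mult_ac)
    finally have 1: "poly (pderiv p) x * w x ^ k = poly (pderiv p) x * (r - x\<^sup>2)\<^sup>2 * w x ^ (k + 2)" .
    have "poly p x * (real k * w x ^ (k - 1) * (2 * x * (w x)\<^sup>2)) = poly p x * 2 * x * (real k * w x ^ (k - 1) * (w x)\<^sup>2)"
      by simp
    also have "\<dots> = poly p x * 2 * x * (real k * w x ^ (k + 1)) * (w x * (r - x\<^sup>2))"
      by (simp only: k ws mult_1_right)
    also have "\<dots> = 2 * real k * (x * poly p x * (r - x\<^sup>2)) * w x ^ (k + 2)" by simp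
    finally have 2: "poly p x * (real k * w x ^ (k - 1) * (2 * x * (w x)\<^sup>2)) = 2 * real k * (x * poly p x * (r - x\<^sup>2)) * w x ^ (k + 2)" .
    have 3: "poly p x * w x ^ k * (exp (- (e * w x)) * - (e * (2 * x * (w x)\<^sup>2))) = - (2 * e * (x * poly p x)) * w x ^ (k + 2) * exp (- (e * w x))"
      by (simp add: power_add power2_eq_square)
    have 4: "poly (cutoff_dpoly r e p k) x = poly (pderiv p) x * (r - x\<^sup>2)\<^sup>2 + 2 * real k * (x * poly p x * (r - x\<^sup>2)) - 2 * e * (x * poly p x)"
      by (simp add: cutoff_dpoly_def power2_eq_square algebra_simps)
    have 5: "cutoff r e (cutoff_dpoly r e p k) (k + 2) x = poly (cutoff_dpoly r e p k) x * w x ^ (k + 2) * exp (- (e * w x))"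
      using x by (simp add: cutoff_def w_def)
    show ?thesis unfolding 1 2 3 5 4 by (simp only: distrib_right left_diff_distrib minus_mult_left diff_conv_add_uminus)
  qed
  ultimately have "((\<lambda>y. poly p y * w y ^ k * exp (- (e * w y))) has_real_derivative cutoff r e (cutoff_dpoly r e p k) (k + 2) x) (at x)"
    by (simp only:)
  then show ?thesis
    by (rule has_field_derivative_transform_within_open[OF _ op _ ev]) (use x in auto)
qed

text \<open>The exponential dominates w^(k+2) with w = 1 / (r - y^2), and the two powers beyond w^k
  become the factor (r - y^2)^2. Quadratic vanishing gives derivative 0 at the edge of the
  support.\<close>

lemma cutoff_quadratic_bound:
  assumes e: "e > 0" and r: "r < 1"
  shows "\<exists>C. \<forall>y. \<bar>cutoff r e p k y\<bar> \<le> C * (r - y\<^sup>2)\<^sup>2"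
proof -
  have "bounded (poly p ` {-1..1})"
    by (intro compact_imp_bounded compact_continuous_image continuous_intros) auto
  then obtain B where B: "\<forall>x\<in>{-1..1}. \<bar>poly p x\<bar> \<le> B" by (auto simp: bounded_iff)
  define C where "C = B * (fact (k + 2) / e ^ (k + 2))"
  have B0: "B \<ge> 0" using B by (auto intro: order_trans[OF abs_ge_zero, of "poly p 0"])
  have C0: "C \<ge> 0" unfolding C_def using e B0 by simp
  have "\<bar>cutoff r e p k y\<bar> \<le> C * (r - y\<^sup>2)\<^sup>2" for y
  proof (cases "y\<^sup>2 < r")
    case True
    then have s: "r - y\<^sup>2 > 0" by simp
    have "y\<^sup>2 \<le> 1" using True r by simp
    then have y: "y \<in> {-1..1}" by (auto simp: abs_square_le_1 abs_le_iff)
    define w where "w = 1 / (r - y\<^sup>2)"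
    have w: "w > 0" "w * (r - y\<^sup>2) = 1" using s by (auto simp: w_def)
    have "(e * w) ^ (k + 2) / fact (k + 2) \<le> exp (e * w)"
      by (rule power_div_fact_le_exp) (use e w in simp)
    then have "(e * w) ^ (k + 2) \<le> exp (e * w) * fact (k + 2)"
      by (subst (asm) pos_divide_le_eq) simp_all
    then have "(e * w) ^ (k + 2) * exp (- (e * w)) \<le> exp (e * w) * fact (k + 2) * exp (- (e * w))"
      by (rule mult_right_mono) simp
    also have "\<dots> = fact (k + 2)" by (simp add: exp_minus)
    finally have "(e * w) ^ (k + 2) * exp (- (e * w)) \<le> fact (k + 2)" .
    then have "w ^ (k + 2) * exp (- (e * w)) \<le> fact (k + 2) / e ^ (k + 2)"
      using e by (simp add: power_mult_distrib pos_le_divide_eq mult_ac)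
    then have "(w ^ (k + 2) * exp (- (e * w))) * (r - y\<^sup>2)\<^sup>2 \<le> fact (k + 2) / e ^ (k + 2) * (r - y\<^sup>2)\<^sup>2"
      by (rule mult_right_mono) simp
    moreover have "(w ^ (k + 2) * exp (- (e * w))) * (r - y\<^sup>2)\<^sup>2 = w ^ k * exp (- (e * w)) * (w * (r - y\<^sup>2))\<^sup>2"
      by (simp only: power_add power_mult_distrib mult_ac)
    ultimately have 1: "w ^ k * exp (- (e * w)) \<le> fact (k + 2) / e ^ (k + 2) * (r - y\<^sup>2)\<^sup>2"
      by (simp only: w(2) power_one mult_1_right)
    have "\<bar>cutoff r e p k y\<bar> = \<bar>poly p y\<bar> * (w ^ k * exp (- (e * w)))"
      using True w by (simp add: cutoff_def abs_mult w_def)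
    also have "\<dots> \<le> B * (fact (k + 2) / e ^ (k + 2) * (r - y\<^sup>2)\<^sup>2)"
      using B y w B0 by (intro mult_mono 1) auto
    finally show ?thesis by (simp add: C_def mult.assoc)
  next
    case False
    then show ?thesis using C0 by (simp add: cutoff_def)
  qed
  then show ?thesis by blast
qed

lemma cutoff_deriv:
  assumes e: "e > 0" and r: "r < 1"
  shows "(cutoff r e p k has_real_derivative cutoff r e (cutoff_dpoly r e p k) (k + 2) x) (at x)"
proof -
  consider "x\<^sup>2 < r" | "x\<^sup>2 > r" | "x\<^sup>2 = r" by linarith
  then show ?thesis
  proof cases
    case 1
    then show ?thesis by (rule cutoff_deriv_inside)
  next
    case 2
    have op: "open {y. r < y\<^sup>2}" by (intro open_Collect_less continuous_intros)
    have "((\<lambda>y. 0) has_real_derivative 0) (at x)" by simp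
    then have "(cutoff r e p k has_real_derivative 0) (at x)"
      by (rule has_field_derivative_transform_within_open[OF _ op]) (use 2 in \<open>auto simp: cutoff_def\<close>)
    then show ?thesis using 2 by (simp add: cutoff_def)
  next
    case 3
    obtain C where C: "\<And>y. \<bar>cutoff r e p k y\<bar> \<le> C * (r - y\<^sup>2)\<^sup>2"
      using cutoff_quadratic_bound[OF assms] by blast
    have "((\<lambda>y. (cutoff r e p k y - cutoff r e p k x) / (y - x)) \<longlongrightarrow> 0) (at x)"
    proof (rule Lim_null_comparison)
      have "((\<lambda>y. \<bar>y - x\<bar> * (C * (y + x)\<^sup>2)) \<longlongrightarrow> \<bar>x - x\<bar> * (C * (x + x)\<^sup>2)) (at x)"
        by (intro tendsto_intros)
      then show "((\<lambda>y. \<bar>y - x\<bar> * (C * (y + x)\<^sup>2)) \<longlongrightarrow> 0) (at x)" by simp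
      show "\<forall>\<^sub>F y in at x. norm ((cutoff r e p k y - cutoff r e p k x) / (y - x)) \<le> \<bar>y - x\<bar> * (C * (y + x)\<^sup>2)"
      proof (rule eventually_at_filter[THEN iffD2], rule always_eventually, intro allI impI)
        fix y assume "y \<noteq> x"
        have z: "cutoff r e p k x = 0" using 3 by (simp add: cutoff_def)
        have "(r - y\<^sup>2)\<^sup>2 = \<bar>y - x\<bar> * \<bar>y - x\<bar> * (y + x)\<^sup>2"
          unfolding 3[symmetric] by (simp add: power2_eq_square algebra_simps)
        then have "\<bar>cutoff r e p k y\<bar> \<le> \<bar>y - x\<bar> * (C * (y + x)\<^sup>2) * \<bar>y - x\<bar>"
          using C[of y] by (simp add: mult_ac)
        then show "norm ((cutoff r e p k y - cutoff r e p k x) / (y - x)) \<le> \<bar>y - x\<bar> * (C * (y + x)\<^sup>2)"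
          using \<open>y \<noteq> x\<close> by (simp add: z abs_divide pos_divide_le_eq)
      qed
    qed
    then have "(cutoff r e p k has_real_derivative 0) (at x)"
      by (simp add: has_field_derivative_iff)
    then show ?thesis using 3 by (simp add: cutoff_def)
  qed
qed

lemma cutoff_test_function:
  assumes e: "e > 0" and r: "0 < r" "r < 1"
  shows "test_function Iref (cutoff r e p k)"
  unfolding test_function_def
proof (intro conjI allI)
  fix j x
  have "\<exists>p' k'. (deriv ^^ j) (cutoff r e p k) = cutoff r e p' k'"
  proof (induction j)
    case (Suc j)
    then obtain p' k' where "(deriv ^^ j) (cutoff r e p k) = cutoff r e p' k'" by blast
    moreover have "deriv (cutoff r e p' k') = cutoff r e (cutoff_dpoly r e p' k') (k' + 2)"
      using DERIV_imp_deriv[OF cutoff_deriv[OF e r(2)]] by blast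
    ultimately have "(deriv ^^ Suc j) (cutoff r e p k) = cutoff r e (cutoff_dpoly r e p' k') (k' + 2)" by simp
    then show ?case by blast
  qed auto
  then obtain p' k' where "(deriv ^^ j) (cutoff r e p k) = cutoff r e p' k'" by blast
  then show "(deriv ^^ j) (cutoff r e p k) differentiable at x"
    using cutoff_deriv[OF e r(2)] real_differentiable_def by metis
next
  have "\<bar>x\<bar> < 1" if "\<bar>x\<bar> \<le> sqrt r" for x
    using that r real_sqrt_lt_1_iff[of r] by linarith
  then have "{- sqrt r..sqrt r} \<subseteq> Iref" by (auto simp: abs_le_iff) (smt (verit))+
  moreover have "cutoff r e p k x = 0" if "x \<notin> {- sqrt r..sqrt r}" for x
  proof -
    have "sqrt r < \<bar>x\<bar>" using that by auto
    then have "(sqrt r)\<^sup>2 < \<bar>x\<bar>\<^sup>2" using r by (intro power_strict_mono) auto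
    then show ?thesis using r by (simp add: cutoff_def)
  qed
  ultimately show "\<exists>K. compact K \<and> K \<subseteq> Iref \<and> (\<forall>x. x \<notin> K \<longrightarrow> cutoff r e p k x = 0)"
    by (intro exI[of _ "{- sqrt r..sqrt r}"]) auto
qed

section \<open>Integration by parts against polynomials and decay of Legendre coefficients\<close>

lemma ip_limit_bounded:
  assumes w: "w \<in> L2_space Iref" and g: "\<And>j. continuous_on UNIV (g j)" and h: "continuous_on UNIV h"
    and B: "\<And>j x. x \<in> Iref \<Longrightarrow> \<bar>g j x\<bar> \<le> B" and lim: "\<And>x. x \<in> Iref \<Longrightarrow> (\<lambda>j. g j x) \<longlonglongrightarrow> h x"
  shows "(\<lambda>j. ip w (g j)) \<longlonglongrightarrow> ip w h"
  unfolding ip_def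
proof (rule integral_dominated_convergence[where w = "\<lambda>x. B * \<bar>w x\<bar>"])
  have m: "f \<in> borel_measurable (lebesgue_on Iref)" if "continuous_on UNIV f" for f :: "real \<Rightarrow> real"
    by (intro continuous_imp_measurable_on_sets_lebesgue continuous_on_subset[OF that]) auto
  have wm: "w \<in> borel_measurable (lebesgue_on Iref)" using w by (simp add: L2_space_iff)
  show "(\<lambda>x. w x * h x) \<in> borel_measurable (lebesgue_on Iref)"
    "(\<lambda>x. w x * g j x) \<in> borel_measurable (lebesgue_on Iref)" for j
    by (intro borel_measurable_times wm m g h)+
  show "integrable (lebesgue_on Iref) (\<lambda>x. B * \<bar>w x\<bar>)"
    by (intro integrable_mult_right integrable_abs L2_imp_integrable w)
  show "AE x in lebesgue_on Iref. (\<lambda>j. w x * g j x) \<longlonglongrightarrow> w x * h x"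
    by (rule AE_I2) (auto intro!: tendsto_intros lim)
  show "AE x in lebesgue_on Iref. norm (w x * g j x) \<le> B * \<bar>w x\<bar>" for j
    by (rule AE_I2) (use B in \<open>auto simp: abs_mult mult.commute[of B] intro!: mult_left_mono\<close>)
qed

text \<open>The polynomial p = (1 - x^2) g is not compactly supported in the open interval, so it is
  approximated by test functions p \<eta>_j with cutoffs \<eta>_j tending to 1. The derivatives
  \<theta>_j of the cutoffs are not uniformly bounded near the endpoints, but (1 - x^2) \<theta>_j
  is, and it tends to 0 pointwise; dominated convergence then leaves no boundary term.\<close>

lemma weak_deriv_polynomial:
  assumes wd: "has_weak_deriv 1 Iref w w'" and w: "w \<in> L2_space Iref" and w': "w' \<in> L2_space Iref"
  shows "ip w (poly (pderiv ([:1, 0, -1:] * g))) = - ip w' (poly ([:1, 0, -1:] * g))"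
proof -
  define p where "p = [:1, 0, -1:] * g"
  define e where "e j = 1 / (real j + 2)" for j :: nat
  have e: "0 < e j" "e j < 1" "1 - e j < 1" "0 < 1 - e j" for j by (auto simp: e_def)
  have e0: "e \<longlonglongrightarrow> 0"
    unfolding e_def using LIMSEQ_ignore_initial_segment[OF lim_1_over_n[where 'a = real], of 2]
    by (simp add: add.commute)
  define \<phi> where "\<phi> j = cutoff (1 - e j) (e j) p 0" for j
  define \<phi>' where "\<phi>' j = cutoff (1 - e j) (e j) (cutoff_dpoly (1 - e j) (e j) p 0) 2" for j
  have d: "(\<phi> j has_real_derivative \<phi>' j x) (at x)" for j x
    unfolding \<phi>_def \<phi>'_def using cutoff_deriv[OF e(1)[of j] e(3)[of j], of p 0 x] by (simp add: numeral_2_eq_2)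
  have c: "continuous_on UNIV (\<phi> j)" for j
    by (intro continuous_at_imp_continuous_on ballI DERIV_isCont[OF d])
  have c': "continuous_on UNIV (\<phi>' j)" for j
    unfolding \<phi>'_def by (intro continuous_at_imp_continuous_on ballI DERIV_isCont[OF cutoff_deriv[OF e(1,3)]])
  have ibp: "ip w (\<phi>' j) = - ip w' (\<phi> j)" for j
  proof -
    have "test_function Iref (\<phi> j)" unfolding \<phi>_def by (rule cutoff_test_function[OF e(1,4,3)])
    then have "ip w (deriv (\<phi> j)) = - ip w' (\<phi> j)"
      using wd by (simp add: has_weak_deriv_def ip_LINT)
    moreover have "deriv (\<phi> j) = \<phi>' j" using DERIV_imp_deriv[OF d] by blast
    ultimately show ?thesis by simp
  qed
  obtain A where A: "A \<ge> 0" "\<And>x. x \<in> Iref \<Longrightarrow> \<bar>poly p x\<bar> \<le> A" using poly_bounded_Iref[of p] by blast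
  obtain A' where A': "A' \<ge> 0" "\<And>x. x \<in> Iref \<Longrightarrow> \<bar>poly (pderiv p) x\<bar> \<le> A'" using poly_bounded_Iref[of "pderiv p"] by blast
  obtain G where G: "G \<ge> 0" "\<And>x. x \<in> Iref \<Longrightarrow> \<bar>poly g x\<bar> \<le> G" using poly_bounded_Iref[of g] by blast
  define \<eta> where "\<eta> j x = (if x\<^sup>2 < 1 - e j then exp (- (e j / (1 - e j - x\<^sup>2))) else 0)" for j and x :: real
  define \<theta> where "\<theta> j x = (if x\<^sup>2 < 1 - e j then - (2 * x * e j * (1 / (1 - e j - x\<^sup>2))\<^sup>2 * exp (- (e j / (1 - e j - x\<^sup>2)))) else 0)" for j and x :: real
  have \<phi>: "\<phi> j x = poly p x * \<eta> j x" for j x by (simp add: \<phi>_def cutoff_def \<eta>_def)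
  have \<phi>': "\<phi>' j x = poly (pderiv p) x * \<eta> j x + poly p x * \<theta> j x" for j x
  proof (cases "x\<^sup>2 < 1 - e j")
    case True
    define s where "s = 1 - e j - x\<^sup>2"
    have s: "s > 0" using True by (simp add: s_def)
    have "poly (cutoff_dpoly (1 - e j) (e j) p 0) x = poly (pderiv p) x * s\<^sup>2 - 2 * e j * (x * poly p x)"
      by (simp add: cutoff_dpoly_def s_def power2_eq_square algebra_simps)
    then have "\<phi>' j x = (poly (pderiv p) x * s\<^sup>2 - 2 * e j * (x * poly p x)) * (1 / s)\<^sup>2 * exp (- (e j / s))"
      using True by (simp add: \<phi>'_def cutoff_def s_def)
    also have "\<dots> = poly (pderiv p) x * exp (- (e j / s)) + poly p x * (- (2 * x * e j * (1 / s)\<^sup>2 * exp (- (e j / s))))"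
      using s by (simp add: field_simps power2_eq_square)
    finally show ?thesis using True by (simp add: \<eta>_def \<theta>_def s_def)
  qed (simp add: \<phi>'_def cutoff_def \<eta>_def \<theta>_def)
  have \<eta>b: "0 \<le> \<eta> j x" "\<eta> j x \<le> 1" for j x using e(1)[of j] by (auto simp: \<eta>_def)
  have \<theta>b: "\<bar>(1 - x\<^sup>2) * \<theta> j x\<bar> \<le> 6" if x: "x \<in> Iref" for j x
  proof (cases "x\<^sup>2 < 1 - e j")
    case True
    define s where "s = 1 - e j - x\<^sup>2"
    have s: "s > 0" using True by (simp add: s_def)
    \<comment> \<open>Since 1 - x^2 = s + \<open>e j\<close>, the product (1 - x^2)
      \<open>e j\<close> / s^2 equals t + t^2. The bounds 1 and 2 for t exp (- t) and t^2 exp (- t)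
      give 2 (1 + 2) = 6.\<close>
    define t where "t = e j / s"
    have t: "t > 0" using s e(1) by (simp add: t_def)
    have t1: "t * exp (- t) \<le> 1" and t2: "t\<^sup>2 * exp (- t) \<le> 2"
      using power_div_fact_le_exp[of t 1] power_div_fact_le_exp[of t 2] t
      by (simp_all add: exp_minus field_simps)
    have "\<bar>(1 - x\<^sup>2) * \<theta> j x\<bar> = \<bar>x\<bar> * (2 * ((1 - x\<^sup>2) * e j * (1 / s)\<^sup>2 * exp (- t)))"
      using True e(1)[of j] one_minus_sq_pos[OF x] unfolding \<theta>_def s_def[symmetric] t_def[symmetric]
      by (simp add: abs_mult mult_ac)
    also have "(1 - x\<^sup>2) * e j * (1 / s)\<^sup>2 = t + t\<^sup>2"
    proof -
      have h: "1 - x\<^sup>2 = s + e j" by (simp add: s_def)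
      show ?thesis unfolding h using s by (simp add: t_def field_simps power2_eq_square)
    qed
    also have "\<bar>x\<bar> * (2 * ((t + t\<^sup>2) * exp (- t))) \<le> 1 * (2 * (1 + 2))"
      using x t1 t2 t by (intro mult_mono) (auto simp: distrib_right)
    finally show ?thesis by simp
  qed (simp add: \<theta>_def)
  have lim: "(\<lambda>j. \<eta> j x) \<longlonglongrightarrow> 1" "(\<lambda>j. \<theta> j x) \<longlonglongrightarrow> 0" if x: "x \<in> Iref" for x
  proof -
    have "eventually (\<lambda>j. e j < 1 - x\<^sup>2) sequentially"
      using order_tendstoD(2)[OF e0 one_minus_sq_pos[OF x]] .
    then have ev: "eventually (\<lambda>j. x\<^sup>2 < 1 - e j) sequentially" by eventually_elim simp
    have nz: "1 - 0 - x\<^sup>2 \<noteq> 0" using one_minus_sq_pos[OF x] by simp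
    have "(\<lambda>j. exp (- (e j / (1 - e j - x\<^sup>2)))) \<longlonglongrightarrow> exp (- (0 / (1 - 0 - x\<^sup>2)))"
      by (intro tendsto_intros e0 nz)
    then have "(\<lambda>j. exp (- (e j / (1 - e j - x\<^sup>2)))) \<longlonglongrightarrow> 1" by simp
    then show "(\<lambda>j. \<eta> j x) \<longlonglongrightarrow> 1"
      by (rule Lim_transform_eventually) (use ev in \<open>auto elim!: eventually_mono simp: \<eta>_def\<close>)
    have "(\<lambda>j. - (2 * x * e j * (1 / (1 - e j - x\<^sup>2))\<^sup>2 * exp (- (e j / (1 - e j - x\<^sup>2))))) \<longlonglongrightarrow>
       - (2 * x * 0 * (1 / (1 - 0 - x\<^sup>2))\<^sup>2 * exp (- (0 / (1 - 0 - x\<^sup>2))))"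
      by (intro tendsto_intros e0 nz)
    then have "(\<lambda>j. - (2 * x * e j * (1 / (1 - e j - x\<^sup>2))\<^sup>2 * exp (- (e j / (1 - e j - x\<^sup>2))))) \<longlonglongrightarrow> 0" by simp
    then show "(\<lambda>j. \<theta> j x) \<longlonglongrightarrow> 0"
      by (rule Lim_transform_eventually) (use ev in \<open>auto elim!: eventually_mono simp: \<theta>_def\<close>)
  qed
  have l1: "(\<lambda>j. ip w' (\<phi> j)) \<longlonglongrightarrow> ip w' (poly p)"
  proof (rule ip_limit_bounded[OF w' c])
    show "continuous_on UNIV (poly p)" by (intro continuous_intros)
    fix x :: real assume x: "x \<in> Iref"
    show "\<bar>\<phi> j x\<bar> \<le> A" for j
      using mult_mono[OF A(2)[OF x] \<eta>b(2)[of j x]] A(1) \<eta>b(1)[of j x] by (simp add: \<phi> abs_mult)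
    have "(\<lambda>j. poly p x * \<eta> j x) \<longlonglongrightarrow> poly p x * 1" by (intro tendsto_intros lim x)
    then show "(\<lambda>j. \<phi> j x) \<longlonglongrightarrow> poly p x" by (simp add: \<phi>)
  qed
  have l2: "(\<lambda>j. ip w (\<phi>' j)) \<longlonglongrightarrow> ip w (poly (pderiv p))"
  proof (rule ip_limit_bounded[OF w c'])
    show "continuous_on UNIV (poly (pderiv p))" by (intro continuous_intros)
    fix x :: real assume x: "x \<in> Iref"
    show "\<bar>\<phi>' j x\<bar> \<le> A' + G * 6" for j
    proof -
      have "poly p x = poly g x * (1 - x\<^sup>2)" by (simp add: p_def power2_eq_square algebra_simps)
      then have "\<phi>' j x = poly (pderiv p) x * \<eta> j x + poly g x * ((1 - x\<^sup>2) * \<theta> j x)" by (simp add: \<phi>')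
      then have "\<bar>\<phi>' j x\<bar> \<le> \<bar>poly (pderiv p) x\<bar> * \<bar>\<eta> j x\<bar> + \<bar>poly g x\<bar> * \<bar>(1 - x\<^sup>2) * \<theta> j x\<bar>"
        by (simp only: abs_mult[symmetric] abs_triangle_ineq)
      also have "\<dots> \<le> A' * 1 + G * 6"
        using \<eta>b[of j x] by (intro add_mono mult_mono A' G \<theta>b x) auto
      finally show ?thesis by simp
    qed
    have "(\<lambda>j. poly (pderiv p) x * \<eta> j x + poly p x * \<theta> j x) \<longlonglongrightarrow> poly (pderiv p) x * 1 + poly p x * 0"
      by (intro tendsto_intros lim x)
    then show "(\<lambda>j. \<phi>' j x) \<longlonglongrightarrow> poly (pderiv p) x" by (simp add: \<phi>')
  qed
  have "(\<lambda>j. ip w (\<phi>' j)) \<longlonglongrightarrow> - ip w' (poly p)"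
    unfolding ibp by (intro tendsto_minus l1)
  from LIMSEQ_unique[OF l2 this] show ?thesis by (simp add: p_def)
qed

text \<open>Integration by parts against the flux of P_(n+1): its derivative is a multiple of
  P_(n+1), and the flux itself is a multiple of P_n - P_(n+2).\<close>

lemma weak_deriv_leg:
  assumes wd: "has_weak_deriv 1 Iref w w'" and w: "w \<in> L2_space Iref" and w': "w' \<in> L2_space Iref"
  shows "(2 * real n + 3) * ip w (Leg (Suc n)) = ip w' (Leg n) - ip w' (Leg (Suc (Suc n)))"
proof -
  let ?N = "(real n + 1) * (real n + 2)"
  let ?p = "[:1, 0, -1:] * pderiv (leg (Suc n))"
  have p: "poly ?p = (\<lambda>x. (1 - x\<^sup>2) * dLeg (Suc n) x)"
    by (simp add: fun_eq_iff power2_eq_square algebra_simps)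
  have dp: "poly (pderiv ?p) = (\<lambda>x. - ?N * Leg (Suc n) x)"
  proof
    fix x
    have "(poly ?p has_real_derivative - (real (Suc n) * (real (Suc n) + 1) * Leg (Suc n) x)) (at x)"
      unfolding p by (rule leg_ode_deriv)
    from DERIV_unique[OF poly_DERIV this] show "poly (pderiv ?p) x = - ?N * Leg (Suc n) x"
      by (simp add: algebra_simps)
  qed
  have "- ?N * ip w (Leg (Suc n)) = - ip w' (poly ?p)"
    using weak_deriv_polynomial[OF assms, of "pderiv (leg (Suc n))"] unfolding dp by (simp only: ip_cmult_right)
  also have "poly ?p = (\<lambda>x. ?N / (2 * real n + 3) * (Leg n x - Leg (Suc (Suc n)) x))"
    unfolding p leg_deriv_weight' ..
  also have "ip w' \<dots> = ?N / (2 * real n + 3) * (ip w' (Leg n) - ip w' (Leg (Suc (Suc n))))"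
    by (simp only: ip_cmult_right ip_diff_right L2_poly w')
  finally have "?N * ((2 * real n + 3) * ip w (Leg (Suc n))) = ?N * (ip w' (Leg n) - ip w' (Leg (Suc (Suc n))))"
    by (simp add: field_simps)
  moreover have "?N \<noteq> 0" by (metis mult_eq_0_iff add.commute of_nat_Suc of_nat_0_neq of_nat_numeral of_nat_add add_2_eq_Suc)
  ultimately show ?thesis by (simp only: mult_cancel_left) simp
qed

text \<open>The square of \<open>weak_deriv_leg\<close> in the orthonormal basis; n + 1/2, n + 3/2
  and n + 5/2 are the squared normalizing factors at the three indices.\<close>

lemma weak_deriv_coef:
  assumes wd: "has_weak_deriv 1 Iref w w'" and w: "w \<in> L2_space Iref" and w': "w' \<in> L2_space Iref"
  shows "(real n + 1)\<^sup>2 * (coef w (Suc n))\<^sup>2 \<le> (coef w' n)\<^sup>2 + (coef w' (Suc (Suc n)))\<^sup>2"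
proof -
  define m0 where "m0 = ip w' (Leg n)"
  define m2 where "m2 = ip w' (Leg (Suc (Suc n)))"
  define m1 where "m1 = ip w (Leg (Suc n))"
  have c: "(coef w (Suc n))\<^sup>2 = (real n + 3/2) * m1\<^sup>2" "(coef w' n)\<^sup>2 = (real n + 1/2) * m0\<^sup>2"
    "(coef w' (Suc (Suc n)))\<^sup>2 = (real n + 5/2) * m2\<^sup>2"
    unfolding coef_def leg_on_def m0_def m1_def m2_def by (simp_all add: ip_cmult_right power_mult_distrib add.commute)
  have m: "(2 * real n + 3) * m1 = m0 - m2"
    unfolding m0_def m1_def m2_def by (rule weak_deriv_leg[OF assms])
  have "(2 * real n + 3)\<^sup>2 * m1\<^sup>2 = (m0 - m2)\<^sup>2" by (simp only: power_mult_distrib[symmetric] m)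
  also have "\<dots> \<le> 2 * m0\<^sup>2 + 2 * m2\<^sup>2"
    using zero_le_power2[of "m0 + m2"] by (simp add: power2_eq_square algebra_simps)
  finally have k: "(2 * real n + 3)\<^sup>2 * m1\<^sup>2 \<le> 2 * m0\<^sup>2 + 2 * m2\<^sup>2" .
  have "(2 * real n + 3) * ((real n + 1)\<^sup>2 * ((real n + 3/2) * m1\<^sup>2)) = (real n + 1)\<^sup>2 / 2 * ((2 * real n + 3)\<^sup>2 * m1\<^sup>2)"
  proof -
    have "real n + 3/2 = (2 * real n + 3) / 2" by simp
    then show ?thesis by (simp only: power2_eq_square) simp
  qed
  also have "\<dots> \<le> (real n + 1)\<^sup>2 / 2 * (2 * m0\<^sup>2 + 2 * m2\<^sup>2)" by (intro mult_left_mono k) simp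
  also have "\<dots> = (real n + 1)\<^sup>2 * m0\<^sup>2 + (real n + 1)\<^sup>2 * m2\<^sup>2" by (simp add: algebra_simps)
  also have "\<dots> \<le> (2 * real n + 3) * (real n + 1/2) * m0\<^sup>2 + (2 * real n + 3) * (real n + 5/2) * m2\<^sup>2"
  proof -
    have "0 \<le> real n * real n" by simp
    then have "(real n + 1)\<^sup>2 \<le> (2 * real n + 3) * (real n + 1/2)" "(real n + 1)\<^sup>2 \<le> (2 * real n + 3) * (real n + 5/2)"
      unfolding power2_eq_square distrib_left distrib_right by linarith+
    then show ?thesis by (intro add_mono mult_right_mono) auto
  qed
  finally have "(2 * real n + 3) * ((real n + 1)\<^sup>2 * ((real n + 3/2) * m1\<^sup>2))
      \<le> (2 * real n + 3) * ((real n + 1/2) * m0\<^sup>2 + (real n + 5/2) * m2\<^sup>2)"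
    by (simp only: distrib_left[of _ "(real n + 1/2) * m0\<^sup>2"] mult.assoc)
  then show ?thesis unfolding c by (rule mult_left_le_imp_le) simp
qed

definition tail :: "nat \<Rightarrow> (nat \<Rightarrow> real) \<Rightarrow> real" where "tail K a = (\<Sum>n. (a (n + K))\<^sup>2)"

lemma tail_summable: "ell2 a \<Longrightarrow> summable (\<lambda>n. (a (n + K))\<^sup>2)"
  by (simp add: ell2_def summable_iff_shift[of "\<lambda>n. (a n)\<^sup>2"])

lemma tail_mono:
  assumes "ell2 a" "K \<le> L"
  shows "tail L a \<le> tail K a"
proof -
  have "tail K a = (\<Sum>n. (a (n + (L - K) + K))\<^sup>2) + (\<Sum>n<L - K. (a (n + K))\<^sup>2)"
    unfolding tail_def by (rule suminf_split_initial_segment[OF tail_summable[OF assms(1)]])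
  then show ?thesis using assms(2) by (simp add: tail_def sum_nonneg add.assoc)
qed

text \<open>The tail on the left starts one index later because coefficient n + 1 of w involves
  coefficient n of w'. The factor 2 arises because a coefficient of w' can serve two
  neighbours.\<close>

lemma weak_deriv_tail:
  assumes wd: "has_weak_deriv 1 Iref w w'" and w: "w \<in> L2_space Iref" and w': "w' \<in> L2_space Iref"
  shows "tail (Suc K) (coef w) \<le> 2 / (real K + 1)\<^sup>2 * tail K (coef w')"
proof -
  note s = tail_summable[OF ell2_coef[OF w']] and s0 = tail_summable[OF ell2_coef[OF w]]
  have "(real K + 1)\<^sup>2 * tail (Suc K) (coef w) = (\<Sum>n. (real K + 1)\<^sup>2 * (coef w (n + Suc K))\<^sup>2)"
    unfolding tail_def by (rule suminf_mult[OF s0, symmetric])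
  also have "\<dots> \<le> (\<Sum>n. (coef w' (n + K))\<^sup>2 + (coef w' (n + Suc (Suc K)))\<^sup>2)"
  proof (rule suminf_le)
    fix n
    have "(real K + 1)\<^sup>2 * (coef w (n + Suc K))\<^sup>2 \<le> (real (n + K) + 1)\<^sup>2 * (coef w (Suc (n + K)))\<^sup>2"
      by (simp add: mult_right_mono power_mono)
    also have "\<dots> \<le> (coef w' (n + K))\<^sup>2 + (coef w' (n + Suc (Suc K)))\<^sup>2"
      using weak_deriv_coef[OF assms, of "n + K"] by simp
    finally show "(real K + 1)\<^sup>2 * (coef w (n + Suc K))\<^sup>2 \<le> (coef w' (n + K))\<^sup>2 + (coef w' (n + Suc (Suc K)))\<^sup>2" .
  qed (intro summable_mult summable_add s s0)+
  also have "\<dots> = tail K (coef w') + tail (Suc (Suc K)) (coef w')"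
    unfolding tail_def by (rule suminf_add[symmetric]; rule s)
  also have "\<dots> \<le> 2 * tail K (coef w')" using tail_mono[OF ell2_coef[OF w'], of K "Suc (Suc K)"] by simp
  finally show ?thesis by (simp add: field_simps)
qed

text \<open>The derivative of a test function is again a test function: it vanishes off the same
  compact set, whose complement is open. It may thus be inserted into the identity of order
  k.\<close>

lemma weak_deriv_shift:
  assumes u: "has_weak_deriv k S u v" and u': "has_weak_deriv (Suc k) S u v'"
  shows "has_weak_deriv 1 S v v'"
  unfolding has_weak_deriv_def
proof (intro allI impI)
  fix \<phi> assume \<phi>: "test_function S \<phi>"
  have "test_function S (deriv \<phi>)"
    unfolding test_function_def
  proof (intro conjI allI)
    fix j x
    have "(deriv ^^ Suc j) \<phi> differentiable (at x)" using \<phi> by (simp only: test_function_def)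
    then show "(deriv ^^ j) (deriv \<phi>) differentiable (at x)" by (simp only: funpow_Suc_right o_apply)
  next
    obtain K where K: "compact K" "K \<subseteq> S" "\<And>x. x \<notin> K \<Longrightarrow> \<phi> x = 0"
      using \<phi> by (auto simp: test_function_def)
    have "deriv \<phi> x = 0" if "x \<notin> K" for x
    proof -
      have "(\<phi> has_real_derivative 0) (at x)"
      proof (rule has_field_derivative_transform_within_open[of "\<lambda>x. 0" _ _ "- K"])
        show "open (- K)" using K(1) by (simp add: compact_imp_closed open_Compl)
      qed (use K that in auto)
      then show ?thesis by (rule DERIV_imp_deriv)
    qed
    then show "\<exists>K. compact K \<and> K \<subseteq> S \<and> (\<forall>x. x \<notin> K \<longrightarrow> deriv \<phi> x = 0)" using K by blast
  qed
  with u have "(LINT x:S|lebesgue. u x * (deriv ^^ k) (deriv \<phi>) x) = (-1) ^ k * (LINT x:S|lebesgue. v x * deriv \<phi> x)"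
    by (simp add: has_weak_deriv_def)
  moreover have "(LINT x:S|lebesgue. u x * (deriv ^^ Suc k) \<phi> x) = (-1) ^ Suc k * (LINT x:S|lebesgue. v' x * \<phi> x)"
    using u' \<phi> by (simp only: has_weak_deriv_def)
  ultimately have "(-1) ^ k * (LINT x:S|lebesgue. v x * deriv \<phi> x) = (-1) ^ Suc k * (LINT x:S|lebesgue. v' x * \<phi> x)"
    by (simp only: funpow_Suc_right o_apply)
  then have "(-1) ^ k * (LINT x:S|lebesgue. v x * deriv \<phi> x) = (-1) ^ k * - (LINT x:S|lebesgue. v' x * \<phi> x)" by simp
  then show "(LINT x:S|lebesgue. v x * (deriv ^^ 1) \<phi> x) = (-1) ^ 1 * (LINT x:S|lebesgue. v' x * \<phi> x)"
    by (simp only: mult_cancel_left) simp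
qed

text \<open>Descends from the derivative \<open>v s\<close> to \<open>v 0 = u\<close>; each step
  costs one index of the tail and gains the factor 2 / (K + 1)^2.\<close>

lemma sobolev_coef_tail:
  assumes L: "\<And>k. k \<le> s \<Longrightarrow> v k \<in> L2_space Iref" and wd: "\<And>k. k \<le> s \<Longrightarrow> has_weak_deriv k Iref u (v k)"
    and v0: "v 0 = u"
  shows "tail (K + s) (coef u) \<le> (2 / (real K + 1)\<^sup>2) ^ s * nsq (v s)"
proof -
  have "j \<le> s \<Longrightarrow> tail (K + j) (coef (v (s - j))) \<le> (2 / (real K + 1)\<^sup>2) ^ j * tail K (coef (v s))" for j
  proof (induction j)
    case (Suc j)
    have w: "has_weak_deriv 1 Iref (v (s - Suc j)) (v (s - j))"
    proof (rule weak_deriv_shift[of "s - Suc j" _ u])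
      show "has_weak_deriv (Suc (s - Suc j)) Iref u (v (s - j))"
        using wd[of "s - j"] Suc.prems by (simp add: Suc_diff_Suc)
    qed (use wd in simp)
    have t0: "0 \<le> tail (K + j) (coef (v (s - j)))" unfolding tail_def
      by (rule suminf_nonneg[OF tail_summable[OF ell2_coef[OF L]]]) auto
    have "tail (K + Suc j) (coef (v (s - Suc j))) \<le> 2 / (real (K + j) + 1)\<^sup>2 * tail (K + j) (coef (v (s - j)))"
      using weak_deriv_tail[OF w L L, of "K + j"] by simp
    also have "\<dots> \<le> 2 / (real K + 1)\<^sup>2 * tail (K + j) (coef (v (s - j)))"
      by (intro mult_right_mono divide_left_mono power_mono t0) auto
    also have "\<dots> \<le> 2 / (real K + 1)\<^sup>2 * ((2 / (real K + 1)\<^sup>2) ^ j * tail K (coef (v s)))"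
      using Suc by (intro mult_left_mono) auto
    finally show ?case by (simp add: mult.assoc)
  qed simp
  from this[of s] have "tail (K + s) (coef u) \<le> (2 / (real K + 1)\<^sup>2) ^ s * tail K (coef (v s))" by (simp add: v0)
  also have "tail K (coef (v s)) \<le> tail 0 (coef (v s))" by (rule tail_mono) (auto simp: ell2_coef L)
  also have "tail 0 (coef (v s)) = nsq (v s)" using parseval[OF L[of s]] by (simp add: tail_def sums_iff)
  finally show ?thesis by (simp add: mult_left_mono)
qed

section \<open>Scaling and the partition\<close>

lemma affine_in_interval: "r > 0 \<Longrightarrow> m + r * y \<in> {m - r<..<m + r} \<longleftrightarrow> y \<in> Iref" for r m y :: real
proof -
  assume r: "r > 0"
  have "m - r < m + r * y \<longleftrightarrow> r * (-1) < r * y" by auto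
  also have "\<dots> \<longleftrightarrow> -1 < y" using r by (simp only: mult_less_cancel_left_pos)
  finally have 1: "m - r < m + r * y \<longleftrightarrow> -1 < y" .
  have "m + r * y < m + r \<longleftrightarrow> r * y < r * 1" by auto
  also have "\<dots> \<longleftrightarrow> y < 1" using r by (simp only: mult_less_cancel_left_pos)
  finally show ?thesis using 1 by simp
qed

lemma affine_LINT:
  fixes f :: "real \<Rightarrow> real"
  assumes r: "r > 0"
  shows "(LINT x:{m - r<..<m + r}|lebesgue. f x) = r * (LINT y:Iref|lebesgue. f (m + r * y))"
    and "set_integrable lebesgue {m - r<..<m + r} f \<longleftrightarrow> set_integrable lebesgue Iref (\<lambda>y. f (m + r * y))"
proof -
  have i: "indicator {m - r<..<m + r} (m + r * y) = (indicator Iref y :: real)" for y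
    using affine_in_interval[OF r, of m y] by (simp add: indicator_def)
  show "(LINT x:{m - r<..<m + r}|lebesgue. f x) = r * (LINT y:Iref|lebesgue. f (m + r * y))"
    unfolding set_lebesgue_integral_def
    using r lebesgue_integral_real_affine[of r "\<lambda>x. indicator {m - r<..<m + r} x *\<^sub>R f x" m] by (simp add: i)
  show "set_integrable lebesgue {m - r<..<m + r} f \<longleftrightarrow> set_integrable lebesgue Iref (\<lambda>y. f (m + r * y))"
    unfolding set_integrable_def
    using r lebesgue_integrable_real_affine_iff[of r "\<lambda>x. indicator {m - r<..<m + r} x *\<^sub>R f x" m] by (simp add: i)
qed

lemma affine_L2:
  assumes r: "r > 0" and u: "u \<in> L2_space {m - r<..<m + r}"
  shows "(\<lambda>y. u (m + r * y)) \<in> L2_space Iref"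
proof -
  have i: "indicator {m - r<..<m + r} (m + r * y) = (indicator Iref y :: real)" for y
    using affine_in_interval[OF r, of m y] by (simp add: indicator_def)
  have "(\<lambda>x. indicator {m - r<..<m + r} x *\<^sub>R u x) \<in> borel_measurable lebesgue"
    using u by (simp add: L2_space_def set_borel_measurable_def)
  from borel_measurable_affine[OF this, of r m] r
  have "set_borel_measurable lebesgue Iref (\<lambda>y. u (m + r * y))"
    by (simp add: set_borel_measurable_def i)
  moreover have "set_integrable lebesgue Iref (\<lambda>y. (u (m + r * y))\<^sup>2)"
    using u affine_LINT(2)[OF r, of m "\<lambda>x. (u x)\<^sup>2"] by (simp add: L2_space_def)
  ultimately show ?thesis by (simp add: L2_space_def)
qed

lemma higher_deriv_affine:
  fixes \<phi> :: "real \<Rightarrow> real"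
  assumes "\<And>k x. ((deriv ^^ k) \<phi>) differentiable (at x)" and r: "r \<noteq> 0"
  shows "(deriv ^^ k) (\<lambda>x. \<phi> ((x - m) / r)) = (\<lambda>x. (1 / r) ^ k * (deriv ^^ k) \<phi> ((x - m) / r))"
    and "((deriv ^^ k) (\<lambda>x. \<phi> ((x - m) / r))) differentiable (at x)"
proof -
  have d: "((\<lambda>x. (1 / r) ^ k * (deriv ^^ k) \<phi> ((x - m) / r)) has_real_derivative
      (1 / r) ^ Suc k * (deriv ^^ Suc k) \<phi> ((x - m) / r)) (at x)" for k x
  proof -
    have "((deriv ^^ k) \<phi> has_real_derivative (deriv ^^ Suc k) \<phi> ((x - m) / r)) (at ((x - m) / r))"
      using assms(1)[of k "(x - m) / r"] by (simp add: DERIV_deriv_iff_real_differentiable)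
    then have "((\<lambda>x. (deriv ^^ k) \<phi> ((x - m) / r)) has_real_derivative (deriv ^^ Suc k) \<phi> ((x - m) / r) * (1 / r)) (at x)"
      by (rule DERIV_chain2) (use r in \<open>auto intro!: derivative_eq_intros\<close>)
    from DERIV_cmult[OF this, of "(1 / r) ^ k"] show ?thesis by (simp only: power_Suc mult_ac)
  qed
  show eq: "(deriv ^^ k) (\<lambda>x. \<phi> ((x - m) / r)) = (\<lambda>x. (1 / r) ^ k * (deriv ^^ k) \<phi> ((x - m) / r))" for k
  proof (induction k)
    case (Suc k)
    have "(deriv ^^ Suc k) (\<lambda>x. \<phi> ((x - m) / r)) = deriv (\<lambda>x. (1 / r) ^ k * (deriv ^^ k) \<phi> ((x - m) / r))"
      by (simp add: Suc)
    then show ?case using DERIV_imp_deriv[OF d] by auto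
  qed simp
  show "((deriv ^^ k) (\<lambda>x. \<phi> ((x - m) / r))) differentiable (at x)"
    unfolding eq using d real_differentiable_def by blast
qed

text \<open>Test functions are transported to the element. Each of their derivatives costs a factor
  1 / r, and moving these to the other side gives r^k; this is the source of the power of h.\<close>

lemma affine_weak_deriv:
  assumes r: "r > 0" and wd: "has_weak_deriv k {m - r<..<m + r} u v"
  shows "has_weak_deriv k Iref (\<lambda>y. u (m + r * y)) (\<lambda>y. r ^ k * v (m + r * y))"
  unfolding has_weak_deriv_def
proof (intro allI impI)
  fix \<phi> assume \<phi>: "test_function Iref \<phi>"
  let ?\<psi> = "\<lambda>x. \<phi> ((x - m) / r)"
  have dif: "\<And>k x. ((deriv ^^ k) \<phi>) differentiable (at x)" using \<phi> by (simp add: test_function_def)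
  note hd = higher_deriv_affine[OF dif, of r]
  obtain K where K: "compact K" "K \<subseteq> Iref" "\<And>x. x \<notin> K \<Longrightarrow> \<phi> x = 0"
    using \<phi> by (auto simp: test_function_def)
  have "test_function {m - r<..<m + r} ?\<psi>"
    unfolding test_function_def
  proof (intro conjI allI)
    show "((deriv ^^ k) ?\<psi>) differentiable (at x)" for k x by (rule hd(2)) (use r in simp)
    show "\<exists>K. compact K \<and> K \<subseteq> {m - r<..<m + r} \<and> (\<forall>x. x \<notin> K \<longrightarrow> ?\<psi> x = 0)"
    proof (intro exI conjI allI impI)
      show "compact ((\<lambda>y. m + r * y) ` K)"
        by (intro compact_continuous_image continuous_intros K(1))
      show "(\<lambda>y. m + r * y) ` K \<subseteq> {m - r<..<m + r}"
        using K(2) affine_in_interval[OF r, of m] by blast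
      fix x assume x: "x \<notin> (\<lambda>y. m + r * y) ` K"
      have "x = m + r * ((x - m) / r)" using r by simp
      then have "(x - m) / r \<notin> K" using x by blast
      then show "?\<psi> x = 0" by (rule K(3))
    qed
  qed
  with wd have w: "(LINT x:{m - r<..<m + r}|lebesgue. u x * (deriv ^^ k) ?\<psi> x)
      = (-1) ^ k * (LINT x:{m - r<..<m + r}|lebesgue. v x * ?\<psi> x)"
    by (simp add: has_weak_deriv_def)
  have r0: "r \<noteq> 0" using r by simp
  have "r * ((1 / r) ^ k * (LINT y:Iref|lebesgue. u (m + r * y) * (deriv ^^ k) \<phi> y))
      = r * (LINT y:Iref|lebesgue. u (m + r * y) * (deriv ^^ k) ?\<psi> (m + r * y))"
    unfolding set_integral_mult_right[symmetric] hd(1)[OF r0] using r0 by (simp add: mult.left_commute)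
  also have "\<dots> = (-1) ^ k * (r * (LINT y:Iref|lebesgue. v (m + r * y) * ?\<psi> (m + r * y)))"
    using w unfolding affine_LINT(1)[OF r] .
  finally have "(1 / r) ^ k * (LINT y:Iref|lebesgue. u (m + r * y) * (deriv ^^ k) \<phi> y)
      = (-1) ^ k * (LINT y:Iref|lebesgue. v (m + r * y) * \<phi> y)"
    using r0 by (simp add: mult.left_commute)
  then have "r ^ k * ((1 / r) ^ k * (LINT y:Iref|lebesgue. u (m + r * y) * (deriv ^^ k) \<phi> y))
      = r ^ k * ((-1) ^ k * (LINT y:Iref|lebesgue. v (m + r * y) * \<phi> y))" by simp
  moreover have "r ^ k * (1 / r) ^ k = 1" using r0 by (simp flip: power_mult_distrib)
  ultimately have "(LINT y:Iref|lebesgue. u (m + r * y) * (deriv ^^ k) \<phi> y)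
      = r ^ k * ((-1) ^ k * (LINT y:Iref|lebesgue. v (m + r * y) * \<phi> y))" by (simp flip: mult.assoc)
  also have "\<dots> = (-1) ^ k * (LINT y:Iref|lebesgue. r ^ k * v (m + r * y) * \<phi> y)"
    unfolding mult.assoc set_integral_mult_right by simp
  finally show "(LINT y:Iref|lebesgue. u (m + r * y) * (deriv ^^ k) \<phi> y)
      = (-1) ^ k * (LINT y:Iref|lebesgue. r ^ k * v (m + r * y) * \<phi> y)" .
qed

lemma affine_L2norm:
  assumes "r > 0"
  shows "(L2norm {m - r<..<m + r} f)\<^sup>2 = r * nsq (\<lambda>y. f (m + r * y))"
proof -
  have "(LINT x:{m - r<..<m + r}|lebesgue. (f x)\<^sup>2) = r * nsq (\<lambda>y. f (m + r * y))"
    unfolding affine_LINT(1)[OF assms] ip_LINT[symmetric] by (simp add: power2_eq_square)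
  then show ?thesis using assms ip_nonneg by (simp add: L2norm_def)
qed

lemma sobolev_coef_tail_affine:
  assumes r: "r > 0" and s: "s \<ge> 1" and u: "u \<in> sobolev_space s {m - r<..<m + r}"
  shows "tail (K + s) (coef (\<lambda>y. u (m + r * y)))
     \<le> (2 / (real K + 1)\<^sup>2) ^ s * (r ^ s)\<^sup>2 * nsq (\<lambda>y. weak_deriv s {m - r<..<m + r} u (m + r * y))"
proof -
  let ?S = "{m - r<..<m + r}"
  define wk where "wk k = weak_deriv k ?S u" for k
  have wk: "wk k \<in> L2_space ?S \<and> has_weak_deriv k ?S u (wk k)" if "k \<le> s" for k
  proof -
    have "\<exists>v. v \<in> L2_space ?S \<and> has_weak_deriv k ?S u v" using u that by (auto simp: sobolev_space_def)
    then show ?thesis unfolding wk_def weak_deriv_def by (rule someI_ex)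
  qed
  \<comment> \<open>At order 0 the function itself is taken, since the chosen
    \<open>weak_deriv 0\<close> agrees with u only almost everywhere.\<close>
  define v where "v k = (if k = 0 then (\<lambda>y. u (m + r * y)) else (\<lambda>y. r ^ k * wk k (m + r * y)))" for k
  have uL: "(\<lambda>y. u (m + r * y)) \<in> L2_space Iref"
    using u by (intro affine_L2[OF r]) (simp add: sobolev_space_def)
  have main: "tail (K + s) (coef (\<lambda>y. u (m + r * y))) \<le> (2 / (real K + 1)\<^sup>2) ^ s * nsq (v s)"
  proof (rule sobolev_coef_tail)
    show "v k \<in> L2_space Iref" if "k \<le> s" for k
      unfolding v_def using uL wk[OF that] by (auto intro!: L2_cmult affine_L2[OF r])
    show "has_weak_deriv k Iref (\<lambda>y. u (m + r * y)) (v k)" if "k \<le> s" for k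
    proof (cases "k = 0")
      case True
      then show ?thesis by (simp add: v_def has_weak_deriv_def)
    next
      case False
      then show ?thesis using affine_weak_deriv[OF r, of k m u "wk k"] wk[OF that] by (simp add: v_def)
    qed
  qed (simp add: v_def)
  have "nsq (v s) = (r ^ s)\<^sup>2 * nsq (\<lambda>y. wk s (m + r * y))"
    using s by (simp add: v_def ip_cmult_left ip_cmult_right power2_eq_square)
  then show ?thesis using main by (simp add: wk_def mult.assoc)
qed

lemma node_diff: "i \<ge> 1 \<Longrightarrow> node a b M i = node a b M (i - 1) + mesh a b M"
  by (simp add: node_def of_nat_diff algebra_simps)

lemma elem_eq:
  assumes "i \<ge> 1"
  shows "elem a b M i = {midpt a b M i - mesh a b M / 2<..<midpt a b M i + mesh a b M / 2}"
proof -
  have "midpt a b M i - mesh a b M / 2 = node a b M (i - 1)" "midpt a b M i + mesh a b M / 2 = node a b M i"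
    unfolding midpt_def node_diff[OF assms] by (simp_all add: field_simps)
  then show ?thesis by (simp only: elem_def)
qed

lemma elem_unique:
  assumes "a < b" "M \<ge> 1" and i: "i \<ge> 1" "x \<in> elem a b M i" and j: "j \<ge> 1" "x \<in> elem a b M j"
  shows "i = j"
proof -
  have h: "mesh a b M > 0" using assms by (simp add: mesh_def)
  have "\<not> i < j" if "i \<ge> 1" "x \<in> elem a b M i" "j \<ge> 1" "x \<in> elem a b M j" for i j
  proof
    assume "i < j"
    then have "real i * mesh a b M \<le> real (j - 1) * mesh a b M" using h by (intro mult_right_mono) auto
    then show False using that by (simp add: elem_def node_def)
  qed
  from this[OF i j] this[OF j i] show ?thesis by linarith
qed

lemma elem_subset:
  assumes "a < b" "i \<in> {1..M}"
  shows "elem a b M i \<subseteq> {a<..<b}"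
proof -
  have M: "M \<ge> 1" using assms by auto
  have h: "mesh a b M > 0" using assms M by (simp add: mesh_def)
  have "node a b M i \<le> a + real M * mesh a b M"
    unfolding node_def using assms h by (intro add_left_mono mult_right_mono) auto
  also have "\<dots> = b" using M by (simp add: mesh_def)
  finally have "node a b M i \<le> b" .
  moreover have "a \<le> node a b M (i - 1)" using h by (simp add: node_def)
  ultimately show ?thesis by (auto simp: elem_def)
qed

lemma interval_minus_elems:
  assumes "a < b" "M \<ge> 1"
  shows "{a<..<b} - (\<Union>i\<in>{1..M}. elem a b M i) \<subseteq> node a b M ` {..M}"
proof
  fix x assume x: "x \<in> {a<..<b} - (\<Union>i\<in>{1..M}. elem a b M i)"
  have h: "mesh a b M > 0" using assms by (simp add: mesh_def)
  define t where "t = (x - a) / mesh a b M"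
  have xt: "x = a + t * mesh a b M" using h by (simp add: t_def)
  have t0: "t > 0" using x h by (simp add: t_def)
  have "b = a + real M * mesh a b M" using assms by (simp add: mesh_def)
  then have "t * mesh a b M < real M * mesh a b M" using x xt by simp
  then have tM: "t < real M" using h by simp
  \<comment> \<open>Rounding up numbers the element that contains x, unless t is an integer, in
    which case x is a node.\<close>
  define i where "i = nat \<lceil>t\<rceil>"
  have i: "real i \<ge> t" "real i < t + 1" "i \<ge> 1" using t0 unfolding i_def by linarith+
  have iM: "i \<le> M" using tM unfolding i_def by linarith
  show "x \<in> node a b M ` {..M}"
  proof (cases "t = real i")
    case True
    then have "x = node a b M i" using xt by (simp add: node_def)
    then show ?thesis using iM by blast
  next
    case False
    then have "real i - 1 < t" "t < real i" using i by auto
    then have "(real i - 1) * mesh a b M < t * mesh a b M" "t * mesh a b M < real i * mesh a b M"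
      using h by (simp_all only: mult_less_cancel_right_pos)
    then have "x \<in> elem a b M i" using i(3) xt by (simp add: elem_def node_def of_nat_diff)
    then show ?thesis using x i(3) iM by auto
  qed
qed

text \<open>The elements miss only nodes, a finite and hence negligible set. Integrability on the
  elements is assumed because a nonintegrable square would have integral 0 by convention.\<close>

lemma L2norm_partition:
  assumes ab: "a < b" "M \<ge> 1" and f: "\<And>i. i \<in> {1..M} \<Longrightarrow> set_integrable lebesgue (elem a b M i) (\<lambda>x. (f x)\<^sup>2)"
  shows "(L2norm {a<..<b} f)\<^sup>2 = (\<Sum>i=1..M. (L2norm (elem a b M i) f)\<^sup>2)"
proof -
  let ?U = "\<Union>i\<in>{1..M}. elem a b M i" and ?g = "\<lambda>x. (f x)\<^sup>2"
  have S: "elem a b M i \<in> sets lebesgue" for i by (simp add: elem_def)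
  have fU: "set_integrable lebesgue ?U ?g" by (intro set_integrable_UN f S) auto
  have n1: "negligible {x \<in> ?U - {a<..<b}. ?g x \<noteq> 0}"
    using elem_subset[OF ab(1)] by (intro negligible_subset[OF negligible_empty]) blast
  have n2: "negligible {x \<in> {a<..<b} - ?U. ?g x \<noteq> 0}"
    by (rule negligible_subset[OF negligible_finite[of "node a b M ` {..M}"]])
      (use interval_minus_elems[OF ab] in auto)
  have fI: "set_integrable lebesgue {a<..<b} ?g"
    using fU absolutely_integrable_spike_set_eq[OF n1 n2] by simp
  have "(LINT x:{a<..<b}|lebesgue. ?g x) = integral {a<..<b} ?g"
    by (rule set_lebesgue_integral_eq_integral(2)[OF fI])
  also have "\<dots> = integral ?U ?g" by (rule integral_spike_set[OF n2 n1])
  also have "\<dots> = (LINT x:?U|lebesgue. ?g x)" by (rule set_lebesgue_integral_eq_integral(2)[OF fU, symmetric])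
  also have "\<dots> = (\<Sum>i=1..M. LINT x:elem a b M i|lebesgue. ?g x)"
  proof (rule set_integral_finite_Union)
    show "disjoint_family_on (elem a b M) {1..M}"
      unfolding disjoint_family_on_def using elem_unique[OF ab] by fastforce
  qed (auto simp: f S)
  finally have eq: "(LINT x:{a<..<b}|lebesgue. ?g x) = (\<Sum>i=1..M. LINT x:elem a b M i|lebesgue. ?g x)" .
  have nn: "(LINT x:S|lebesgue. ?g x) \<ge> 0" for S
    unfolding set_lebesgue_integral_def by (rule Bochner_Integration.integral_nonneg) simp
  show ?thesis unfolding L2norm_def using eq nn by (simp add: sum_nonneg)
qed

text \<open>For e N < 2 s + 2 the cut-off index leaves no room for s derivative steps. There the
  factor \<open>q powr - (2 * real s + 2)\<close> makes the exponential term at least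
  \<open>nsq v\<close>, and contraction suffices.\<close>

lemma ref_projection_sobolev_error:
  assumes sys: "pswf_system c chi \<psi>" and N: "N \<ge> 1" and q: "0 < q" "q < 1"
    and c: "c \<ge> 0" "c / sqrt (chi N) \<le> q / root 6 2" and e: "e = sqrt ((q - q\<^sup>2) / 128)"
    and r: "r > 0" and s: "s \<ge> 1" and u: "u \<in> sobolev_space s {m - r<..<m + r}"
  defines "v \<equiv> \<lambda>y. u (m + r * y)" and "vs \<equiv> \<lambda>y. weak_deriv s {m - r<..<m + r} u (m + r * y)"
  shows "nsq (\<lambda>x. ref_projection \<psi> N v x - v x)
    \<le> 2 * (2 / e\<^sup>2) ^ s * ((2 * r / real N) ^ s)\<^sup>2 * nsq vs
      + ((sqrt 2 / q + q powr - (2 * real s + 2)) * q powr (e * real N))\<^sup>2 * nsq v"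
    (is "?E \<le> ?A + ?B")
proof -
  have vL: "v \<in> L2_space Iref"
    using u unfolding v_def by (intro affine_L2[OF r]) (simp add: sobolev_space_def)
  have "q\<^sup>2 < q" using q by (simp add: power2_eq_square)
  then have e0: "e > 0" by (simp add: e)
  have A0: "?A \<ge> 0" using e0 r by (intro mult_nonneg_nonneg ip_nonneg) auto
  define D3 where "D3 = q powr - (2 * real s + 2)"
  define Q where "Q = q powr (e * real N)"
  have pos: "D3 > 0" "Q > 0" using q by (auto simp: D3_def Q_def)
  show ?thesis
  proof (cases "e * real N < 2 * real s + 2")
    case True
    have "1 = q powr 0" using q by simp
    also have "\<dots> \<le> q powr (- (2 * real s + 2) + e * real N)" using True q by (intro powr_mono') auto
    also have "\<dots> = D3 * Q" by (simp add: D3_def Q_def powr_add)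
    also have "\<dots> \<le> (sqrt 2 / q + D3) * Q" using pos q by (intro mult_right_mono) auto
    finally have "1\<^sup>2 \<le> ((sqrt 2 / q + D3) * Q)\<^sup>2" by (intro power_mono) auto
    then have "nsq v \<le> ?B" unfolding D3_def Q_def
      using mult_right_mono[OF _ ip_nonneg[of v], of 1] by simp
    then show ?thesis using ref_projection_contract[OF sys vL, of N] A0 by linarith
  next
    case False
    \<comment> \<open>K serves both as cut-off index and as the number of applications of the
      operator. Rounding down loses less than 1, which costs the factor 1 / q.\<close>
    define K where "K = nat \<lfloor>e * real N\<rfloor>"
    have K: "real K \<le> e * real N" "e * real N - 1 \<le> real K" using False unfolding K_def by linarith+
    have sK: "s \<le> Suc K" using K(2) False by linarith
    have one: "1 \<le> e * real N" using False by linarith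
    define L where "L = Suc K - s"
    have L: "Suc K = L + s" "real L = real K + 1 - real s" using sK by (auto simp: L_def of_nat_diff)
    have "?E \<le> 2 * q ^ (2 * K) * nsq v + 2 * tail (Suc K) (coef v)"
      using ref_projection_decay[OF sys vL N q c e one K(1) K(1)] by (simp add: tail_def)
    moreover have "2 * q ^ (2 * K) * nsq v \<le> ?B"
    proof -
      have "q ^ K = q powr real K" using q by (simp add: powr_realpow)
      also have "\<dots> \<le> q powr (e * real N - 1)" using K(2) q by (intro powr_mono') auto
      also have "\<dots> = Q / q" using q by (simp add: Q_def powr_diff)
      finally have "sqrt 2 * q ^ K \<le> sqrt 2 * (Q / q)" by (rule mult_left_mono) simp
      also have "\<dots> = sqrt 2 / q * Q" by simp
      also have "\<dots> \<le> (sqrt 2 / q + D3) * Q" using pos by (intro mult_right_mono) auto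
      finally have "(sqrt 2 * q ^ K)\<^sup>2 \<le> ((sqrt 2 / q + D3) * Q)\<^sup>2" using q by (intro power_mono) auto
      then have "2 * q ^ (2 * K) \<le> ((sqrt 2 / q + D3) * Q)\<^sup>2"
        by (simp add: power_mult_distrib power_mult[symmetric] mult.commute)
      then show ?thesis unfolding D3_def Q_def by (rule mult_right_mono[OF _ ip_nonneg])
    qed
    moreover have "2 * tail (Suc K) (coef v) \<le> ?A"
    proof -
      have t: "tail (Suc K) (coef v) \<le> (2 / (real L + 1)\<^sup>2) ^ s * (r ^ s)\<^sup>2 * nsq vs"
        unfolding L(1) v_def vs_def by (rule sobolev_coef_tail_affine[OF r s u])
      \<comment> \<open>Half of e N covers the s + 1 indices lost, so L is still of order e
        N.\<close>
      have "e * real N / 2 \<le> real L + 1" using K(2) False unfolding L(2) by linarith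
      then have "(e * real N / 2)\<^sup>2 \<le> (real L + 1)\<^sup>2" using one by (intro power_mono) auto
      then have "2 / (real L + 1)\<^sup>2 \<le> 2 / (e * real N / 2)\<^sup>2"
        using one by (intro divide_left_mono mult_pos_pos zero_less_power) auto
      then have "(2 / (real L + 1)\<^sup>2) ^ s \<le> (2 / (e * real N / 2)\<^sup>2) ^ s" by (intro power_mono) auto
      then have "(2 / (real L + 1)\<^sup>2) ^ s * (r ^ s)\<^sup>2 \<le> (2 / (e * real N / 2)\<^sup>2) ^ s * (r ^ s)\<^sup>2"
        by (rule mult_right_mono) simp
      also have "\<dots> = (2 / (e * real N / 2)\<^sup>2 * r\<^sup>2) ^ s"
        by (simp only: power_mult_distrib power_mult[symmetric] mult.commute)
      also have "2 / (e * real N / 2)\<^sup>2 * r\<^sup>2 = 2 / e\<^sup>2 * (2 * r / real N)\<^sup>2"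
        using e0 N by (simp add: field_simps power2_eq_square)
      also have "(2 / e\<^sup>2 * (2 * r / real N)\<^sup>2) ^ s = (2 / e\<^sup>2) ^ s * ((2 * r / real N) ^ s)\<^sup>2"
        by (simp only: power_mult_distrib power_mult[symmetric] mult.commute)
      finally have "(2 / (real L + 1)\<^sup>2) ^ s * (r ^ s)\<^sup>2 * nsq vs \<le> (2 / e\<^sup>2) ^ s * ((2 * r / real N) ^ s)\<^sup>2 * nsq vs"
        by (rule mult_right_mono[OF _ ip_nonneg])
      with t show ?thesis by (simp only: mult.assoc)
    qed
    ultimately show ?thesis by linarith
  qed
qed

theorem theorem1:
  fixes a b q :: real and \<sigma> :: nat
  assumes "a < b" and "0 < q" and "q < 1" and "\<sigma> \<ge> 1"
  shows "\<exists>D>0. \<exists>\<delta>>0.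
    \<forall>(M::nat) (N::nat) (c::real) (chi::nat \<Rightarrow> real) (\<psi>::nat \<Rightarrow> real \<Rightarrow> real).
      M \<ge> 1 \<longrightarrow> N \<ge> 1 \<longrightarrow> c \<ge> 0 \<longrightarrow> pswf_system c chi \<psi> \<longrightarrow>
      c / sqrt (chi N) \<le> q / root 6 2 \<longrightarrow>
      (\<forall>u \<in> broken_sobolev a b M \<sigma>.
        L2norm {a<..<b} (\<lambda>x. piecewise_projection \<psi> a b M N u x - u x)
        \<le> D * (sqrt (real N) * (mesh a b M / real N) ^ \<sigma> * broken_seminorm a b M \<sigma> u
               + 1 / sqrt (\<delta> * ln (1 / q)) * q powr (\<delta> * real N) * L2norm {a<..<b} u))"
proof -
  define e where "e = sqrt ((q - q\<^sup>2) / 128)"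
  have "q\<^sup>2 < q" using assms by (simp add: power2_eq_square)
  then have e0: "e > 0" by (simp add: e_def)
  define \<kappa> where "\<kappa> = sqrt (e * ln (1 / q))"
  have \<kappa>: "\<kappa> > 0" using e0 assms by (simp add: \<kappa>_def)
  define C1 where "C1 = 2 * (2 / e\<^sup>2) ^ \<sigma>"
  define C2 where "C2 = sqrt 2 / q + q powr - (2 * real \<sigma> + 2)"
  have C: "C1 > 0" "C2 > 0" using e0 assms by (auto simp: C1_def C2_def add_pos_pos)
  \<comment> \<open>The factor 1 / \<kappa> in front of the exponential term depends on q only;
    writing C2 = C2 \<kappa> / \<kappa> moves it into D.\<close>
  define D where "D = sqrt C1 + C2 * \<kappa>"
  have D: "D > 0" "sqrt C1 \<le> D" "C2 * \<kappa> \<le> D" using C \<kappa> by (auto simp: D_def add_pos_pos)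
  have main: "L2norm {a<..<b} (\<lambda>x. piecewise_projection \<psi> a b M N u x - u x)
        \<le> D * (sqrt (real N) * (mesh a b M / real N) ^ \<sigma> * broken_seminorm a b M \<sigma> u
               + 1 / \<kappa> * q powr (e * real N) * L2norm {a<..<b} u)"
    if M: "M \<ge> 1" and N: "N \<ge> 1" and c: "c \<ge> 0" "c / sqrt (chi N) \<le> q / root 6 2"
      and sys: "pswf_system c chi \<psi>" and u: "u \<in> broken_sobolev a b M \<sigma>"
    for M N :: nat and c chi \<psi> u
  proof -
    define r where "r = mesh a b M / 2"
    have r: "r > 0" using assms M by (simp add: r_def mesh_def)
    define err where "err x = piecewise_projection \<psi> a b M N u x - u x" for x
    define X where "X = (mesh a b M / real N) ^ \<sigma> * broken_seminorm a b M \<sigma> u"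
    define Y where "Y = q powr (e * real N) * L2norm {a<..<b} u"
    have X0: "X \<ge> 0" using r by (auto simp: X_def r_def broken_seminorm_def intro!: mult_nonneg_nonneg sum_nonneg)
    have L0: "L2norm S f \<ge> 0" for S f
      by (auto simp: L2norm_def set_lebesgue_integral_def intro!: Bochner_Integration.integral_nonneg)
    have Y0: "Y \<ge> 0" using L0 by (simp add: Y_def)
    have el: "set_integrable lebesgue (elem a b M i) (\<lambda>x. (err x)\<^sup>2) \<and>
        set_integrable lebesgue (elem a b M i) (\<lambda>x. (u x)\<^sup>2) \<and>
        (L2norm (elem a b M i) err)\<^sup>2 \<le> C1 * ((mesh a b M / real N) ^ \<sigma>)\<^sup>2 * (L2norm (elem a b M i) (weak_deriv \<sigma> (elem a b M i) u))\<^sup>2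
          + (C2 * q powr (e * real N))\<^sup>2 * (L2norm (elem a b M i) u)\<^sup>2" if i: "i \<in> {1..M}" for i
    proof -
      define m where "m = midpt a b M i"
      have S: "elem a b M i = {m - r<..<m + r}" using i by (simp add: elem_eq m_def r_def)
      have us: "u \<in> sobolev_space \<sigma> {m - r<..<m + r}" using u i unfolding broken_sobolev_def S[symmetric] by blast
      define v where "v y = u (m + r * y)" for y
      define vs where "vs y = weak_deriv \<sigma> {m - r<..<m + r} u (m + r * y)" for y
      let ?w = "\<lambda>y. ref_projection \<psi> N v y - v y"
      have uL: "u \<in> L2_space {m - r<..<m + r}" using us by (simp add: sobolev_space_def)
      have vL: "v \<in> L2_space Iref" unfolding v_def by (rule affine_L2[OF r uL])
      have pb: "pullback a b M i u = v" by (auto simp: pullback_def v_def m_def r_def add.commute)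
      have w: "err (m + r * y) = ?w y" if y: "y \<in> Iref" for y
      proof -
        have x: "m + r * y \<in> elem a b M i" unfolding S using affine_in_interval[OF r] y by blast
        have "piecewise_projection \<psi> a b M N u (m + r * y) =
          (\<Sum>j = 1..M. if j = i then ref_projection \<psi> N v y else 0)"
          unfolding piecewise_projection_def
        proof (rule sum.cong)
          fix j assume j: "j \<in> {1..M}"
          show "(if m + r * y \<in> elem a b M j then ref_projection \<psi> N (pullback a b M j u) ((m + r * y - midpt a b M j) / (mesh a b M / 2)) else 0)
            = (if j = i then ref_projection \<psi> N v y else 0)"
          proof (cases "j = i")
            case True
            have "(m + r * y - m) / r = y" using r by simp
            then show ?thesis using True x by (simp add: pb m_def r_def)
          next
            case False
            then have "m + r * y \<notin> elem a b M j" using elem_unique[OF assms(1) M _ x] i j by auto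
            then show ?thesis using False by simp
          qed
        qed simp
        then show ?thesis using i by (simp add: err_def v_def)
      qed
      have wL: "?w \<in> L2_space Iref" by (rule ref_projection_error(1)[OF sys vL])
      have "set_integrable lebesgue Iref (\<lambda>y. (err (m + r * y))\<^sup>2) \<longleftrightarrow> set_integrable lebesgue Iref (\<lambda>y. (?w y)\<^sup>2)"
        by (rule set_integrable_cong) (auto simp: w)
      then have 1: "set_integrable lebesgue (elem a b M i) (\<lambda>x. (err x)\<^sup>2)"
        using wL unfolding S affine_LINT(2)[OF r] by (simp add: L2_space_def)
      have 2: "set_integrable lebesgue (elem a b M i) (\<lambda>x. (u x)\<^sup>2)"
        using uL unfolding S by (simp add: L2_space_def)
      have "(L2norm (elem a b M i) err)\<^sup>2 = r * nsq (\<lambda>y. err (m + r * y))"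
        unfolding S by (rule affine_L2norm[OF r])
      also have "nsq (\<lambda>y. err (m + r * y)) = nsq ?w" by (rule ip_cong) (auto simp: w)
      also have "r * nsq ?w \<le> r * (C1 * ((2 * r / real N) ^ \<sigma>)\<^sup>2 * nsq vs + (C2 * q powr (e * real N))\<^sup>2 * nsq v)"
        unfolding C1_def C2_def v_def vs_def
        by (rule mult_left_mono[OF ref_projection_sobolev_error[OF sys N assms(2,3) c e_def r assms(4) us]]) (use r in simp)
      also have "\<dots> = C1 * ((2 * r / real N) ^ \<sigma>)\<^sup>2 * (r * nsq vs) + (C2 * q powr (e * real N))\<^sup>2 * (r * nsq v)"
        by (simp only: distrib_left mult_ac)
      also have "r * nsq vs = (L2norm (elem a b M i) (weak_deriv \<sigma> (elem a b M i) u))\<^sup>2"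
        unfolding S vs_def by (rule affine_L2norm[OF r, symmetric])
      also have "r * nsq v = (L2norm (elem a b M i) u)\<^sup>2"
        unfolding S v_def by (rule affine_L2norm[OF r, symmetric])
      also have "2 * r = mesh a b M" by (simp add: r_def)
      finally show ?thesis using 1 2 by blast
    qed
    have "(L2norm {a<..<b} err)\<^sup>2 = (\<Sum>i=1..M. (L2norm (elem a b M i) err)\<^sup>2)"
      using el by (intro L2norm_partition assms M) auto
    also have "\<dots> \<le> (\<Sum>i=1..M. C1 * ((mesh a b M / real N) ^ \<sigma>)\<^sup>2 * (L2norm (elem a b M i) (weak_deriv \<sigma> (elem a b M i) u))\<^sup>2
          + (C2 * q powr (e * real N))\<^sup>2 * (L2norm (elem a b M i) u)\<^sup>2)"
      using el by (intro sum_mono) auto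
    also have "\<dots> = C1 * ((mesh a b M / real N) ^ \<sigma>)\<^sup>2 * (\<Sum>i=1..M. (L2norm (elem a b M i) (weak_deriv \<sigma> (elem a b M i) u))\<^sup>2)
          + (C2 * q powr (e * real N))\<^sup>2 * (\<Sum>i=1..M. (L2norm (elem a b M i) u)\<^sup>2)"
      by (simp add: sum.distrib sum_distrib_left)
    also have "(\<Sum>i=1..M. (L2norm (elem a b M i) (weak_deriv \<sigma> (elem a b M i) u))\<^sup>2) = (broken_seminorm a b M \<sigma> u)\<^sup>2"
      by (simp add: broken_seminorm_def sum_nonneg)
    also have "(\<Sum>i=1..M. (L2norm (elem a b M i) u)\<^sup>2) = (L2norm {a<..<b} u)\<^sup>2"
      using el by (intro L2norm_partition[symmetric] assms M) auto
    also have "C1 * ((mesh a b M / real N) ^ \<sigma>)\<^sup>2 * (broken_seminorm a b M \<sigma> u)\<^sup>2 + (C2 * q powr (e * real N))\<^sup>2 * (L2norm {a<..<b} u)\<^sup>2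
        = (sqrt C1 * X)\<^sup>2 + (C2 * Y)\<^sup>2"
      using C by (simp add: X_def Y_def power_mult_distrib mult.assoc)
    finally have "sqrt ((L2norm {a<..<b} err)\<^sup>2) \<le> sqrt ((sqrt C1 * X)\<^sup>2 + (C2 * Y)\<^sup>2)" by (rule real_sqrt_le_mono)
    also have "\<dots> \<le> sqrt C1 * X + C2 * Y"
      using X0 Y0 C by (intro sqrt_sum_squares_le_sum) auto
    finally have "L2norm {a<..<b} err \<le> sqrt C1 * X + C2 * Y" using L0 by simp
    also have "\<dots> \<le> D * (sqrt (real N) * X) + D * (1 / \<kappa> * Y)"
    proof (rule add_mono)
      have "X \<le> sqrt (real N) * X" using X0 N mult_right_mono[of 1 "sqrt (real N)" X] by simp
      then show "sqrt C1 * X \<le> D * (sqrt (real N) * X)" using D C X0 by (intro mult_mono) auto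
      have "C2 * Y = C2 * \<kappa> * (1 / \<kappa> * Y)" using \<kappa> by simp
      also have "\<dots> \<le> D * (1 / \<kappa> * Y)" using D Y0 \<kappa> by (intro mult_right_mono) auto
      finally show "C2 * Y \<le> D * (1 / \<kappa> * Y)" .
    qed
    finally show ?thesis unfolding err_def X_def Y_def by (simp only: distrib_left mult.assoc)
  qed
  show ?thesis
    by (intro exI[of _ D] exI[of _ e] conjI allI impI ballI D(1) e0 main[unfolded \<kappa>_def])
qed

end
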